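(* Let $S$ be a countable set. For any $p\in\,]0,1[$ and any $f\in H_1^2(\lambda_p^S\otimes\gamma^{\mathbb{N}})$, $$\mathrm{Var}(f)\log\frac{\mathrm{Var}(f)}{\sum_{s\in S}\|\Delta_s f\|_1^2+\sum_{i\in\mathbb{N}}\|\Delta_i f\|_1^2}\le c_{LS}(p)\sum_{s\in S}\mathbb{E}\left((\Delta_s f)^2\right)+2\sum_{i\in\mathbb{N}}\mathbb{E}\left(\left(\frac{\partial f}{\partial y_i}\right)^2\right),$$ where variance, expectations and norms are with respect to $\lambda_p^S\otimes\gamma^{\mathbb{N}}$.
   Context: $\beta_p=(1-p)\delta_0+p\delta_1$ on $\{0,1\}$, $\lambda_p^S=\beta_p^{\otimes S}$ on $\{0,1\}^S$; $\gamma$ is the standard Gaussian measure on $\mathbb{R}$ and $\gamma^{\mathbb{N}}=\gamma^{\otimes\mathbb{N}}$. Points of $\{0,1\}^S\times\mathbb{R}^{\mathbb{N}}$ are written $(x,y)$. $$c_{LS}(p)=\frac{\log p-\log(1-p)}{p-(1-p)}$$ (with $c_{LS}(1/2)=2$ by continuity). $\Delta_s f=f-\int f\,d\beta_p(x_s)$ for $s\in S$ and $\Delta_i f=f-\int f\,d\gamma(y_i)$ for $i\in\mathbb{N}$ (integration of one coordinate only). $\|f\|_1$ is the $L^1$ norm. The left-hand side is read as $0$ when $\mathrm{Var}(f)=0$. The space $H_1^2(\lambda_p^S\otimes\gamma^{\mathbb{N}})$ consists of the functions $f\in L^2(\lambda_p^S\otimes\gamma^{\mathbb{N}})$ such that for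 all $i\in\mathbb{N}$ there exists $h_i\in L^2(\lambda_p^S\otimes\gamma^{\mathbb{N}})$ with $$-\int_{\mathbb{R}}g'(y_i)f(x,y)\,dy_i=\int_{\mathbb{R}}g(y_i)h_i(x,y)\,dy_i\qquad \lambda_p^S\otimes\gamma^{\mathbb{N}}\text{-a.s.}$$ for every smooth compactly supported $g:\mathbb{R}\to\mathbb{R}$; $h_i$ is denoted $\frac{\partial f}{\partial y_i}$. *)

theory Defs
  imports "HOL-Probability.Probability"
begin

definition two_point_product :: "real \<Rightarrow> 's set \<Rightarrow> ('s \<Rightarrow> bool) measure" where
  "two_point_product p S = (\<Pi>\<^sub>M s\<in>S. measure_pmf (bernoulli_pmf p))"

definition gauss_product :: "(nat \<Rightarrow> real) measure" where
  "gauss_product = (\<Pi>\<^sub>M i\<in>UNIV. std_normal_distribution)"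

definition mixed_product :: "real \<Rightarrow> 's set \<Rightarrow> (('s \<Rightarrow> bool) \<times> (nat \<Rightarrow> real)) measure" where
  "mixed_product p S = two_point_product p S \<Otimes>\<^sub>M gauss_product"

definition L2_functions :: "'a measure \<Rightarrow> ('a \<Rightarrow> real) set" where
  "L2_functions M = {f \<in> borel_measurable M. integrable M (\<lambda>z. (f z)\<^sup>2)}"

text \<open>Values in \<^typ>\<open>ennreal\<close>, hence meaningful without any integrability assumption.\<close>

definition L1_norm :: "'a measure \<Rightarrow> ('a \<Rightarrow> real) \<Rightarrow> ennreal" where
  "L1_norm M f = (\<integral>\<^sup>+ z. ennreal \<bar>f z\<bar> \<partial>M)"

definition expect_sq :: "'a measure \<Rightarrow> ('a \<Rightarrow> real) \<Rightarrow> ennreal" where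
  "expect_sq M f = (\<integral>\<^sup>+ z. ennreal ((f z)\<^sup>2) \<partial>M)"

definition c_LS :: "real \<Rightarrow> real" where
  "c_LS p = (if p = 1/2 then 2 else (ln p - ln (1 - p)) / (p - (1 - p)))"

definition Delta_bool :: "real \<Rightarrow> 's \<Rightarrow> (('s \<Rightarrow> bool) \<times> (nat \<Rightarrow> real) \<Rightarrow> real)
    \<Rightarrow> ('s \<Rightarrow> bool) \<times> (nat \<Rightarrow> real) \<Rightarrow> real" where
  "Delta_bool p s f =
     (\<lambda>(x, y). f (x, y) - (\<integral>b. f (x(s := b), y) \<partial>measure_pmf (bernoulli_pmf p)))"

definition Delta_gauss :: "nat \<Rightarrow> (('s \<Rightarrow> bool) \<times> (nat \<Rightarrow> real) \<Rightarrow> real)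
    \<Rightarrow> ('s \<Rightarrow> bool) \<times> (nat \<Rightarrow> real) \<Rightarrow> real" where
  "Delta_gauss i f =
     (\<lambda>(x, y). f (x, y) - (\<integral>t. f (x, y(i := t)) \<partial>std_normal_distribution))"

definition test_function :: "(real \<Rightarrow> real) \<Rightarrow> bool" where
  "test_function g \<longleftrightarrow>
     (\<forall>n t. (deriv ^^ n) g differentiable (at t)) \<and> compact (closure {t. g t \<noteq> 0})"

text \<open>
  The integrals over the single coordinate \<open>y\<^sub>i\<close> are with respect to Lebesgue measure, as no
  Gaussian correction term appears in the integration by parts formula. For square integrable
  \<open>f\<close> and \<open>h\<close> they converge for almost every \<open>(x, y)\<close>, because \<open>g\<close> has compact support.
  The predicate determines \<open>h\<close> up to almost everywhere equality.
\<close>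

definition weak_partial :: "real \<Rightarrow> 's set \<Rightarrow> nat \<Rightarrow> (('s \<Rightarrow> bool) \<times> (nat \<Rightarrow> real) \<Rightarrow> real)
    \<Rightarrow> (('s \<Rightarrow> bool) \<times> (nat \<Rightarrow> real) \<Rightarrow> real) \<Rightarrow> bool" where
  "weak_partial p S i f h \<longleftrightarrow>
     h \<in> L2_functions (mixed_product p S) \<and>
     (\<forall>g. test_function g \<longrightarrow>
        (AE (x, y) in mixed_product p S.
           - (\<integral>t. deriv g t * f (x, y(i := t)) \<partial>lborel)
             = (\<integral>t. g t * h (x, y(i := t)) \<partial>lborel)))"

definition H12 :: "real \<Rightarrow> 's set \<Rightarrow> (('s \<Rightarrow> bool) \<times> (nat \<Rightarrow> real) \<Rightarrow> real) set" where
  "H12 p S = {f \<in> L2_functions (mixed_product p S). \<forall>i. \<exists>h. weak_partial p S i f h}"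

text \<open>
  The sums over \<open>S\<close> and over \<open>\<nat>\<close> may diverge, so the logarithm is extended
  continuously to \<open>[0, \<infinity>]\<close>. Division in \<^typ>\<open>ennreal\<close> satisfies \<open>a / \<infinity> = 0\<close> for
  \<open>a < \<infinity>\<close> and \<open>a / 0 = \<infinity>\<close> for \<open>a > 0\<close>.
\<close>

definition ext_ln :: "ennreal \<Rightarrow> ereal" where
  "ext_ln a = (if a = 0 then -\<infinity> else if a = \<infinity> then \<infinity> else ereal (ln (enn2real a)))"

end

theory Submission
  imports Defs "HOL-Real_Asymp.Real_Asymp"
begin

text \<open>
  The proof combines a martingale decomposition with logarithmic Sobolev inequalities, one for
  each coordinate (the method of Falik and Samorodnitsky). Write \<open>Ent(Y) = E(Y ln Y) - EY ln EY\<close>.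

  Let first \<open>f\<close> depend on finitely many coordinates only. Averaging the coordinates out one after
  the other writes \<open>f - Ef\<close> as a sum of orthogonal differences \<open>V\<^sub>j\<close>, where \<open>V\<^sub>j\<close> is an average of
  \<open>\<Delta>\<^sub>j f\<close>, so that \<open>\<parallel>V\<^sub>j\<parallel>\<^sub>1 \<le> \<parallel>\<Delta>\<^sub>j f\<parallel>\<^sub>1\<close> and the second moments \<open>E V\<^sub>j\<^sup>2\<close> add up to \<open>Var(f)\<close>.
  Jensen's inequality bounds each entropy from below,
  \<open>Ent(V\<^sup>2) \<ge> E V\<^sup>2 ln (E V\<^sup>2 / \<parallel>V\<parallel>\<^sub>1\<^sup>2)\<close> (\<open>square_rel_ent_lower_bound\<close>, in a linearized form
  with a free parameter \<open>r\<close>), while tensorization of entropy (\<open>entropy_tensorization\<close>) and the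
  logarithmic Sobolev inequalities of the single coordinates bound it from above by a weighted
  sum of the squared gradients of \<open>V\<^sub>j\<close>. These gradients are differences of averages of the
  gradient of \<open>f\<close>, hence orthogonal again, and the upper bounds add up to the right-hand side.
  This is \<open>energy_inequality\<close>; taking \<open>r\<close> to be the ratio of the variance and the sum of the
  squared \<open>L\<^sup>1\<close> norms gives the logarithm of the theorem.

  Entropy is handled through \<open>rel_ent x a = x ln (x/a) - x + a\<close>, which is nonnegative and satisfies
  \<open>Ent(Y) = E (rel_ent Y (EY))\<close>. All entropies are then integrals of nonnegative functions,
  with values in \<open>[0, \<infinity>]\<close> whether or not \<open>Y ln Y\<close> is integrable.

  Two inequalities in one variable are needed with their optimal constants. For a coin of bias
  \<open>p\<close> (\<open>two_point_log_sobolev\<close>) the difference of the two sides, as a function of one real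
  parameter, vanishes to second order at two points and is convex outside an interval between
  them and concave inside; hence it is nonnegative. The Gaussian inequality follows from the
  symmetric coin by the central limit theorem for functions with uniformly continuous derivative
  (\<open>gauss_log_sobolev_smooth\<close>) and extends to \<open>t \<mapsto> C + \<integral>\<^sub>0\<^sup>t h\<close> with \<open>h\<close> in \<open>L\<^sup>2\<close> of the Gaussian measure
  by approximation (\<open>gauss_lsi_L2\<close>), because \<open>h \<mapsto> \<integral>\<^sub>0\<^sup>t h\<close> is a contraction of this space.
  The defining property of the weak derivative holds almost surely for each test function
  separately. A countable family of test functions suffices to show that almost every
  one-dimensional section of \<open>f\<close> is such a primitive (\<open>weak_derivative_imp_primitive\<close>).

  Finally, for an exhausting sequence of finite sets of coordinates, the averages of \<open>f\<close> over the
  other coordinates converge to \<open>f\<close> in \<open>L\<^sup>2\<close> (\<open>avg_tendsto_L2\<close>), and averaging increases neither the \<open>L\<^sup>1\<close> norms nor the energies, so the bound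
  passes to the limit (\<open>mixed_energy_inequality\<close>).
\<close>

section \<open>Relative entropy of two numbers\<close>

text \<open>
  The Bregman divergence of \<open>x ln x\<close>. The linear terms make it nonnegative and cancel in expectation
  when \<open>a\<close> is the mean of \<open>x\<close>. With \<open>ln 0 = 0\<close> and \<open>x / 0 = 0\<close> the values at \<open>x = 0\<close> are the limits; for
  \<open>a = 0\<close> the definition is meaningful at \<open>x = 0\<close> only.
\<close>

definition rel_ent :: "real \<Rightarrow> real \<Rightarrow> real" where
  "rel_ent x a = x * ln (x / a) - x + a"

text \<open>
  The right-hand side is the tangent plane of the jointly convex, homogeneous function \<open>rel_ent\<close> at
  the points with \<open>x = w a\<close>. It reduces to \<open>ln z \<le> z - 1\<close> at \<open>z = w a / x\<close>.
\<close>

lemma rel_ent_ge_tangent: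
  assumes "x \<ge> 0" "a \<ge> 0" "a = 0 \<Longrightarrow> x = 0" "w > 0"
  shows "x * ln w + a - w * a \<le> rel_ent x a"
proof (cases "x = 0")
  case True
  then show ?thesis using assms by (simp add: rel_ent_def)
next
  case False
  then have x: "x > 0" and a: "a > 0" using assms by (auto simp: less_le)
  have "ln (w * a / x) \<le> w * a / x - 1"
    using x a assms by (intro ln_le_minus_one) auto
  then have "x * ln (w * a / x) \<le> x * (w * a / x - 1)"
    using x by (intro mult_left_mono) auto
  also have "\<dots> = w * a - x" using x by (simp add: field_simps)
  finally show ?thesis
    using x a assms by (simp add: rel_ent_def ln_div ln_mult algebra_simps)
qed

lemma rel_ent_nonneg:
  assumes "x \<ge> 0" "a \<ge> 0" "a = 0 \<Longrightarrow> x = 0"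
  shows "rel_ent x a \<ge> 0"
  using rel_ent_ge_tangent[of x a 1] assms by simp

lemma rel_ent_self [simp]: "rel_ent x x = 0"
  by (cases "x = 0") (auto simp: rel_ent_def)

lemma rel_ent_zero_left [simp]: "rel_ent 0 a = a"
  by (simp add: rel_ent_def)

lemma rel_ent_measurable [measurable]:
  assumes [measurable]: "f \<in> borel_measurable M" "g \<in> borel_measurable M"
  shows "(\<lambda>x. rel_ent (f x) (g x)) \<in> borel_measurable M"
  unfolding rel_ent_def by measurable

lemma ennreal_integral_le_nn_integral:
  fixes g :: "'a \<Rightarrow> real"
  assumes "integrable M g" "AE x in M. ennreal (g x) \<le> h x"
  shows "ennreal (integral\<^sup>L M g) \<le> (\<integral>\<^sup>+ x. h x \<partial>M)"
proof -
  have "ennreal (integral\<^sup>L M g) \<le> ennreal (\<integral>x. max 0 (g x) \<partial>M)"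
    using assms(1) by (intro ennreal_leI integral_mono) auto
  also have "\<dots> = (\<integral>\<^sup>+ x. ennreal (max 0 (g x)) \<partial>M)"
    using assms(1) by (intro nn_integral_eq_integral[symmetric]) auto
  also have "\<dots> \<le> (\<integral>\<^sup>+ x. h x \<partial>M)"
    using assms(2) by (intro nn_integral_mono_AE) (auto elim!: eventually_mono simp: max_def ennreal_neg)
  finally show ?thesis .
qed

context prob_space begin

text \<open>
  Jensen's inequality for the jointly convex function \<open>rel_ent\<close>: integrate the tangent plane at the
  point of means.
\<close>

lemma rel_ent_expectation_le:
  assumes Y: "integrable M Y" "AE x in M. Y x \<ge> 0"
    and Z: "integrable M Z" "AE x in M. Z x \<ge> 0"
    and YZ: "AE x in M. Z x = 0 \<longrightarrow> Y x = 0"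
  shows "ennreal (rel_ent (expectation Y) (expectation Z)) \<le> (\<integral>\<^sup>+ x. ennreal (rel_ent (Y x) (Z x)) \<partial>M)"
proof (cases "expectation Z = 0")
  case True
  then have "AE x in M. Z x = 0" using integral_nonneg_eq_0_iff_AE Z by blast
  then have "AE x in M. Y x = 0" using YZ by eventually_elim auto
  then have "expectation Y = 0" by (rule integral_eq_zero_AE)
  with True show ?thesis by simp
next
  case False
  then have EZ: "expectation Z > 0"
    using integral_nonneg_AE[OF Z(2)] by linarith
  show ?thesis
  proof (cases "expectation Y = 0")
    case True
    then have "AE x in M. Y x = 0" using integral_nonneg_eq_0_iff_AE Y by blast
    then have "AE x in M. ennreal (Z x) \<le> ennreal (rel_ent (Y x) (Z x))"
      by eventually_elim simp
    from ennreal_integral_le_nn_integral[OF Z(1) this] True show ?thesis by simp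
  next
    case False
    then have EY: "expectation Y > 0"
      using integral_nonneg_AE[OF Y(2)] by linarith
    \<comment> \<open>the slope of the tangent plane at the point of means\<close>
    define w where "w = expectation Y / expectation Z"
    have w: "w > 0" using EY EZ by (simp add: w_def)
    have AE: "AE x in M. ennreal (Y x * ln w + Z x - w * Z x) \<le> ennreal (rel_ent (Y x) (Z x))"
      using Y(2) Z(2) YZ by eventually_elim (intro ennreal_leI rel_ent_ge_tangent w, auto)
    have "expectation (\<lambda>x. Y x * ln w + Z x - w * Z x) =
        expectation Y * ln w + expectation Z - w * expectation Z"
      using Y Z by simp
    also have "\<dots> = rel_ent (expectation Y) (expectation Z)"
      using EZ by (simp add: w_def rel_ent_def)
    finally show ?thesis
      using ennreal_integral_le_nn_integral[OF _ AE] Y Z by simp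
  qed
qed

text \<open>
  Pointwise, \<open>rel_ent y c = rel_ent y a + rel_ent a c + ln (a/c) (y - a)\<close>, and the last term has mean zero
  when \<open>a\<close> is the mean.
\<close>

lemma rel_ent_chain:
  assumes Y: "integrable M Y" "AE x in M. Y x \<ge> 0" and c: "c > 0"
  shows "(\<integral>\<^sup>+ x. ennreal (rel_ent (Y x) c) \<partial>M)
    \<le> (\<integral>\<^sup>+ x. ennreal (rel_ent (Y x) (expectation Y)) \<partial>M) + ennreal (rel_ent (expectation Y) c)"
proof (cases "expectation Y = 0")
  case True
  then have "AE x in M. Y x = 0" using integral_nonneg_eq_0_iff_AE Y by blast
  then have "(\<integral>\<^sup>+ x. ennreal (rel_ent (Y x) c) \<partial>M) = (\<integral>\<^sup>+ x. ennreal c \<partial>M)"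
    by (intro nn_integral_cong_AE) (auto elim!: eventually_mono)
  with True show ?thesis by (simp add: emeasure_space_1)
next
  case False
  define a where "a = expectation Y"
  have a: "a > 0" using integral_nonneg_AE[OF Y(2)] False by (simp add: a_def)
  have [measurable]: "Y \<in> borel_measurable M" using Y by auto
  have AEn: "AE x in M. 0 \<le> rel_ent (Y x) a"
    using Y(2) by eventually_elim (use a in \<open>auto intro!: rel_ent_nonneg\<close>)
  show ?thesis
  proof (cases "(\<integral>\<^sup>+ x. ennreal (rel_ent (Y x) a) \<partial>M) = \<infinity>")
    case True
    then show ?thesis by (simp add: a_def)
  next
    case False
    have int: "integrable M (\<lambda>x. rel_ent (Y x) a)"
      using AEn False by (intro integrableI_nonneg) (auto simp: less_top)
    have eq: "AE x in M. rel_ent (Y x) c = rel_ent (Y x) a + rel_ent a c + ln (a / c) * (Y x - a)"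
      using Y(2)
    proof eventually_elim
      case (elim x)
      then show ?case using a c
        by (cases "Y x = 0") (auto simp: rel_ent_def ln_div algebra_simps)
    qed
    have int2: "integrable M (\<lambda>x. rel_ent (Y x) a + rel_ent a c + ln (a / c) * (Y x - a))"
      using int Y by auto
    have int3: "integrable M (\<lambda>x. rel_ent (Y x) c)"
      using int2 by (rule Bochner_Integration.integrable_cong_AE_imp) (use eq in \<open>auto elim!: eventually_mono\<close>)
    have AEc: "AE x in M. 0 \<le> rel_ent (Y x) c"
      using Y(2) by eventually_elim (use c in \<open>auto intro!: rel_ent_nonneg\<close>)
    have "expectation (\<lambda>x. rel_ent (Y x) c) = expectation (\<lambda>x. rel_ent (Y x) a + rel_ent a c + ln (a / c) * (Y x - a))"
      using eq by (intro integral_cong_AE) auto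
    also have "\<dots> = expectation (\<lambda>x. rel_ent (Y x) a) + rel_ent a c"
      using int Y by (simp add: prob_space a_def)
    finally have "expectation (\<lambda>x. rel_ent (Y x) c) = expectation (\<lambda>x. rel_ent (Y x) a) + rel_ent a c" .
    moreover have "rel_ent a c \<ge> 0" using a c by (intro rel_ent_nonneg) auto
    ultimately show ?thesis
      using nn_integral_eq_integral[OF int AEn] nn_integral_eq_integral[OF int3 AEc] integral_nonneg_AE[OF AEn]
      by (simp add: a_def[symmetric] ennreal_plus)
  qed
qed

text \<open>
  Under the probability measure with density \<open>V\<^sup>2 / v\<close>, Jensen's inequality for the logarithm
  of \<open>sqrt v / \<bar>V\<bar>\<close> gives \<open>Ent(V\<^sup>2) \<ge> v ln (v / m\<^sup>2)\<close>. The tangent inequality for \<open>v ln (v / m\<^sup>2)\<close> with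
  slope \<open>r\<close> replaces this by a bound that is affine in \<open>v\<close> and \<open>m\<^sup>2\<close> and can be summed over the
  terms of the martingale decomposition.
\<close>

lemma square_rel_ent_lower_bound:
  assumes V: "V \<in> borel_measurable M" "integrable M (\<lambda>x. (V x)\<^sup>2)" and r: "r > 0"
  defines "v \<equiv> expectation (\<lambda>x. (V x)\<^sup>2)" and "m \<equiv> expectation (\<lambda>x. \<bar>V x\<bar>)"
  shows "ennreal (v * ln r + v - r * m\<^sup>2) \<le> (\<integral>\<^sup>+ x. ennreal (rel_ent ((V x)\<^sup>2) v) \<partial>M)"
proof (cases "v = 0")
  case True
  then have "AE x in M. (V x)\<^sup>2 = 0" using integral_nonneg_eq_0_iff_AE[OF V(2)] unfolding v_def by simp
  then have "m = 0" unfolding m_def by (intro integral_eq_zero_AE) (auto elim!: eventually_mono)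
  with True show ?thesis by simp
next
  case False
  then have v: "v > 0" by (simp add: v_def less_le)
  have int: "integrable M (\<lambda>x. \<bar>V x\<bar>)" using V square_integrable_imp_integrable by blast
  have m: "m > 0"
  proof (rule ccontr)
    assume "\<not> m > 0"
    moreover have "m \<ge> 0" unfolding m_def by simp
    ultimately have "m = 0" by simp
    then have "AE x in M. \<bar>V x\<bar> = 0" using integral_nonneg_eq_0_iff_AE[OF int] unfolding m_def by simp
    then have "v = 0" unfolding v_def by (intro integral_eq_zero_AE) (auto elim!: eventually_mono)
    with v show False by simp
  qed
  \<comment> \<open>\<open>1 / b\<close> is the mean of \<open>sqrt v / \<bar>V\<bar>\<close> for the measure with density \<open>V\<^sup>2 / v\<close>;
    the logarithm is replaced by its tangent at this mean\<close>
  define b where "b = sqrt v / m"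
  have b: "b > 0" using v m by (simp add: b_def)
  have pw: "(2 + 2 * ln b) * (V x)\<^sup>2 - 2 * b * sqrt v * \<bar>V x\<bar> - (V x)\<^sup>2 + v \<le> rel_ent ((V x)\<^sup>2) v" for x
  proof (cases "V x = 0")
    case True
    then show ?thesis by (simp add: rel_ent_def)
  next
    case False
    define t where "t = \<bar>V x\<bar>"
    have t: "t > 0" "(V x)\<^sup>2 = t\<^sup>2" using False by (auto simp: t_def)
    have "ln (b * sqrt v / t) \<le> b * sqrt v / t - 1"
      using t v b by (intro ln_le_minus_one) auto
    then have "t\<^sup>2 * ln (b * sqrt v / t) \<le> t\<^sup>2 * (b * sqrt v / t - 1)"
      by (intro mult_left_mono) auto
    also have "\<dots> = b * sqrt v * t - t\<^sup>2" using t by (simp add: field_simps power2_eq_square)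
    also have "ln (b * sqrt v / t) = ln b + ln v / 2 - ln t"
      using t v b by (simp add: ln_div ln_mult ln_sqrt)
    finally have "t\<^sup>2 * (ln b + ln v / 2 - ln t) \<le> b * sqrt v * t - t\<^sup>2" .
    moreover have lnr: "ln (t\<^sup>2 / v) = 2 * ln t - ln v" using t v by (simp add: ln_div ln_realpow)
    ultimately show ?thesis unfolding rel_ent_def t(2) t_def[symmetric] lnr
      by (simp add: algebra_simps)
  qed
  have "expectation (\<lambda>x. (2 + 2 * ln b) * (V x)\<^sup>2 - 2 * b * sqrt v * \<bar>V x\<bar> - (V x)\<^sup>2 + v)
      = (2 + 2 * ln b) * v - 2 * b * sqrt v * m - v + v"
    using V int by (simp add: v_def[symmetric] m_def[symmetric] prob_space)
  also have "\<dots> = v * ln (v / m\<^sup>2)"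
    using v m by (simp add: b_def ln_div ln_sqrt ln_realpow algebra_simps)
  finally have eq: "expectation (\<lambda>x. (2 + 2 * ln b) * (V x)\<^sup>2 - 2 * b * sqrt v * \<bar>V x\<bar> - (V x)\<^sup>2 + v) = v * ln (v / m\<^sup>2)" .
  have "v * ln r + v - r * m\<^sup>2 \<le> v * ln (v / m\<^sup>2)"
    using rel_ent_ge_tangent[of v "m\<^sup>2" r] v m r by (simp add: rel_ent_def)
  then have "ennreal (v * ln r + v - r * m\<^sup>2) \<le> ennreal (v * ln (v / m\<^sup>2))" by (rule ennreal_leI)
  also have "\<dots> \<le> (\<integral>\<^sup>+ x. ennreal (rel_ent ((V x)\<^sup>2) v) \<partial>M)"
    unfolding eq[symmetric]
    by (rule ennreal_integral_le_nn_integral) (use V int pw in \<open>auto intro!: ennreal_leI\<close>)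
  finally show ?thesis .
qed

end

section \<open>Averaging over independent coordinates\<close>

lemma L2_functionsD:
  assumes "f \<in> L2_functions M"
  shows "f \<in> borel_measurable M" "integrable M (\<lambda>x. (f x)\<^sup>2)"
  using assms by (auto simp: L2_functions_def)

lemma L2_functions_mult_integrable:
  assumes "f \<in> L2_functions M" "g \<in> L2_functions M"
  shows "integrable M (\<lambda>x. f x * g x)"
proof (rule Bochner_Integration.integrable_bound)
  show "integrable M (\<lambda>x. (f x)\<^sup>2 + (g x)\<^sup>2)" "(\<lambda>x. f x * g x) \<in> borel_measurable M"
    using assms[THEN L2_functionsD(1)] assms[THEN L2_functionsD(2)] by auto
  have "norm (a * b) \<le> norm (a\<^sup>2 + b\<^sup>2)" for a b :: real
  proof -
    have "0 \<le> (\<bar>a\<bar> - \<bar>b\<bar>)\<^sup>2" by simp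
    then have "2 * (\<bar>a\<bar> * \<bar>b\<bar>) \<le> a\<^sup>2 + b\<^sup>2" by (simp add: power2_diff algebra_simps)
    moreover have "0 \<le> \<bar>a\<bar> * \<bar>b\<bar>" by simp
    ultimately have "\<bar>a\<bar> * \<bar>b\<bar> \<le> a\<^sup>2 + b\<^sup>2" by linarith
    then show ?thesis by (simp add: abs_mult)
  qed
  then show "AE x in M. norm (f x * g x) \<le> norm ((f x)\<^sup>2 + (g x)\<^sup>2)" by simp
qed

lemma L2_functions_add:
  assumes "f \<in> L2_functions M" "g \<in> L2_functions M"
  shows "(\<lambda>x. f x + g x) \<in> L2_functions M"
proof -
  have "integrable M (\<lambda>x. (f x)\<^sup>2 + (g x)\<^sup>2 + 2 * (f x * g x))"
    using assms[THEN L2_functionsD(2)] L2_functions_mult_integrable[OF assms] by auto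
  then show ?thesis
    using assms[THEN L2_functionsD(1)] by (auto simp: L2_functions_def power2_sum mult.assoc)
qed

lemma L2_functions_cmult:
  "f \<in> L2_functions M \<Longrightarrow> (\<lambda>x. c * f x) \<in> L2_functions M"
  by (auto simp: L2_functions_def power_mult_distrib)

lemma L2_functions_diff:
  assumes "f \<in> L2_functions M" "g \<in> L2_functions M"
  shows "(\<lambda>x. f x - g x) \<in> L2_functions M"
  using L2_functions_add[OF assms(1) L2_functions_cmult[OF assms(2), of "-1"]] by simp

lemma (in prob_space) L2_functions_integrable:
  "f \<in> L2_functions M \<Longrightarrow> integrable M f"
  using square_integrable_imp_integrable by (auto simp: L2_functions_def)

lemma (in prob_space) expectation_square_le:
  fixes X :: "'a \<Rightarrow> real"
  assumes "integrable M X" "integrable M (\<lambda>x. (X x)\<^sup>2)"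
  shows "(expectation X)\<^sup>2 \<le> expectation (\<lambda>x. (X x)\<^sup>2)"
  using variance_positive[of X] variance_eq[OF assms] by simp

text \<open>
  An axiomatic product space with coordinates indexed by \<open>'k\<close>: the point \<open>mrg I a b\<close> has the coordinates
  in \<open>I\<close> from \<open>a\<close> and the others from \<open>b\<close>. Independence of the coordinates is expressed by the fact
  that merging two independent points yields a point with the same law. Neither the
  coordinates nor their value spaces are mentioned, so that Boolean and real coordinates can be
  treated alike.
\<close>

locale resampling = prob_space M for M :: "'a measure" +
  fixes mrg :: "'k set \<Rightarrow> 'a \<Rightarrow> 'a \<Rightarrow> 'a"
  assumes mrg_measurable [measurable]: "(\<lambda>(a, b). mrg I a b) \<in> M \<Otimes>\<^sub>M M \<rightarrow>\<^sub>M M"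
    and mrg_distr: "distr (M \<Otimes>\<^sub>M M) M (\<lambda>(a, b). mrg I a b) = M"
    and mrg_mrg: "mrg J (mrg I a b) c = mrg (I \<inter> J) a (mrg J b c)"
    and mrg_absorb: "mrg I a (mrg I b c) = mrg I a c"
    and mrg_empty: "mrg {} a b = b"
    and mrg_UNIV: "mrg UNIV a b = a"
begin

sublocale MM: pair_prob_space M M ..

lemma measurable_mrg [measurable (raw)]:
  assumes "f \<in> N \<rightarrow>\<^sub>M M" "g \<in> N \<rightarrow>\<^sub>M M"
  shows "(\<lambda>x. mrg I (f x) (g x)) \<in> N \<rightarrow>\<^sub>M M"
  using measurable_compose[OF measurable_Pair[OF assms] mrg_measurable[of I]] by simp

text \<open>
  Merging preserves the measure, so almost sure statements may be read along the fibres on which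
  the coordinates in \<open>I\<close> are fixed.
\<close>

lemma AE_mrg:
  assumes "AE x in M. P x"
  shows "AE a in M. AE b in M. P (mrg I a b)"
proof -
  have "AE z in M \<Otimes>\<^sub>M M. P (case z of (a, b) \<Rightarrow> mrg I a b)"
    by (rule AE_distrD[OF mrg_measurable]) (simp only: mrg_distr assms)
  from MM.AE_pair[OF this] show ?thesis by simp
qed

lemma nn_integral_mrg:
  assumes [measurable]: "F \<in> borel_measurable M"
  shows "(\<integral>\<^sup>+ a. \<integral>\<^sup>+ b. F (mrg I a b) \<partial>M \<partial>M) = (\<integral>\<^sup>+ x. F x \<partial>M)"
proof -
  have "(\<integral>\<^sup>+ x. F x \<partial>M) = (\<integral>\<^sup>+ x. F x \<partial>(distr (M \<Otimes>\<^sub>M M) M (\<lambda>(a, b). mrg I a b)))"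
    by (simp only: mrg_distr)
  also have "\<dots> = (\<integral>\<^sup>+ z. F (case z of (a, b) \<Rightarrow> mrg I a b) \<partial>(M \<Otimes>\<^sub>M M))"
    by (rule nn_integral_distr) auto
  also have "\<dots> = (\<integral>\<^sup>+ a. \<integral>\<^sup>+ b. F (mrg I a b) \<partial>M \<partial>M)"
    by (subst nn_integral_fst[symmetric]) (auto simp: split_beta')
  finally show ?thesis by simp
qed

lemma integrable_mrg_pair:
  assumes "integrable M f"
  shows "integrable (M \<Otimes>\<^sub>M M) (\<lambda>z. f (mrg I (fst z) (snd z)))"
    and "(\<integral>z. f (mrg I (fst z) (snd z)) \<partial>(M \<Otimes>\<^sub>M M)) = (integral\<^sup>L M f :: real)"
proof -
  have [measurable]: "f \<in> borel_measurable M" using assms by auto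
  show "integrable (M \<Otimes>\<^sub>M M) (\<lambda>z. f (mrg I (fst z) (snd z)))"
    using assms integrable_distr[OF mrg_measurable, of I f] mrg_distr[of I] by (simp add: split_beta')
  show "(\<integral>z. f (mrg I (fst z) (snd z)) \<partial>(M \<Otimes>\<^sub>M M)) = integral\<^sup>L M f"
    using integral_distr[OF mrg_measurable, of f I] mrg_distr[of I] by (simp add: split_beta')
qed

text \<open>
  The conditional expectation given the coordinates in \<open>I\<close>, in the concrete form of an integral
  over the other coordinates. This version is a function of the coordinates in \<open>I\<close> at every point,
  not just almost everywhere. In particular \<open>avg (-{k})\<close> integrates out the coordinate \<open>k\<close>.
\<close>

definition avg :: "'k set \<Rightarrow> ('a \<Rightarrow> real) \<Rightarrow> 'a \<Rightarrow> real" where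
  "avg I f a = (\<integral>b. f (mrg I a b) \<partial>M)"

lemma avg_measurable [measurable]:
  assumes [measurable]: "f \<in> borel_measurable M"
  shows "avg I f \<in> borel_measurable M"
  unfolding avg_def by measurable

lemma
  assumes f: "integrable M f"
  shows AE_integrable_mrg: "AE a in M. integrable M (\<lambda>b. f (mrg I a b))"
    and integrable_avg: "integrable M (avg I f)"
    and integral_avg: "integral\<^sup>L M (avg I f) = integral\<^sup>L M f"
  using MM.AE_integrable_fst'[OF integrable_mrg_pair(1)[OF f, of I]]
    MM.integrable_fst'[OF integrable_mrg_pair(1)[OF f, of I]]
    MM.integral_fst'[OF integrable_mrg_pair(1)[OF f, of I]] integrable_mrg_pair(2)[OF f, of I]
  by (auto simp: avg_def[abs_def])

lemma avg_mrg: "avg I f (mrg I a b) = avg I f a"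
  by (simp add: avg_def mrg_mrg mrg_absorb)

lemma avg_mult_left:
  assumes "\<And>b. g (mrg I a b) = g a"
  shows "avg I (\<lambda>x. g x * f x) a = g a * avg I f a"
  by (simp add: avg_def assms)

lemma avg_empty: "avg {} f a = integral\<^sup>L M f"
  by (simp add: avg_def mrg_empty)

lemma avg_UNIV: "avg UNIV f a = f a"
  by (simp add: avg_def mrg_UNIV prob_space)

lemma avg_cong_AE:
  assumes [measurable]: "f \<in> borel_measurable M" "g \<in> borel_measurable M"
    and "AE x in M. f x = g x"
  shows "AE a in M. avg I f a = avg I g a"
  using AE_mrg[OF assms(3), of I] AE_space
proof eventually_elim
  case (elim a)
  note [measurable] = elim(2)
  show ?case unfolding avg_def using elim(1) by (intro integral_cong_AE) auto
qed

lemma avg_diff: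
  assumes "integrable M f" "integrable M g"
  shows "AE a in M. avg I (\<lambda>x. f x - g x) a = avg I f a - avg I g a"
  using AE_integrable_mrg[OF assms(1), of I] AE_integrable_mrg[OF assms(2), of I]
  by eventually_elim (simp add: avg_def)

text \<open>
  Applying the two averages in succession resamples twice, and two independent resamplings of the
  coordinates outside \<open>I \<inter> J\<close> combine to a single one by \<open>mrg_mrg\<close> and invariance of the measure.
\<close>

lemma avg_avg:
  assumes f: "integrable M f"
  shows "AE a in M. avg I (avg J f) a = avg (I \<inter> J) f a"
  using AE_integrable_mrg[OF f, of "I \<inter> J"] AE_space
proof eventually_elim
  case (elim a)
  have "avg I (avg J f) a = (\<integral>b. \<integral>c. f (mrg (I \<inter> J) a (mrg J b c)) \<partial>M \<partial>M)"
    by (simp add: avg_def mrg_mrg)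
  also have "\<dots> = (\<integral>z. f (mrg (I \<inter> J) a (mrg J (fst z) (snd z))) \<partial>(M \<Otimes>\<^sub>M M))"
    using MM.integral_fst'[OF integrable_mrg_pair(1)[OF elim(1), of J]] by simp
  also have "\<dots> = avg (I \<inter> J) f a"
    unfolding avg_def by (rule integrable_mrg_pair(2)[OF elim(1), of J])
  finally show ?case .
qed

lemma avg_commute:
  assumes "integrable M f"
  shows "AE a in M. avg I (avg J f) a = avg J (avg I f) a"
  using avg_avg[OF assms, of I J] avg_avg[OF assms, of J I] by eventually_elim (simp add: Int_commute)

lemma avg_square_le:
  assumes "f \<in> L2_functions M"
  shows "AE a in M. (avg I f a)\<^sup>2 \<le> avg I (\<lambda>x. (f x)\<^sup>2) a"
  using AE_integrable_mrg[OF L2_functions_integrable[OF assms], of I]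
    AE_integrable_mrg[OF L2_functionsD(2)[OF assms], of I]
  by eventually_elim (auto simp: avg_def intro!: expectation_square_le)

lemma avg_L2:
  assumes f: "f \<in> L2_functions M"
  shows "avg I f \<in> L2_functions M"
proof -
  have [measurable]: "f \<in> borel_measurable M" using L2_functionsD[OF f] by simp
  have "integrable M (\<lambda>x. (avg I f x)\<^sup>2)"
  proof (rule Bochner_Integration.integrable_bound[OF integrable_avg[OF L2_functionsD(2)[OF f], of I]])
    show "AE x in M. norm ((avg I f x)\<^sup>2) \<le> norm (avg I (\<lambda>x. (f x)\<^sup>2) x)"
      using avg_square_le[OF f, of I] by eventually_elim auto
  qed auto
  then show ?thesis by (simp add: L2_functions_def)
qed

text \<open>
  \<open>avg I\<close> is an orthogonal projection; this is the relation from which the Pythagorean identity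
  \<open>integral_square_minus_avg\<close> follows.
\<close>

lemma integral_mult_avg:
  assumes f: "f \<in> L2_functions M"
  shows "(\<integral>x. avg I f x * f x \<partial>M) = (\<integral>x. (avg I f x)\<^sup>2 \<partial>M)"
proof -
  have "(\<integral>x. avg I f x * f x \<partial>M) = integral\<^sup>L M (avg I (\<lambda>x. avg I f x * f x))"
    by (rule integral_avg[symmetric]) (intro L2_functions_mult_integrable avg_L2 f)
  also have "avg I (\<lambda>x. avg I f x * f x) = (\<lambda>x. (avg I f x)\<^sup>2)"
    by (rule ext, subst avg_mult_left) (auto simp: avg_mrg power2_eq_square)
  finally show ?thesis .
qed

lemma integral_square_minus_avg:
  assumes f: "f \<in> L2_functions M"
  shows "(\<integral>x. (f x - avg I f x)\<^sup>2 \<partial>M) = (\<integral>x. (f x)\<^sup>2 \<partial>M) - (\<integral>x. (avg I f x)\<^sup>2 \<partial>M)"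
proof -
  note i = L2_functionsD(2)[OF f] L2_functionsD(2)[OF avg_L2[OF f], of I]
    L2_functions_mult_integrable[OF avg_L2[OF f] f, of I]
  have "(\<lambda>x. (f x - avg I f x)\<^sup>2) = (\<lambda>x. (f x)\<^sup>2 + (avg I f x)\<^sup>2 - 2 * (avg I f x * f x))"
    by (simp add: fun_eq_iff power2_diff)
  then show ?thesis using i by (simp add: integral_mult_avg[OF f])
qed

lemma integral_abs_avg_le:
  assumes f: "integrable M f"
  shows "(\<integral>x. \<bar>avg I f x\<bar> \<partial>M) \<le> (\<integral>x. \<bar>f x\<bar> \<partial>M)"
proof -
  have "(\<integral>x. \<bar>avg I f x\<bar> \<partial>M) \<le> integral\<^sup>L M (avg I (\<lambda>x. \<bar>f x\<bar>))"
    by (intro integral_mono integrable_abs integrable_avg f) (auto simp: avg_def)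
  also have "\<dots> = (\<integral>x. \<bar>f x\<bar> \<partial>M)" by (intro integral_avg integrable_abs f)
  finally show ?thesis .
qed

lemma AE_avg_nonneg:
  assumes "AE x in M. f x \<ge> 0"
  shows "AE x in M. avg I f x \<ge> 0"
  using AE_mrg[OF assms, of I] by eventually_elim (auto simp: avg_def intro!: integral_nonneg_AE)

text \<open>
  A nonnegative function vanishes almost everywhere on the fibres on which its average is zero. This
  excludes the degenerate second argument of \<open>rel_ent\<close>.
\<close>

lemma AE_avg_zero_imp_zero:
  assumes Y: "integrable M Y" "AE x in M. Y x \<ge> 0"
  shows "AE x in M. avg I Y x = 0 \<longrightarrow> Y x = 0"
proof -
  define g where "g x = indicat_real {0} (avg I Y x)" for x
  have [measurable]: "Y \<in> borel_measurable M" using Y by auto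
  have [measurable]: "g \<in> borel_measurable M" unfolding g_def by measurable
  have int: "integrable M (\<lambda>x. g x * Y x)"
    by (rule Bochner_Integration.integrable_bound[OF Y(1)]) (auto simp: g_def indicator_def)
  have "(\<integral>x. g x * Y x \<partial>M) = integral\<^sup>L M (avg I (\<lambda>x. g x * Y x))"
    by (rule integral_avg[symmetric, OF int])
  also have "avg I (\<lambda>x. g x * Y x) = (\<lambda>x. g x * avg I Y x)"
    by (rule ext, rule avg_mult_left) (simp add: g_def avg_mrg)
  also have "\<dots> = (\<lambda>x. 0)" by (auto simp: g_def indicator_def fun_eq_iff)
  finally have "(\<integral>x. g x * Y x \<partial>M) = 0" by simp
  moreover have nn: "AE x in M. 0 \<le> g x * Y x"
    using Y(2) by eventually_elim (auto simp: g_def)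
  ultimately have "AE x in M. g x * Y x = 0"
    using integral_nonneg_eq_0_iff_AE[OF int nn] by simp
  then show ?thesis by eventually_elim (auto simp: g_def)
qed

text \<open>
  Jensen's inequality on each fibre: averaging contracts relative entropy. With \<open>Z = avg (-{k}) Y\<close> it
  says that the mean entropy in the coordinate \<open>k\<close> decreases when other coordinates are averaged out.
\<close>

lemma rel_ent_avg_le:
  assumes Y: "integrable M Y" "AE x in M. Y x \<ge> 0"
    and Z: "integrable M Z" "AE x in M. Z x \<ge> 0"
    and YZ: "AE x in M. Z x = 0 \<longrightarrow> Y x = 0"
  shows "(\<integral>\<^sup>+ x. ennreal (rel_ent (avg I Y x) (avg I Z x)) \<partial>M) \<le> (\<integral>\<^sup>+ x. ennreal (rel_ent (Y x) (Z x)) \<partial>M)"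
proof -
  have [measurable]: "Y \<in> borel_measurable M" "Z \<in> borel_measurable M" using Y Z by auto
  have "AE a in M. ennreal (rel_ent (avg I Y a) (avg I Z a)) \<le> (\<integral>\<^sup>+ b. ennreal (rel_ent (Y (mrg I a b)) (Z (mrg I a b))) \<partial>M)"
    using AE_integrable_mrg[OF Y(1), of I] AE_integrable_mrg[OF Z(1), of I]
      AE_mrg[OF Y(2), of I] AE_mrg[OF Z(2), of I] AE_mrg[OF YZ, of I]
    by eventually_elim (auto simp: avg_def intro!: rel_ent_expectation_le)
  then have "(\<integral>\<^sup>+ a. ennreal (rel_ent (avg I Y a) (avg I Z a)) \<partial>M)
      \<le> (\<integral>\<^sup>+ a. \<integral>\<^sup>+ b. ennreal (rel_ent (Y (mrg I a b)) (Z (mrg I a b))) \<partial>M \<partial>M)"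
    by (rule nn_integral_mono_AE)
  also have "\<dots> = (\<integral>\<^sup>+ x. ennreal (rel_ent (Y x) (Z x)) \<partial>M)"
    by (rule nn_integral_mrg) measurable
  finally show ?thesis .
qed

lemma rel_ent_avg_chain:
  assumes Y: "integrable M Y" "AE x in M. Y x \<ge> 0" and c: "c > 0"
  shows "(\<integral>\<^sup>+ x. ennreal (rel_ent (Y x) c) \<partial>M) \<le>
    (\<integral>\<^sup>+ x. ennreal (rel_ent (Y x) (avg I Y x)) \<partial>M) + (\<integral>\<^sup>+ x. ennreal (rel_ent (avg I Y x) c) \<partial>M)"
proof -
  have [measurable]: "Y \<in> borel_measurable M" using Y by auto
  have "(\<integral>\<^sup>+ x. ennreal (rel_ent (Y x) c) \<partial>M) = (\<integral>\<^sup>+ a. \<integral>\<^sup>+ b. ennreal (rel_ent (Y (mrg I a b)) c) \<partial>M \<partial>M)"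
    by (rule nn_integral_mrg[symmetric]) measurable
  also have "\<dots> \<le> (\<integral>\<^sup>+ a. (\<integral>\<^sup>+ b. ennreal (rel_ent (Y (mrg I a b)) (avg I Y (mrg I a b))) \<partial>M) + ennreal (rel_ent (avg I Y a) c) \<partial>M)"
  proof (rule nn_integral_mono_AE)
    show "AE a in M. (\<integral>\<^sup>+ b. ennreal (rel_ent (Y (mrg I a b)) c) \<partial>M) \<le>
       (\<integral>\<^sup>+ b. ennreal (rel_ent (Y (mrg I a b)) (avg I Y (mrg I a b))) \<partial>M) + ennreal (rel_ent (avg I Y a) c)"
      using AE_integrable_mrg[OF Y(1), of I] AE_mrg[OF Y(2), of I]
    proof eventually_elim
      case (elim a)
      show ?case unfolding avg_mrg using rel_ent_chain[OF elim c] by (simp add: avg_def)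
    qed
  qed
  also have "\<dots> = (\<integral>\<^sup>+ a. (\<integral>\<^sup>+ b. ennreal (rel_ent (Y (mrg I a b)) (avg I Y (mrg I a b))) \<partial>M) \<partial>M)
      + (\<integral>\<^sup>+ x. ennreal (rel_ent (avg I Y x) c) \<partial>M)"
    by (rule nn_integral_add) measurable
  also have "(\<integral>\<^sup>+ a. (\<integral>\<^sup>+ b. ennreal (rel_ent (Y (mrg I a b)) (avg I Y (mrg I a b))) \<partial>M) \<partial>M) = (\<integral>\<^sup>+ x. ennreal (rel_ent (Y x) (avg I Y x)) \<partial>M)"
    by (rule nn_integral_mrg) measurable
  finally show ?thesis .
qed

text \<open>
  Average out the coordinates of \<open>J\<close> one by one. The chain rule \<open>rel_ent_avg_chain\<close> splits the entropy
  into one term for each coordinate \<open>k\<close>; this term is the entropy in \<open>k\<close> of an average of \<open>Y\<close>, hence at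
  most that of \<open>Y\<close> itself. All quantities may be infinite.
\<close>

lemma entropy_tensorization:
  assumes Y: "integrable M Y" "AE x in M. Y x \<ge> 0" and J: "finite J"
    and dep: "AE x in M. avg J Y x = Y x"
  shows "(\<integral>\<^sup>+ x. ennreal (rel_ent (Y x) (expectation Y)) \<partial>M)
    \<le> (\<Sum>k\<in>J. \<integral>\<^sup>+ x. ennreal (rel_ent (Y x) (avg (-{k}) Y x)) \<partial>M)"
proof (cases "expectation Y = 0")
  case True
  then have "AE x in M. Y x = 0" using integral_nonneg_eq_0_iff_AE Y by blast
  then have "(\<integral>\<^sup>+ x. ennreal (rel_ent (Y x) (expectation Y)) \<partial>M) = (\<integral>\<^sup>+ x. 0 \<partial>M)"
    by (intro nn_integral_cong_AE) (auto elim!: eventually_mono simp: True)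
  then show ?thesis by simp
next
  case False
  define c where "c = expectation Y"
  have [measurable]: "Y \<in> borel_measurable M" using Y by auto
  have c: "c > 0" using integral_nonneg_AE[OF Y(2)] False by (simp add: c_def)
  have "(\<integral>\<^sup>+ x. ennreal (rel_ent (Y x) c) \<partial>M)
    \<le> (\<Sum>k\<in>J. \<integral>\<^sup>+ x. ennreal (rel_ent (Y x) (avg (-{k}) Y x)) \<partial>M)
      + (\<integral>\<^sup>+ x. ennreal (rel_ent (avg (-J) Y x) c) \<partial>M)"
    using J
  proof (induction J)
    case empty
    show ?case by (simp add: avg_UNIV)
  next
    case (insert k J)
    let ?Z = "avg (-J) Y"
    have Z: "integrable M ?Z" "AE x in M. ?Z x \<ge> 0"
      using integrable_avg[OF Y(1)] AE_avg_nonneg[OF Y(2)] by auto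
    have eq: "- insert k J = -{k} \<inter> -J" by auto
    have 1: "AE x in M. avg (-{k}) ?Z x = avg (- insert k J) Y x"
      using avg_avg[OF Y(1), of "-{k}" "-J"] by (simp add: eq)
    have 2: "AE x in M. avg (-{k}) ?Z x = avg (-J) (avg (-{k}) Y) x"
      by (rule avg_commute[OF Y(1)])
    have "(\<integral>\<^sup>+ x. ennreal (rel_ent (?Z x) c) \<partial>M) \<le>
        (\<integral>\<^sup>+ x. ennreal (rel_ent (?Z x) (avg (-{k}) ?Z x)) \<partial>M) + (\<integral>\<^sup>+ x. ennreal (rel_ent (avg (-{k}) ?Z x) c) \<partial>M)"
      by (rule rel_ent_avg_chain[OF Z c])
    also have "(\<integral>\<^sup>+ x. ennreal (rel_ent (?Z x) (avg (-{k}) ?Z x)) \<partial>M)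
        = (\<integral>\<^sup>+ x. ennreal (rel_ent (avg (-J) Y x) (avg (-J) (avg (-{k}) Y) x)) \<partial>M)"
      using 2 by (intro nn_integral_cong_AE) (auto elim!: eventually_mono)
    also have "\<dots> \<le> (\<integral>\<^sup>+ x. ennreal (rel_ent (Y x) (avg (-{k}) Y x)) \<partial>M)"
      by (intro rel_ent_avg_le Y integrable_avg AE_avg_nonneg AE_avg_zero_imp_zero)
    also have "(\<integral>\<^sup>+ x. ennreal (rel_ent (avg (-{k}) ?Z x) c) \<partial>M) = (\<integral>\<^sup>+ x. ennreal (rel_ent (avg (- insert k J) Y x) c) \<partial>M)"
      using 1 by (intro nn_integral_cong_AE) (auto elim!: eventually_mono)
    finally have "(\<integral>\<^sup>+ x. ennreal (rel_ent (?Z x) c) \<partial>M) \<le> (\<integral>\<^sup>+ x. ennreal (rel_ent (Y x) (avg (-{k}) Y x)) \<partial>M)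
        + (\<integral>\<^sup>+ x. ennreal (rel_ent (avg (- insert k J) Y x) c) \<partial>M)" by (simp add: add_right_mono)
    from insert.IH this have "(\<integral>\<^sup>+ x. ennreal (rel_ent (Y x) c) \<partial>M)
      \<le> (\<Sum>k\<in>J. \<integral>\<^sup>+ x. ennreal (rel_ent (Y x) (avg (-{k}) Y x)) \<partial>M) + ((\<integral>\<^sup>+ x. ennreal (rel_ent (Y x) (avg (-{k}) Y x)) \<partial>M)
        + (\<integral>\<^sup>+ x. ennreal (rel_ent (avg (- insert k J) Y x) c) \<partial>M))"
      by (meson add_left_mono order_trans)
    then show ?case by (simp only: sum.insert[OF insert.hyps] ac_simps)
  qed
  also have "(\<integral>\<^sup>+ x. ennreal (rel_ent (avg (-J) Y x) c) \<partial>M) = (\<integral>\<^sup>+ x. 0 \<partial>M)"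
  proof (rule nn_integral_cong_AE)
    have "AE x in M. avg (-J) (avg J Y) x = avg (-J) Y x"
      using dep by (intro avg_cong_AE) auto
    with avg_avg[OF Y(1), of "-J" J]
    show "AE x in M. ennreal (rel_ent (avg (-J) Y x) c) = 0"
      by eventually_elim (simp add: Int_commute avg_empty c_def)
  qed
  finally show ?thesis by (simp add: c_def)
qed

lemma AE_avg_square_eq:
  assumes f: "f \<in> L2_functions M" and dep: "AE x in M. avg J f x = f x"
  shows "AE x in M. avg J (\<lambda>x. (f x)\<^sup>2) x = (f x)\<^sup>2"
proof -
  have [measurable]: "f \<in> borel_measurable M" using L2_functionsD[OF f] by simp
  have "AE x in M. avg J (\<lambda>x. (avg J f x)\<^sup>2) x = avg J (\<lambda>x. (f x)\<^sup>2) x"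
    using dep by (intro avg_cong_AE) (auto elim!: eventually_mono)
  moreover have "avg J (\<lambda>x. (avg J f x)\<^sup>2) a = (avg J f a)\<^sup>2" for a
    unfolding avg_def[of J "\<lambda>x. (avg J f x)\<^sup>2"] by (simp add: avg_mrg prob_space)
  ultimately have "AE x in M. (avg J f x)\<^sup>2 = avg J (\<lambda>x. (f x)\<^sup>2) x" by simp
  then show ?thesis using dep by eventually_elim simp
qed

text \<open>
  \<open>R k f h\<close> means that \<open>h\<close> is the gradient of \<open>f\<close> in the coordinate \<open>k\<close>; the hypotheses on \<open>R\<close> are that
  gradients commute with averaging, that subtracting a function which does not depend on \<open>k\<close> keeps the gradient,
  linearity, and the one-dimensional logarithmic Sobolev inequality.
  
  Induction on \<open>J\<close>: split off a coordinate \<open>k\<close> and put \<open>g = avg (-{k}) f\<close>, \<open>V = f - g\<close>. The induction hypothesis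
  applies to \<open>g\<close>, whose gradients are averages of those of \<open>f\<close>, and the lower bound on the entropy
  of \<open>V\<^sup>2\<close> together with tensorization applies to \<open>V\<close>. By orthogonality of \<open>g\<close> and \<open>V\<close>, and of their
  gradients, the two estimates add up to the claim.
\<close>

lemma energy_inequality:
  fixes R :: "'k \<Rightarrow> ('a \<Rightarrow> real) \<Rightarrow> ('a \<Rightarrow> real) \<Rightarrow> bool" and c :: "'k \<Rightarrow> real"
  assumes R_L2: "\<And>k f h. R k f h \<Longrightarrow> f \<in> L2_functions M \<and> h \<in> L2_functions M"
    and R_avg: "\<And>k l f h. R k f h \<Longrightarrow> k \<noteq> l \<Longrightarrow> R k (avg (-{l}) f) (avg (-{l}) h)"
    and R_self: "\<And>k f h. R k f h \<Longrightarrow> R k (\<lambda>x. f x - avg (-{k}) f x) h"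
    and R_diff: "\<And>k f h f' h'. R k f h \<Longrightarrow> R k f' h' \<Longrightarrow> R k (\<lambda>x. f x - f' x) (\<lambda>x. h x - h' x)"
    and R_lsi: "\<And>k f h. R k f h \<Longrightarrow>
      (\<integral>\<^sup>+ x. ennreal (rel_ent ((f x)\<^sup>2) (avg (-{k}) (\<lambda>x. (f x)\<^sup>2) x)) \<partial>M) \<le> ennreal (c k * (\<integral>x. (h x)\<^sup>2 \<partial>M))"
    and c: "\<And>k. c k \<ge> 0" and r: "r > 0"
    and J: "finite J"
    and "f \<in> L2_functions M" "AE x in M. avg J f x = f x" "\<And>k. k \<in> J \<Longrightarrow> R k f (h k)"
  shows "variance f * (ln r + 1) - r * (\<Sum>k\<in>J. (\<integral>x. \<bar>f x - avg (-{k}) f x\<bar> \<partial>M)\<^sup>2)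
     \<le> (\<Sum>k\<in>J. c k * (\<integral>x. (h k x)\<^sup>2 \<partial>M))"
  using J assms(9-)
proof (induction J arbitrary: f h)
  case empty
  have "variance f = 0"
    using empty.prems(2) by (intro integral_eq_zero_AE) (auto elim!: eventually_mono simp: avg_empty)
  then show ?case by simp
next
  case (insert k J)
  note f = insert.prems(1) and dep = insert.prems(2) and R = insert.prems(3)
  have fi: "integrable M f" using f by (rule L2_functions_integrable)
  define g where "g = avg (-{k}) f"
  define V where "V x = f x - g x" for x
  have g: "g \<in> L2_functions M" unfolding g_def by (rule avg_L2[OF f])
  have gi: "integrable M g" using g by (rule L2_functions_integrable)
  have V: "V \<in> L2_functions M" unfolding V_def[abs_def] by (rule L2_functions_diff[OF f g])
  have [measurable]: "f \<in> borel_measurable M" "g \<in> borel_measurable M" using f g by (auto dest: L2_functionsD)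
  have g_J: "AE x in M. avg J f x = g x"
  proof -
    have "AE x in M. avg (-{k}) (avg (insert k J) f) x = avg (-{k}) f x"
      using dep by (intro avg_cong_AE) auto
    moreover have "-{k} \<inter> insert k J = J" using insert.hyps by auto
    ultimately have "AE x in M. avg (-{k}) (avg (insert k J) f) x = avg J f x"
      using avg_avg[OF fi, of "-{k}" "insert k J"] by simp
    with \<open>AE x in M. avg (-{k}) (avg (insert k J) f) x = avg (-{k}) f x\<close> show ?thesis
      by eventually_elim (simp add: g_def)
  qed
  have g_dep: "AE x in M. avg J' g x = g x" if "J \<subseteq> J'" for J'
  proof -
    have "AE x in M. avg J' (avg J f) x = avg J' g x"
      using g_J by (intro avg_cong_AE) auto
    moreover have "J' \<inter> J = J" using that by auto
    ultimately have "AE x in M. avg J' (avg J f) x = avg J f x" using avg_avg[OF fi, of J' J] by simp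
    with \<open>AE x in M. avg J' (avg J f) x = avg J' g x\<close> g_J show ?thesis
      by eventually_elim simp
  qed
  have V_dep: "AE x in M. avg (insert k J) V x = V x"
    using avg_diff[OF fi gi, of "insert k J"] dep g_dep[OF subset_insertI]
    unfolding V_def[abs_def] by eventually_elim simp
  define v where "v = (\<integral>x. (V x)\<^sup>2 \<partial>M)"
  have Vsq: "integrable M (\<lambda>x. (V x)\<^sup>2)" using V by (rule L2_functionsD)
  have Rk: "R k V (h k)" unfolding V_def[abs_def] g_def using R by (intro R_self) auto
  have Rg: "R l g (avg (-{k}) (h l))" if "l \<in> J" for l
    unfolding g_def using that insert.hyps by (intro R_avg R) auto
  have RV: "R l V (\<lambda>x. h l x - avg (-{k}) (h l) x)" if "l \<in> J" for l
    unfolding V_def[abs_def] using that by (intro R_diff R Rg) auto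
  have hL2: "h l \<in> L2_functions M" if "l \<in> insert k J" for l using R[OF that] R_L2 by blast
  have "ennreal (v * ln r + v - r * (\<integral>x. \<bar>V x\<bar> \<partial>M)\<^sup>2) \<le> (\<integral>\<^sup>+ x. ennreal (rel_ent ((V x)\<^sup>2) v) \<partial>M)"
    unfolding v_def by (rule square_rel_ent_lower_bound[OF L2_functionsD[OF V] r])
  also have "\<dots> \<le> (\<Sum>l\<in>insert k J. \<integral>\<^sup>+ x. ennreal (rel_ent ((V x)\<^sup>2) (avg (-{l}) (\<lambda>x. (V x)\<^sup>2) x)) \<partial>M)"
    unfolding v_def using insert.hyps by (intro entropy_tensorization Vsq AE_avg_square_eq V V_dep) auto
  also have "\<dots> \<le> ennreal (c k * (\<integral>x. (h k x)\<^sup>2 \<partial>M)) + (\<Sum>l\<in>J. ennreal (c l * (\<integral>x. (h l x - avg (-{k}) (h l) x)\<^sup>2 \<partial>M)))"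
    unfolding sum.insert[OF insert.hyps] by (intro add_mono sum_mono R_lsi Rk RV)
  also have "\<dots> = ennreal (c k * (\<integral>x. (h k x)\<^sup>2 \<partial>M) + (\<Sum>l\<in>J. c l * (\<integral>x. (h l x - avg (-{k}) (h l) x)\<^sup>2 \<partial>M)))"
    using c by (simp add: sum_nonneg ennreal_plus sum_ennreal)
  finally have "v * ln r + v - r * (\<integral>x. \<bar>V x\<bar> \<partial>M)\<^sup>2 \<le>
     c k * (\<integral>x. (h k x)\<^sup>2 \<partial>M) + (\<Sum>l\<in>J. c l * (\<integral>x. (h l x - avg (-{k}) (h l) x)\<^sup>2 \<partial>M))"
    using c by (subst (asm) ennreal_le_iff) (auto intro!: add_nonneg_nonneg sum_nonneg)
  \<comment> \<open>Pythagoras for the gradients; the subtracted sum is what the induction hypothesis for \<open>g\<close> contributes\<close>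
  also have "(\<Sum>l\<in>J. c l * (\<integral>x. (h l x - avg (-{k}) (h l) x)\<^sup>2 \<partial>M)) =
     (\<Sum>l\<in>J. c l * (\<integral>x. (h l x)\<^sup>2 \<partial>M)) - (\<Sum>l\<in>J. c l * (\<integral>x. (avg (-{k}) (h l) x)\<^sup>2 \<partial>M))"
    unfolding sum_subtractf[symmetric] using hL2
    by (intro sum.cong refl) (simp add: integral_square_minus_avg right_diff_distrib)
  finally have 1: "v * ln r + v - r * (\<integral>x. \<bar>V x\<bar> \<partial>M)\<^sup>2 \<le> (\<Sum>l\<in>insert k J. c l * (\<integral>x. (h l x)\<^sup>2 \<partial>M))
     - (\<Sum>l\<in>J. c l * (\<integral>x. (avg (-{k}) (h l) x)\<^sup>2 \<partial>M))"
    using insert.hyps by simp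
  have IH: "variance g * (ln r + 1) - r * (\<Sum>l\<in>J. (\<integral>x. \<bar>g x - avg (-{l}) g x\<bar> \<partial>M)\<^sup>2)
     \<le> (\<Sum>l\<in>J. c l * (\<integral>x. (avg (-{k}) (h l) x)\<^sup>2 \<partial>M))"
    by (rule insert.IH) (use g g_dep Rg in auto)
  have "(\<integral>x. \<bar>g x - avg (-{l}) g x\<bar> \<partial>M) \<le> (\<integral>x. \<bar>f x - avg (-{l}) f x\<bar> \<partial>M)" for l
  proof -
    have "AE x in M. g x - avg (-{l}) g x = avg (-{k}) (\<lambda>x. f x - avg (-{l}) f x) x"
      using avg_commute[OF fi, of "-{l}" "-{k}"] avg_diff[OF fi integrable_avg[OF fi], of "-{k}" "-{l}"]
      by eventually_elim (simp add: g_def)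
    then have "(\<integral>x. \<bar>g x - avg (-{l}) g x\<bar> \<partial>M) = (\<integral>x. \<bar>avg (-{k}) (\<lambda>x. f x - avg (-{l}) f x) x\<bar> \<partial>M)"
      by (intro integral_cong_AE) (auto elim!: eventually_mono)
    also have "\<dots> \<le> (\<integral>x. \<bar>f x - avg (-{l}) f x\<bar> \<partial>M)"
      by (intro integral_abs_avg_le Bochner_Integration.integrable_diff fi integrable_avg)
    finally show ?thesis .
  qed
  then have "(\<Sum>l\<in>J. (\<integral>x. \<bar>g x - avg (-{l}) g x\<bar> \<partial>M)\<^sup>2) \<le> (\<Sum>l\<in>J. (\<integral>x. \<bar>f x - avg (-{l}) f x\<bar> \<partial>M)\<^sup>2)"
    by (intro sum_mono power_mono) auto
  then have 2: "r * (\<Sum>l\<in>J. (\<integral>x. \<bar>g x - avg (-{l}) g x\<bar> \<partial>M)\<^sup>2) \<le> r * (\<Sum>l\<in>J. (\<integral>x. \<bar>f x - avg (-{l}) f x\<bar> \<partial>M)\<^sup>2)"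
    using r by (intro mult_left_mono) auto
  \<comment> \<open>Pythagoras\<close>
  have 3: "variance f = variance g + v"
  proof -
    have "expectation g = expectation f" unfolding g_def by (rule integral_avg[OF fi])
    then show ?thesis
      using variance_eq[OF fi L2_functionsD(2)[OF f]] variance_eq[OF gi L2_functionsD(2)[OF g]]
        integral_square_minus_avg[OF f, of "-{k}"]
      by (simp add: v_def V_def g_def)
  qed
  have 4: "(\<Sum>l\<in>insert k J. (\<integral>x. \<bar>f x - avg (-{l}) f x\<bar> \<partial>M)\<^sup>2) =
     (\<integral>x. \<bar>V x\<bar> \<partial>M)\<^sup>2 + (\<Sum>l\<in>J. (\<integral>x. \<bar>f x - avg (-{l}) f x\<bar> \<partial>M)\<^sup>2)"
    using insert.hyps by (simp add: V_def g_def)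
  show ?case using 1 2 IH unfolding 3 4 by (simp add: algebra_simps)
qed

end

section \<open>The two-point logarithmic Sobolev inequality\<close>

text \<open>
  With \<open>t = q - p\<close> this is \<open>ln ((1 + t) / (1 - t)) \<ge> 2 t\<close>, which holds because the difference of the two
  sides has derivative \<open>2 t\<^sup>2 / (1 - t\<^sup>2)\<close>.
\<close>

lemma ln_ratio_ge:
  fixes p q :: real
  assumes "0 < p" "p < q" "p + q = 1"
  shows "ln q - ln p \<ge> 2 * (q - p)"
proof -
  define t where "t = q - p"
  have t: "0 \<le> t" "t < 1" using assms by (auto simp: t_def)
  have qp: "q = (1 + t) / 2" "p = (1 - t) / 2" using assms by (auto simp: t_def field_simps)
  have "ln (1 + 0) - ln (1 - 0) - 2 * 0 \<le> ln (1 + t) - ln (1 - t) - 2 * t"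
  proof (rule DERIV_nonneg_imp_nondecreasing[OF t(1)])
    fix x assume x: "0 \<le> x" "x \<le> t"
    then have x1: "x < 1" using t by simp
    have "((\<lambda>x. ln (1 + x) - ln (1 - x) - 2 * x) has_real_derivative (1 / (1 + x) + 1 / (1 - x) - 2)) (at x)"
      using x x1 by (auto intro!: derivative_eq_intros)
    moreover have "1 / (1 + x) + 1 / (1 - x) - 2 = 2 * x\<^sup>2 / ((1 + x) * (1 - x))"
      using x x1 by (simp add: divide_simps) (simp add: algebra_simps power2_eq_square)
    then have "1 / (1 + x) + 1 / (1 - x) - 2 \<ge> 0" using x x1 by simp
    ultimately show "\<exists>y. ((\<lambda>x. ln (1 + x) - ln (1 - x) - 2 * x) has_real_derivative y) (at x) \<and> 0 \<le> y" by blast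
  qed
  moreover have "ln q - ln p = ln (1 + t) - ln (1 - t)" using t unfolding qp by (simp add: ln_div)
  ultimately show ?thesis by (simp add: t_def)
qed

lemma c_LS_ge_2:
  assumes "0 < p" "p < 1"
  shows "c_LS p \<ge> 2"
proof -
  consider "p = 1/2" | "p < 1 - p" | "1 - p < p" by linarith
  then show ?thesis
  proof cases
    case 1
    then show ?thesis by (simp add: c_LS_def)
  next
    case 2
    then have "c_LS p = (ln (1 - p) - ln p) / ((1 - p) - p)"
      unfolding c_LS_def by (simp add: divide_simps) (simp add: algebra_simps)
    also have "\<dots> \<ge> 2" using ln_ratio_ge[of p "1 - p"] assms 2 by (subst pos_le_divide_eq) auto
    finally show ?thesis .
  next
    case 3
    then show ?thesis using ln_ratio_ge[of "1 - p" p] assms unfolding c_LS_def by (auto simp: pos_le_divide_eq)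
  qed
qed

lemma c_LS_sym: "c_LS (1 - p) = c_LS p"
proof (cases "p = 1/2")
  case False
  then show ?thesis unfolding c_LS_def by (simp add: divide_simps) (simp add: algebra_simps)
qed (simp add: c_LS_def)

text \<open>
  The values \<open>A = 1 + q s\<close> and \<open>B = 1 - p s\<close> of the squared function, taken with probabilities \<open>p\<close> and \<open>q\<close>, have
  mean one. Let \<open>G s\<close> be the right-hand side minus the left-hand side. A computation that uses
  \<open>q B + p A = 1\<close> gives
  \<open>G'' = p q / (A B) * (c / (2 sqrt (A B)) - 1)\<close> with \<open>c = c_LS p\<close>,
  so \<open>G\<close> is convex where \<open>sqrt (A B) \<le> c / 2\<close> and concave elsewhere. Moreover \<open>G\<close> and \<open>G'\<close> vanish
  at \<open>0\<close> and at \<open>d = 1/p - 1/q\<close>, where \<open>A = q/p\<close> and \<open>B = p/q\<close>; the second zero determines \<open>c_LS p\<close>. At both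
  points \<open>A B = 1\<close>, which lies in the convex region because \<open>c \<ge> 2\<close>. The product \<open>A B = 1 + p q s (d - s)\<close> is a
  parabola with its maximum at \<open>d/2\<close>. So a point of the convex region can be joined to \<open>0\<close> or to \<open>d\<close>
  within this region, and \<open>G \<ge> 0\<close> there by the tangent at the zero. In the concave region, which lies
  between \<open>0\<close> and \<open>d\<close>, \<open>G\<close> has no interior minimum.
\<close>

lemma two_point_log_sobolev_normalized:
  fixes p q s :: real
  assumes pq: "0 < p" "p \<le> q" "p + q = 1" and s: "1 + q * s > 0" "1 - p * s > 0"
  shows "p * (1 + q * s) * ln (1 + q * s) + q * (1 - p * s) * ln (1 - p * s) \<le>
     c_LS p * p * q * ((1 + q * s) + (1 - p * s) - 2 * sqrt ((1 + q * s) * (1 - p * s)))"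
proof -
  define c where "c = c_LS p"
  define A where "A s = 1 + q * s" for s
  define B where "B s = 1 - p * s" for s
  define R where "R s = sqrt (A s * B s)" for s
  define d where "d = 1 / p - 1 / q"
  define I where "I = {s. A s > 0 \<and> B s > 0}"
  define G where "G s = c * p * q * (A s + B s - 2 * R s) - p * A s * ln (A s) - q * B s * ln (B s)" for s
  define G' where "G' s = p * q * (c * (q - p - (q * B s - p * A s) / R s) - ln (A s) + ln (B s))" for s
  define G'' where "G'' s = p * q / (A s * B s) * (c / (2 * R s) - 1)" for s
  have q: "q > 0" using pq by simp
  have c2: "c \<ge> 2" unfolding c_def using pq q by (intro c_LS_ge_2) auto
  have d0: "d \<ge> 0" using pq q by (simp add: d_def field_simps)
  have sum1: "p * A s + q * B s = 1" "q * B s + p * A s = 1" for s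
    using pq by (auto simp: A_def B_def algebra_simps)
  have dA: "(A has_real_derivative q) (at x)" for x
    unfolding A_def[abs_def] by (auto intro!: derivative_eq_intros)
  have dB: "(B has_real_derivative - p) (at x)" for x
    unfolding B_def[abs_def] by (auto intro!: derivative_eq_intros)
  have R2: "R x * R x = A x * B x" "R x > 0" if "x \<in> I" for x
    using that by (auto simp: I_def R_def)
  have dR: "(R has_real_derivative (q * B x - p * A x) / (2 * R x)) (at x)" if "x \<in> I" for x
    unfolding R_def[abs_def]
    by (rule DERIV_cong[OF DERIV_chain2[OF DERIV_real_sqrt DERIV_mult[OF dA dB]]])
      (use that in \<open>auto simp: I_def field_simps\<close>)
  have dlnA: "((\<lambda>x. ln (A x)) has_real_derivative q / A x) (at x)" if "x \<in> I" for x
    using DERIV_chain2[OF DERIV_ln_divide dA, of x] that by (simp add: I_def)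
  have dlnB: "((\<lambda>x. ln (B x)) has_real_derivative - p / B x) (at x)" if "x \<in> I" for x
    using DERIV_chain2[OF DERIV_ln_divide dB, of x] that by (simp add: I_def)
  have dG: "(G has_real_derivative G' x) (at x)" if x: "x \<in> I" for x
  proof -
    have AB: "A x > 0" "B x > 0" using x by (auto simp: I_def)
    have "(G has_real_derivative c * p * q * (q + - p - 2 * ((q * B x - p * A x) / (2 * R x)))
        - p * (q * ln (A x) + q / A x * A x) - q * (- p * ln (B x) + - p / B x * B x)) (at x)"
      unfolding G_def[abs_def] mult.assoc[of p] mult.assoc[of q] mult.assoc[of "c * p"]
      by (intro DERIV_diff DERIV_cmult DERIV_add DERIV_mult dA dB dR[OF x] dlnA dlnB x)
    also have "c * p * q * (q + - p - 2 * ((q * B x - p * A x) / (2 * R x)))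
        - p * (q * ln (A x) + q / A x * A x) - q * (- p * ln (B x) + - p / B x * B x) = G' x"
      using AB R2[OF x] by (simp add: G'_def field_simps)
    finally show ?thesis .
  qed
  have dG': "(G' has_real_derivative G'' x) (at x)" if x: "x \<in> I" for x
  proof -
    have AB: "A x > 0" "B x > 0" using x by (auto simp: I_def)
    note R = R2[OF x]
    let ?n = "q * B x - p * A x"
    have "(G' has_real_derivative p * q * (c * (0 - ((q * - p - p * q) * R x - ?n * (?n / (2 * R x))) / (R x * R x)) - q / A x + - p / B x)) (at x)"
      unfolding G'_def[abs_def]
      by (intro DERIV_diff DERIV_cmult DERIV_add DERIV_divide dA dB dR[OF x] dlnA dlnB x DERIV_const)
        (use R in auto)
    also have "((q * - p - p * q) * R x - ?n * (?n / (2 * R x))) / (R x * R x) = - (4 * p * q * (R x * R x) + ?n * ?n) / (2 * R x * (R x * R x))"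
      using R(2) by (simp add: field_simps)
    also have "4 * p * q * (R x * R x) + ?n * ?n = (q * B x + p * A x) * (q * B x + p * A x)"
      unfolding R(1) by (simp add: algebra_simps)
    also have "\<dots> = 1" by (simp add: sum1)
    also have "p * q * (c * (0 - - 1 / (2 * R x * (R x * R x))) - q / A x + - p / B x) =
        p * q * (c / (2 * R x * (A x * B x)) - (q * B x + p * A x) / (A x * B x))"
      using AB unfolding R(1) by (simp add: field_simps)
    also have "\<dots> = G'' x" unfolding sum1 G''_def using AB R(2) by (simp add: field_simps)
    finally show ?thesis .
  qed
  have G''_nonneg: "G'' x \<ge> 0" if "x \<in> I" "R x \<le> c / 2" for x
  proof -
    have "c / (2 * R x) \<ge> 1" using that R2[OF that(1)] by (simp add: field_simps)
    then show ?thesis using that pq q by (auto simp: G''_def I_def)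
  qed
  have G''_neg: "G'' x < 0" if "x \<in> I" "R x > c / 2" for x
  proof -
    have "c / (2 * R x) < 1" using that R2[OF that(1)] by (simp add: field_simps)
    then show ?thesis using that pq q by (auto simp: G''_def I_def intro!: divide_neg_pos mult_pos_neg)
  qed
  have I_interval: "{x..y} \<subseteq> I" if "x \<in> I" "y \<in> I" for x y
  proof
    fix z assume z: "z \<in> {x..y}"
    have "q * x \<le> q * z" "p * z \<le> p * y" using z pq q by auto
    then show "z \<in> I" using that by (auto simp: I_def A_def B_def)
  qed
  have Ad: "A d = q / p" "B d = p / q" using pq q by (auto simp: A_def B_def d_def field_simps)
  have I0: "0 \<in> I" and Id: "d \<in> I" using pq q Ad by (auto simp: I_def) (auto simp: A_def B_def)
  have R0: "R 0 = 1" "R d = 1" using Ad pq q by (auto simp: R_def) (auto simp: A_def B_def)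
  have ABd: "A x * B x = 1 + p * q * (x * (d - x))" for x
    using pq q by (simp add: A_def B_def d_def field_simps)
  have lnqp: "ln q - ln p = c * (q - p)"
  proof (cases "p = q")
    case False
    have "1 - p = q" "p \<noteq> 1 / 2" using pq False by auto
    then have "c = (ln p - ln q) / (p - q)" by (simp add: c_def c_LS_def)
    then show ?thesis using False by (simp add: field_simps)
  qed simp
  have G0: "G 0 = 0" "G' 0 = 0" by (auto simp: G_def G'_def R0) (auto simp: A_def B_def)
  have "p * (q / p) * ln (q / p) + q * (p / q) * ln (p / q) = (q - p) * (ln q - ln p)"
    using pq q by (simp add: ln_div algebra_simps)
  moreover have "p * q * (q / p + p / q - 2 * 1) = (q - p) * (q - p)"
    using pq q by (simp add: field_simps)
  then have "c * (p * q * (q / p + p / q - 2 * 1)) = c * ((q - p) * (q - p))" by (simp only:)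
  then have "c * p * q * (q / p + p / q - 2 * 1) = (q - p) * (c * (q - p))" by (simp only: ac_simps)
  ultimately have Gd: "G d = 0" unfolding G_def R0 Ad lnqp by linarith
  have G'd: "G' d = 0"
  proof -
    have "c * (q - p - (q * (p / q) - p * (q / p)) / 1) - ln (q / p) + ln (p / q) = 0"
      using pq q lnqp by (simp add: ln_div algebra_simps)
    then show ?thesis by (simp add: G'_def R0 Ad)
  qed
  have mono: "R x \<le> R y" if "x \<in> I" "y \<in> I" "x * (d - x) \<le> y * (d - y)" for x y
    unfolding R_def ABd using that pq q by (intro real_sqrt_le_mono add_left_mono mult_left_mono) auto
  have tangent: "G x \<ge> 0" if x: "x \<in> I" and e: "e \<in> I" "G e = 0" "G' e = 0"
    and R: "\<And>y. y \<in> {min e x..max e x} \<Longrightarrow> R y \<le> c / 2" for x e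
  proof -
    let ?C = "{min e x..max e x}"
    have sub: "?C \<subseteq> I" by (rule I_interval) (use x e in \<open>auto simp: min_def max_def\<close>)
    have "G' e * (x - e) \<le> G x - G e"
      by (rule f''_imp_f'[of ?C G G' G'']) (use sub dG dG' G''_nonneg R in auto)
    then show ?thesis using e by simp
  qed
  have outer: "G x \<ge> 0" if x: "x \<in> I" and Rx: "R x \<le> c / 2" for x
  proof (cases "x \<le> d / 2")
    case True
    show ?thesis
    proof (rule tangent[OF x I0 G0])
      fix y assume y: "y \<in> {min 0 x..max 0 x}"
      have "{min 0 x..max 0 x} \<subseteq> I" by (rule I_interval) (use x I0 in \<open>auto simp: min_def max_def\<close>)
      then have yI: "y \<in> I" using y by blast
      show "R y \<le> c / 2"
      proof (cases "x \<le> 0")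
        case True
        then have "y * (d - y) \<le> 0 * (d - 0)" using y d0 by (auto intro!: mult_nonpos_nonneg)
        then have "R y \<le> R 0" by (rule mono[OF yI I0])
        then show ?thesis using R0 c2 by simp
      next
        case False
        then have "x * (d - x) - y * (d - y) = (x - y) * (d - x - y)" "x - y \<ge> 0" "d - x - y \<ge> 0"
          using y True by (auto simp: algebra_simps)
        then have "y * (d - y) \<le> x * (d - x)" by (metis diff_ge_0_iff_ge mult_nonneg_nonneg)
        then have "R y \<le> R x" by (rule mono[OF yI x])
        then show ?thesis using Rx by simp
      qed
    qed
  next
    case False
    show ?thesis
    proof (rule tangent[OF x Id Gd G'd])
      fix y assume y: "y \<in> {min d x..max d x}"
      have "{min d x..max d x} \<subseteq> I" by (rule I_interval) (use x Id in \<open>auto simp: min_def max_def\<close>)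
      then have yI: "y \<in> I" using y by blast
      show "R y \<le> c / 2"
      proof (cases "d \<le> x")
        case True
        then have "y * (d - y) \<le> d * (d - d)" using y d0 by (auto intro!: mult_nonneg_nonpos)
        then have "R y \<le> R d" by (rule mono[OF yI Id])
        then show ?thesis using R0 c2 by simp
      next
        case False2: False
        then have "x * (d - x) - y * (d - y) = (y - x) * (x + y - d)" "y - x \<ge> 0" "x + y - d \<ge> 0"
          using y False by (auto simp: algebra_simps)
        then have "y * (d - y) \<le> x * (d - x)" by (metis diff_ge_0_iff_ge mult_nonneg_nonneg)
        then have "R y \<le> R x" by (rule mono[OF yI x])
        then show ?thesis using Rx by simp
      qed
    qed
  qed
  \<comment> \<open>at a negative minimum, which would lie in the concave region, \<open>G' = 0\<close> and \<open>G'' < 0\<close>\<close>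
  have inner: "G x \<ge> 0" if x: "x \<in> {0..d}" for x
  proof -
    have sub: "{0..d} \<subseteq> I" by (rule I_interval[OF I0 Id])
    have "continuous_on {0..d} G"
      using sub dG by (intro continuous_at_imp_continuous_on) (blast intro: DERIV_isCont)
    then obtain z where z: "z \<in> {0..d}" and min: "\<And>y. y \<in> {0..d} \<Longrightarrow> G z \<le> G y"
      using continuous_attains_inf[of "{0..d}" G] d0 by auto
    have "G z \<ge> 0"
    proof (rule ccontr)
      assume neg: "\<not> G z \<ge> 0"
      have zI: "z \<in> I" using z sub by auto
      have zd: "0 < z" "z < d" using z neg G0 Gd by (auto simp: less_le)
      have "R z > c / 2" using outer[OF zI] neg by force
      then have neg2: "G'' z < 0" by (rule G''_neg[OF zI])
      have "G' z = 0"
      proof (rule DERIV_local_min[OF dG[OF zI]])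
        show "0 < Min {z, d - z}" using zd by simp
        show "\<forall>y. \<bar>z - y\<bar> < Min {z, d - z} \<longrightarrow> G z \<le> G y"
          using min by (auto simp: abs_if split: if_splits)
      qed
      then obtain \<delta> where \<delta>: "\<delta> > 0" "\<And>h. h > 0 \<Longrightarrow> h < \<delta> \<Longrightarrow> G' (z + h) < 0"
        using DERIV_neg_dec_right[OF dG'[OF zI] neg2] by auto
      define h where "h = Min {\<delta> / 2, d - z}"
      have h: "h > 0" "h < \<delta>" "z + h \<le> d" using \<delta> zd by (auto simp: h_def min_def)
      have "\<exists>t. z < t \<and> t < z + h \<and> G (z + h) - G z = (z + h - z) * G' t"
        using h zd sub by (intro MVT2) (auto intro!: dG)
      then obtain t where t: "z < t" "t < z + h" "G (z + h) - G z = (z + h - z) * G' t" by blast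
      have "G' t < 0" using \<delta>(2)[of "t - z"] t h by simp
      then have "h * G' t < 0" using h by (intro mult_pos_neg) auto
      moreover have "G z \<le> G (z + h)" using h zd by (intro min) auto
      ultimately show False using t by simp
    qed
    then show ?thesis using min[OF x] by simp
  qed
  have sI: "s \<in> I" using s by (auto simp: I_def A_def B_def)
  have "G s \<ge> 0"
  proof (cases "s \<in> {0..d}")
    case False
    then have "s * (d - s) \<le> 0 * (d - 0)"
      using d0 by (auto simp: not_le mult_le_0_iff)
    then have "R s \<le> R 0" by (rule mono[OF sI I0])
    then show ?thesis using outer[OF sI] R0 c2 by simp
  qed (rule inner)
  then show ?thesis by (simp add: G_def R_def A_def B_def c_def)
qed

lemma two_point_log_sobolev_pos_half:
  fixes p q a b :: real
  assumes pq: "0 < p" "p \<le> q" "p + q = 1" and ab: "a > 0" "b > 0"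
  shows "p * a\<^sup>2 * ln (a\<^sup>2 / (p * a\<^sup>2 + q * b\<^sup>2)) + q * b\<^sup>2 * ln (b\<^sup>2 / (p * a\<^sup>2 + q * b\<^sup>2)) \<le> c_LS p * p * q * (a - b)\<^sup>2"
proof -
  define m where "m = p * a\<^sup>2 + q * b\<^sup>2"
  have m: "m > 0" using pq ab by (auto simp: m_def intro!: add_pos_pos)
  \<comment> \<open>the parameter for which \<open>a\<^sup>2 / m\<close> and \<open>b\<^sup>2 / m\<close> are \<open>1 + q s\<close> and \<open>1 - p s\<close>\<close>
  define s where "s = (a\<^sup>2 - b\<^sup>2) / m"
  have qp: "q = 1 - p" using pq by simp
  have "m + q * (a\<^sup>2 - b\<^sup>2) = a\<^sup>2" "m - p * (a\<^sup>2 - b\<^sup>2) = b\<^sup>2"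
    by (auto simp: m_def qp algebra_simps)
  then have A: "1 + q * s = a\<^sup>2 / m" and B: "1 - p * s = b\<^sup>2 / m"
    using m by (auto simp: s_def field_simps)
  have R: "sqrt ((a\<^sup>2 / m) * (b\<^sup>2 / m)) = a * b / m"
    using ab m by (simp add: real_sqrt_mult real_sqrt_divide)
  have "p * (a\<^sup>2 / m) * ln (a\<^sup>2 / m) + q * (b\<^sup>2 / m) * ln (b\<^sup>2 / m) \<le> c_LS p * p * q * (a\<^sup>2 / m + b\<^sup>2 / m - 2 * (a * b / m))"
    using two_point_log_sobolev_normalized[OF pq, of s] m ab unfolding A B R by simp
  from mult_left_mono[OF this, of m] m
  have "m * (p * (a\<^sup>2 / m) * ln (a\<^sup>2 / m) + q * (b\<^sup>2 / m) * ln (b\<^sup>2 / m)) \<le> m * (c_LS p * p * q * (a\<^sup>2 / m + b\<^sup>2 / m - 2 * (a * b / m)))"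
    by simp
  also have "m * (p * (a\<^sup>2 / m) * ln (a\<^sup>2 / m) + q * (b\<^sup>2 / m) * ln (b\<^sup>2 / m)) = p * a\<^sup>2 * ln (a\<^sup>2 / m) + q * b\<^sup>2 * ln (b\<^sup>2 / m)"
    using m by (simp add: algebra_simps)
  also have "m * (c_LS p * p * q * (a\<^sup>2 / m + b\<^sup>2 / m - 2 * (a * b / m))) = c_LS p * p * q * (a - b)\<^sup>2"
    using m by (simp add: field_simps power2_eq_square)
  finally show ?thesis by (simp add: m_def)
qed

text \<open>
  The case in which the function vanishes at one of the two points, by continuity.
\<close>

lemma two_point_log_sobolev_zero:
  fixes p q a b :: real
  assumes pq: "0 < p" "0 < q" and b: "b > 0"
    and *: "\<And>a. a > 0 \<Longrightarrow> p * a\<^sup>2 * ln (a\<^sup>2 / (p * a\<^sup>2 + q * b\<^sup>2)) + q * b\<^sup>2 * ln (b\<^sup>2 / (p * a\<^sup>2 + q * b\<^sup>2)) \<le> C * (a - b)\<^sup>2"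
  shows "q * b\<^sup>2 * ln (b\<^sup>2 / (q * b\<^sup>2)) \<le> C * b\<^sup>2"
proof (rule tendsto_le)
  show "at_right (0::real) \<noteq> bot" by simp
  show "((\<lambda>a. C * (a - b)\<^sup>2) \<longlongrightarrow> C * b\<^sup>2) (at_right 0)"
    by (auto intro!: tendsto_eq_intros)
  show "((\<lambda>a. p * a\<^sup>2 * ln (a\<^sup>2 / (p * a\<^sup>2 + q * b\<^sup>2)) + q * b\<^sup>2 * ln (b\<^sup>2 / (p * a\<^sup>2 + q * b\<^sup>2))) \<longlongrightarrow> q * b\<^sup>2 * ln (b\<^sup>2 / (q * b\<^sup>2))) (at_right 0)"
    using pq b by real_asymp (simp add: divide_inverse)
  show "\<forall>\<^sub>F a in at_right 0. p * a\<^sup>2 * ln (a\<^sup>2 / (p * a\<^sup>2 + q * b\<^sup>2)) + q * b\<^sup>2 * ln (b\<^sup>2 / (p * a\<^sup>2 + q * b\<^sup>2)) \<le> C * (a - b)\<^sup>2"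
    using eventually_at_right_less[of "0::real"] by eventually_elim (rule *)
qed

text \<open>
  The two terms with \<open>rel_ent\<close> add up to the entropy of the square, and \<open>p (1 - p) (a - b)\<^sup>2\<close> is the variance
  of a function with values \<open>a\<close> and \<open>b\<close>. Replacing \<open>a\<close> and \<open>b\<close> by their absolute values keeps the left-hand
  side and does not increase the right-hand side, so that nonnegative values suffice.
\<close>

lemma two_point_log_sobolev:
  fixes p a b :: real
  assumes p: "0 < p" "p < 1"
  defines "m \<equiv> p * a\<^sup>2 + (1 - p) * b\<^sup>2"
  shows "p * rel_ent (a\<^sup>2) m + (1 - p) * rel_ent (b\<^sup>2) m \<le> c_LS p * (p * (1 - p) * (a - b)\<^sup>2)"
proof -
  have pos: "p * a\<^sup>2 * ln (a\<^sup>2 / (p * a\<^sup>2 + (1 - p) * b\<^sup>2)) + (1 - p) * b\<^sup>2 * ln (b\<^sup>2 / (p * a\<^sup>2 + (1 - p) * b\<^sup>2)) \<le> c_LS p * p * (1 - p) * (a - b)\<^sup>2"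
    if "0 < p" "p < 1" "a > 0" "b > 0" for p a b :: real
  proof (cases "p \<le> 1 - p")
    case True
    then show ?thesis using that by (intro two_point_log_sobolev_pos_half) auto
  next
    case False
    then show ?thesis using two_point_log_sobolev_pos_half[of "1 - p" p b a] that
      by (simp add: c_LS_sym ac_simps power2_commute)
  qed
  have nonneg: "p * a\<^sup>2 * ln (a\<^sup>2 / (p * a\<^sup>2 + (1 - p) * b\<^sup>2)) + (1 - p) * b\<^sup>2 * ln (b\<^sup>2 / (p * a\<^sup>2 + (1 - p) * b\<^sup>2)) \<le> c_LS p * p * (1 - p) * (a - b)\<^sup>2"
    if ab: "a \<ge> 0" "b \<ge> 0" for a b :: real
  proof -
    consider "a > 0" "b > 0" | "a = 0" "b > 0" | "a > 0" "b = 0" | "a = 0" "b = 0"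
      using ab by linarith
    then show ?thesis
    proof cases
      case 1
      then show ?thesis using p by (intro pos)
    next
      case 2
      then show ?thesis
        using two_point_log_sobolev_zero[of p "1 - p" b "c_LS p * p * (1 - p)"] pos[OF p] p by simp
    next
      case 3
      then show ?thesis
        using two_point_log_sobolev_zero[of "1 - p" p a "c_LS p * p * (1 - p)"] pos[of "1 - p" _ a] p
        by (simp add: c_LS_sym ac_simps power2_commute)
    qed simp
  qed
  have "(\<bar>a\<bar> - \<bar>b\<bar>)\<^sup>2 \<le> (a - b)\<^sup>2"
    by (rule abs_le_square_iff[THEN iffD1]) simp
  then have "c_LS p * p * (1 - p) * (\<bar>a\<bar> - \<bar>b\<bar>)\<^sup>2 \<le> c_LS p * p * (1 - p) * (a - b)\<^sup>2"
    using c_LS_ge_2[OF p] p by (intro mult_left_mono) auto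
  with nonneg[of "\<bar>a\<bar>" "\<bar>b\<bar>"] have "p * a\<^sup>2 * ln (a\<^sup>2 / m) + (1 - p) * b\<^sup>2 * ln (b\<^sup>2 / m) \<le> c_LS p * p * (1 - p) * (a - b)\<^sup>2"
    by (simp add: m_def)
  moreover have "p * rel_ent (a\<^sup>2) m + (1 - p) * rel_ent (b\<^sup>2) m = p * a\<^sup>2 * ln (a\<^sup>2 / m) + (1 - p) * b\<^sup>2 * ln (b\<^sup>2 / m)"
    unfolding rel_ent_def by (simp add: m_def algebra_simps)
  ultimately show ?thesis by (simp add: mult.assoc)
qed

section \<open>The product of coins and Gaussians as a resampling space\<close>

text \<open>
  Both measures agree on finite-dimensional boxes: a box pulls back to a product of a box in
  the coordinates of \<open>J\<close> and a box in the others.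
\<close>

lemma distr_PiM_mix:
  assumes N: "\<And>i. i \<in> I \<Longrightarrow> prob_space (N i)"
  shows "(\<lambda>(x, y). \<lambda>i. if i \<in> J then x i else y i) \<in> PiM I N \<Otimes>\<^sub>M PiM I N \<rightarrow>\<^sub>M PiM I N" (is "?f \<in> _")
    and "distr (PiM I N \<Otimes>\<^sub>M PiM I N) (PiM I N) (\<lambda>(x, y). \<lambda>i. if i \<in> J then x i else y i) = PiM I N" (is "?L = _")
proof -
  interpret P: prob_space "PiM I N" using N by (rule prob_space_PiM)
  have "(\<lambda>z i. if i \<in> J then fst z i else snd z i) \<in> PiM I N \<Otimes>\<^sub>M PiM I N \<rightarrow>\<^sub>M PiM I N"
  proof (rule measurable_PiM_single')
    fix i assume i: "i \<in> I"
    then show "(\<lambda>z. if i \<in> J then fst z i else snd z i) \<in> PiM I N \<Otimes>\<^sub>M PiM I N \<rightarrow>\<^sub>M N i"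
      by (cases "i \<in> J") simp_all
  next
    show "(\<lambda>z i. if i \<in> J then fst z i else snd z i) \<in> space (PiM I N \<Otimes>\<^sub>M PiM I N) \<rightarrow> (\<Pi>\<^sub>E i\<in>I. space (N i))"
      by (auto simp: space_pair_measure space_PiM PiE_iff extensional_def)
  qed
  then show f: "?f \<in> PiM I N \<Otimes>\<^sub>M PiM I N \<rightarrow>\<^sub>M PiM I N" by (simp add: split_beta')
  have "PiM I N = ?L"
  proof (rule measure_eqI_PiM_infinite[OF refl])
    show "finite_measure (PiM I N)" by unfold_locales
    fix A F assume F: "finite F" "F \<subseteq> I" and A: "\<And>i. i \<in> F \<Longrightarrow> A i \<in> sets (N i)"
    let ?X = "prod_emb I N F (Pi\<^sub>E F A)"
    let ?E = "\<lambda>K. prod_emb I N (F \<inter> K) (Pi\<^sub>E (F \<inter> K) A)"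
    have X: "?X \<in> sets (PiM I N)" using F A by (intro sets_PiM_I) auto
    have E: "?E K \<in> sets (PiM I N)" for K using F A by (intro sets_PiM_I) auto
    have eE: "emeasure (PiM I N) (?E K) = (\<Prod>i\<in>F \<inter> K. emeasure (N i) (A i))" for K
      using N F A by (intro emeasure_PiM_emb) auto
    have "?f -` ?X \<inter> space (PiM I N \<Otimes>\<^sub>M PiM I N) = ?E J \<times> ?E (-J)"
      using F
      by (auto simp: prod_emb_def space_pair_measure space_PiM PiE_iff extensional_def split: if_splits)
    then have "emeasure ?L ?X = emeasure (PiM I N \<Otimes>\<^sub>M PiM I N) (?E J \<times> ?E (-J))"
      using X by (subst emeasure_distr[OF f]) auto
    also have "\<dots> = (\<Prod>i\<in>F \<inter> J. emeasure (N i) (A i)) * (\<Prod>i\<in>F \<inter> -J. emeasure (N i) (A i))"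
      by (subst P.emeasure_pair_measure_Times[OF E E]) (simp add: eE)
    also have "\<dots> = (\<Prod>i\<in>F. emeasure (N i) (A i))"
      using F by (subst prod.union_disjoint[symmetric]) (auto intro!: prod.cong)
    also have "\<dots> = emeasure (PiM I N) ?X"
      using N F A by (intro emeasure_PiM_emb[symmetric]) auto
    finally show "emeasure (PiM I N) ?X = emeasure ?L ?X" by simp
  qed simp
  then show "?L = PiM I N" by simp
qed

lemma nn_integral_indicator_distr_pair:
  assumes "prob_space N" and m: "(\<lambda>(x, x'). m x x') \<in> N \<Otimes>\<^sub>M N \<rightarrow>\<^sub>M N"
    and distr: "distr (N \<Otimes>\<^sub>M N) N (\<lambda>(x, x'). m x x') = N" and A [measurable]: "A \<in> sets N"
  shows "(\<integral>\<^sup>+x. (\<integral>\<^sup>+x'. indicator A (m x x') \<partial>N) \<partial>N) = emeasure N A"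
proof -
  interpret N: prob_space N by fact
  note [measurable] = measurable_compose[OF measurable_Pair m, simplified]
  have "emeasure N A = emeasure (distr (N \<Otimes>\<^sub>M N) N (\<lambda>(x, x'). m x x')) A" by (simp only: distr)
  also have "\<dots> = (\<integral>\<^sup>+z. indicator A z \<partial>distr (N \<Otimes>\<^sub>M N) N (\<lambda>(x, x'). m x x'))" by simp
  also have "\<dots> = (\<integral>\<^sup>+z. indicator A (m (fst z) (snd z)) \<partial>(N \<Otimes>\<^sub>M N))"
    using m by (subst nn_integral_distr) (auto simp: split_beta')
  also have "\<dots> = (\<integral>\<^sup>+x. (\<integral>\<^sup>+x'. indicator A (m x x') \<partial>N) \<partial>N)"
    by (subst N.nn_integral_fst[symmetric]) auto
  finally show ?thesis by simp
qed

lemma distr_pair_mix: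
  assumes "prob_space M1" "prob_space M2"
    and m1: "(\<lambda>(x, x'). m1 x x') \<in> M1 \<Otimes>\<^sub>M M1 \<rightarrow>\<^sub>M M1" "distr (M1 \<Otimes>\<^sub>M M1) M1 (\<lambda>(x, x'). m1 x x') = M1"
    and m2: "(\<lambda>(x, x'). m2 x x') \<in> M2 \<Otimes>\<^sub>M M2 \<rightarrow>\<^sub>M M2" "distr (M2 \<Otimes>\<^sub>M M2) M2 (\<lambda>(x, x'). m2 x x') = M2"
  defines "f \<equiv> \<lambda>(a, b). (m1 (fst a) (fst b), m2 (snd a) (snd b))"
  shows "f \<in> (M1 \<Otimes>\<^sub>M M2) \<Otimes>\<^sub>M (M1 \<Otimes>\<^sub>M M2) \<rightarrow>\<^sub>M M1 \<Otimes>\<^sub>M M2"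
    and "distr ((M1 \<Otimes>\<^sub>M M2) \<Otimes>\<^sub>M (M1 \<Otimes>\<^sub>M M2)) (M1 \<Otimes>\<^sub>M M2) f = M1 \<Otimes>\<^sub>M M2"
proof -
  interpret M1: prob_space M1 by fact
  interpret M2: prob_space M2 by fact
  interpret P: pair_prob_space M1 M2 ..
  interpret P1: pair_prob_space M1 M1 ..
  interpret P2: pair_prob_space M2 M2 ..
  note [measurable] = measurable_compose[OF measurable_Pair m1(1), simplified] measurable_compose[OF measurable_Pair m2(1), simplified]
  show f [measurable]: "f \<in> (M1 \<Otimes>\<^sub>M M2) \<Otimes>\<^sub>M (M1 \<Otimes>\<^sub>M M2) \<rightarrow>\<^sub>M M1 \<Otimes>\<^sub>M M2"
    unfolding f_def split_beta' by measurable
  let ?M = "M1 \<Otimes>\<^sub>M M2"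
  have "M1 \<Otimes>\<^sub>M M2 = distr (?M \<Otimes>\<^sub>M ?M) ?M f"
  proof (rule pair_measure_eqI)
    show "sigma_finite_measure M1" "sigma_finite_measure M2" by unfold_locales
    fix A B assume A [measurable]: "A \<in> sets M1" and B [measurable]: "B \<in> sets M2"
    define w where "w x = (\<integral>\<^sup>+x'. indicator A (m1 x x') \<partial>M1)" for x
    define u where "u y = (\<integral>\<^sup>+y'. indicator B (m2 y y') \<partial>M2)" for y
    have [measurable]: "w \<in> borel_measurable M1" "u \<in> borel_measurable M2"
      unfolding w_def[abs_def] u_def[abs_def] by measurable
    have W: "(\<integral>\<^sup>+x. w x \<partial>M1) = emeasure M1 A" and U: "(\<integral>\<^sup>+y. u y \<partial>M2) = emeasure M2 B"
      unfolding w_def u_def by (intro nn_integral_indicator_distr_pair m1 m2 A B assms(1,2))+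
    have "emeasure (distr (?M \<Otimes>\<^sub>M ?M) ?M f) (A \<times> B) = (\<integral>\<^sup>+z. indicator (A \<times> B) z \<partial>distr (?M \<Otimes>\<^sub>M ?M) ?M f)" by simp
    also have "\<dots> = (\<integral>\<^sup>+z. indicator A (m1 (fst (fst z)) (fst (snd z))) * indicator B (m2 (snd (fst z)) (snd (snd z))) \<partial>(?M \<Otimes>\<^sub>M ?M))"
      by (subst nn_integral_distr) (auto simp: f_def split_beta' indicator_times)
    also have "\<dots> = (\<integral>\<^sup>+a. \<integral>\<^sup>+b. indicator A (m1 (fst a) (fst b)) * indicator B (m2 (snd a) (snd b)) \<partial>?M \<partial>?M)"
      by (subst P.nn_integral_fst[symmetric]) auto
    also have "\<dots> = (\<integral>\<^sup>+a. w (fst a) * u (snd a) \<partial>?M)"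
    proof (rule nn_integral_cong)
      fix a assume "a \<in> space ?M"
      then have [measurable]: "fst a \<in> space M1" "snd a \<in> space M2" by (auto simp: space_pair_measure)
      have "(\<integral>\<^sup>+b. indicator A (m1 (fst a) (fst b)) * indicator B (m2 (snd a) (snd b)) \<partial>?M)
        = (\<integral>\<^sup>+x. \<integral>\<^sup>+y. indicator A (m1 (fst a) x) * indicator B (m2 (snd a) y) \<partial>M2 \<partial>M1)"
        by (subst M2.nn_integral_fst[symmetric]) auto
      also have "\<dots> = w (fst a) * u (snd a)"
        unfolding w_def u_def by (simp add: nn_integral_cmult nn_integral_multc)
      finally show "(\<integral>\<^sup>+b. indicator A (m1 (fst a) (fst b)) * indicator B (m2 (snd a) (snd b)) \<partial>?M) = w (fst a) * u (snd a)" .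
    qed
    also have "\<dots> = (\<integral>\<^sup>+x. \<integral>\<^sup>+y. w x * u y \<partial>M2 \<partial>M1)"
      by (subst M2.nn_integral_fst[symmetric]) auto
    also have "\<dots> = emeasure M1 A * emeasure M2 B"
      by (simp add: nn_integral_cmult nn_integral_multc W U)
    finally show "emeasure M1 A * emeasure M2 B = emeasure (distr (?M \<Otimes>\<^sub>M ?M) ?M f) (A \<times> B)" by simp
  qed simp
  then show "distr (?M \<Otimes>\<^sub>M ?M) ?M f = ?M" by simp
qed

text \<open>
  Coordinates in \<open>S\<close> are tagged by \<open>Inl\<close>, those in \<open>\<nat>\<close> by \<open>Inr\<close>. At an index \<open>s \<notin> S\<close> all points of the space have the
  value \<open>undefined\<close>, so it does not matter from which argument the value is taken.
\<close>

definition mixed_mrg :: "('s + nat) set \<Rightarrow> ('s \<Rightarrow> bool) \<times> (nat \<Rightarrow> real) \<Rightarrow> ('s \<Rightarrow> bool) \<times> (nat \<Rightarrow> real) \<Rightarrow> ('s \<Rightarrow> bool) \<times> (nat \<Rightarrow> real)" where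
  "mixed_mrg J a b = ((\<lambda>s. if Inl s \<in> J then fst a s else fst b s), (\<lambda>i. if Inr i \<in> J then snd a i else snd b i))"

lemma prob_space_std_normal: "prob_space std_normal_distribution"
  by (rule prob_space_normal_density) simp

lemma prob_space_two_point_product: "prob_space (two_point_product p S)"
  unfolding two_point_product_def by (intro prob_space_PiM prob_space_measure_pmf)

lemma prob_space_gauss_product: "prob_space gauss_product"
  unfolding gauss_product_def by (intro prob_space_PiM prob_space_std_normal)

lemma resampling_mixed_product: "resampling (mixed_product p S) mixed_mrg"
proof -
  interpret A: prob_space "two_point_product p S" by (rule prob_space_two_point_product)
  interpret B: prob_space gauss_product by (rule prob_space_gauss_product)
  interpret AB: pair_prob_space "two_point_product p S" gauss_product ..
  note 1 = distr_PiM_mix[of S "\<lambda>_. measure_pmf (bernoulli_pmf p)", OF prob_space_measure_pmf, folded two_point_product_def]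
  note 2 = distr_PiM_mix[of "UNIV :: nat set" "\<lambda>_. std_normal_distribution", OF prob_space_std_normal, folded gauss_product_def]
  note * = distr_pair_mix[OF A.prob_space_axioms B.prob_space_axioms 1 2, folded mixed_product_def]
  have eq: "(\<lambda>(a, b). mixed_mrg J a b) = (\<lambda>(a, b). (\<lambda>i. if i \<in> {s. Inl s \<in> J} then fst a i else fst b i, \<lambda>i. if i \<in> {i. Inr i \<in> J} then snd a i else snd b i))" for J :: "('s + nat) set"
    by (auto simp: mixed_mrg_def fun_eq_iff)
  have M: "prob_space (mixed_product p S)" unfolding mixed_product_def by (rule AB.prob_space_axioms)
  show ?thesis
  proof (intro resampling.intro resampling_axioms.intro M)
    show "(\<lambda>(a, b). mixed_mrg J a b) \<in> mixed_product p S \<Otimes>\<^sub>M mixed_product p S \<rightarrow>\<^sub>M mixed_product p S"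
      "distr (mixed_product p S \<Otimes>\<^sub>M mixed_product p S) (mixed_product p S) (\<lambda>(a, b). mixed_mrg J a b) = mixed_product p S" for J
      unfolding eq by (rule *)+
  qed (auto simp: mixed_mrg_def fun_eq_iff)
qed

lemma distr_mixed_Inr: "distr (mixed_product p S) borel (\<lambda>a. snd a i) = std_normal_distribution"
proof -
  interpret A: prob_space "two_point_product p S" by (rule prob_space_two_point_product)
  interpret B: prob_space gauss_product by (rule prob_space_gauss_product)
  interpret AB: pair_prob_space "two_point_product p S" gauss_product ..
  have m [measurable]: "(\<lambda>y. y i) \<in> gauss_product \<rightarrow>\<^sub>M std_normal_distribution"
    using measurable_component_singleton[of i UNIV "\<lambda>_. std_normal_distribution"]
    by (simp add: gauss_product_def)
  have "distr (mixed_product p S) borel (\<lambda>a. snd a i) = distr (mixed_product p S) std_normal_distribution ((\<lambda>y. y i) \<circ> snd)"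
    by (intro distr_cong) (auto simp: comp_def)
  also have "\<dots> = distr (distr (mixed_product p S) gauss_product snd) std_normal_distribution (\<lambda>y. y i)"
    unfolding mixed_product_def by (rule distr_distr[symmetric, OF m measurable_snd])
  also have "distr (mixed_product p S) gauss_product snd = gauss_product"
  proof (rule measure_eqI)
    fix X assume "X \<in> sets (distr (mixed_product p S) gauss_product snd)"
    then have X [measurable]: "X \<in> sets gauss_product" by simp
    have "snd -` X \<inter> space (mixed_product p S) = space (two_point_product p S) \<times> X"
      using sets.sets_into_space[OF X] by (auto simp: mixed_product_def space_pair_measure)
    then show "emeasure (distr (mixed_product p S) gauss_product snd) X = emeasure gauss_product X"
      unfolding mixed_product_def
      by (subst emeasure_distr) (auto simp: B.emeasure_pair_measure_Times A.emeasure_space_1)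
  qed simp
  also have "distr gauss_product std_normal_distribution (\<lambda>y. y i) = std_normal_distribution"
    unfolding gauss_product_def by (rule distr_PiM_component) (auto intro: prob_space_std_normal)
  finally show ?thesis .
qed

lemma distr_mixed_fst: "distr (mixed_product p S) (two_point_product p S) fst = two_point_product p S"
proof -
  interpret B: prob_space gauss_product by (rule prob_space_gauss_product)
  show ?thesis unfolding mixed_product_def by (rule B.distr_pair_fst)
qed

lemma distr_mixed_Inl:
  assumes "s \<in> S"
  shows "distr (mixed_product p S) (measure_pmf (bernoulli_pmf p)) (\<lambda>a. fst a s) = measure_pmf (bernoulli_pmf p)"
proof -
  have m [measurable]: "(\<lambda>x. x s) \<in> two_point_product p S \<rightarrow>\<^sub>M measure_pmf (bernoulli_pmf p)"
    using measurable_component_singleton[OF assms, of "\<lambda>_. measure_pmf (bernoulli_pmf p)"]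
    by (simp add: two_point_product_def)
  have "distr (mixed_product p S) (measure_pmf (bernoulli_pmf p)) (\<lambda>a. fst a s) = distr (mixed_product p S) (measure_pmf (bernoulli_pmf p)) ((\<lambda>x. x s) \<circ> fst)"
    by (intro distr_cong) (auto simp: comp_def)
  also have "\<dots> = distr (distr (mixed_product p S) (two_point_product p S) fst) (measure_pmf (bernoulli_pmf p)) (\<lambda>x. x s)"
    unfolding mixed_product_def by (rule distr_distr[symmetric, OF m measurable_fst])
  also note distr_mixed_fst
  also have "distr (two_point_product p S) (measure_pmf (bernoulli_pmf p)) (\<lambda>x. x s) = measure_pmf (bernoulli_pmf p)"
    unfolding two_point_product_def by (rule distr_PiM_component) (auto intro: assms prob_space_measure_pmf)
  finally show ?thesis .
qed

lemma measurable_mixed_Inl [measurable]: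
  "s \<in> S \<Longrightarrow> (\<lambda>a. fst a s) \<in> mixed_product p S \<rightarrow>\<^sub>M measure_pmf (bernoulli_pmf p)"
  using measurable_component_singleton[of s S "\<lambda>_. measure_pmf (bernoulli_pmf p)"]
  unfolding mixed_product_def two_point_product_def by measurable

lemma measurable_mixed_Inr [measurable]: "(\<lambda>a. snd a i) \<in> borel_measurable (mixed_product p S)"
  using measurable_component_singleton[of i UNIV "\<lambda>_. std_normal_distribution"]
  unfolding mixed_product_def gauss_product_def by measurable

section \<open>Approximation by functions of finitely many coordinates\<close>

context resampling begin

lemma integral_square_minus_avg_le:
  assumes f: "f \<in> L2_functions M"
  shows "(\<integral>x. (f x - avg I f x)\<^sup>2 \<partial>M) \<le> (\<integral>x. (f x)\<^sup>2 \<partial>M)"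
  unfolding integral_square_minus_avg[OF f] by simp

text \<open>
  The squared distance of \<open>f\<close> to its average is a quadratic form in \<open>f\<close>, which gives the inequality
  \<open>(a + b)\<^sup>2 \<le> 2 a\<^sup>2 + 2 b\<^sup>2\<close> for it.
\<close>

lemma integral_square_minus_avg_add_le:
  assumes f: "f \<in> L2_functions M" and g: "g \<in> L2_functions M"
  shows "(\<integral>x. ((f x + g x) - avg I (\<lambda>x. f x + g x) x)\<^sup>2 \<partial>M)
    \<le> 2 * (\<integral>x. (f x - avg I f x)\<^sup>2 \<partial>M) + 2 * (\<integral>x. (g x - avg I g x)\<^sup>2 \<partial>M)"
proof -
  have L: "(\<lambda>x. u x - avg I u x) \<in> L2_functions M" if "u \<in> L2_functions M" for u
    by (intro L2_functions_diff avg_L2 that)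
  note int = L2_functionsD(2)[OF L]
  have "AE x in M. avg I (\<lambda>x. f x + g x) x = avg I f x + avg I g x"
    using AE_integrable_mrg[OF L2_functions_integrable[OF f], of I] AE_integrable_mrg[OF L2_functions_integrable[OF g], of I]
    by eventually_elim (simp add: avg_def)
  then have "(\<integral>x. ((f x + g x) - avg I (\<lambda>x. f x + g x) x)\<^sup>2 \<partial>M) \<le>
     (\<integral>x. 2 * (f x - avg I f x)\<^sup>2 + 2 * (g x - avg I g x)\<^sup>2 \<partial>M)"
  proof (intro integral_mono_AE int L2_functions_add f g, goal_cases)
    case 2
    then show ?case
    proof eventually_elim
      case (elim x)
      have "0 \<le> ((f x - avg I f x) - (g x - avg I g x))\<^sup>2" by simp
      then show ?case unfolding elim by (simp add: power2_eq_square algebra_simps)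
    qed
  qed (use int[OF f] int[OF g] in auto)
  also have "\<dots> = 2 * (\<integral>x. (f x - avg I f x)\<^sup>2 \<partial>M) + 2 * (\<integral>x. (g x - avg I g x)\<^sup>2 \<partial>M)"
    using int[OF f] int[OF g] by simp
  finally show ?thesis .
qed

context
  fixes J :: "nat \<Rightarrow> 'k set"
begin

text \<open>
  The square-integrable functions to which the averages given the coordinates in \<open>J n\<close> converge
  in \<open>L\<^sup>2\<close>; they form a closed subspace.
\<close>

definition approximable :: "('a \<Rightarrow> real) \<Rightarrow> bool" where
  "approximable f \<longleftrightarrow> f \<in> L2_functions M \<and> (\<lambda>n. \<integral>x. (f x - avg (J n) f x)\<^sup>2 \<partial>M) \<longlonglongrightarrow> 0"

lemma approximable_cong:
  assumes f: "approximable f" and eq: "\<And>x. x \<in> space M \<Longrightarrow> f x = g x"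
  shows "approximable g"
proof -
  have "avg I f x = avg I g x" if x: "x \<in> space M" for I x
  proof -
    have "mrg I x b \<in> space M" if "b \<in> space M" for b
      using measurable_space[OF mrg_measurable[of I], of "(x, b)"] x that by (simp add: space_pair_measure)
    then show ?thesis unfolding avg_def using eq by (intro Bochner_Integration.integral_cong) auto
  qed
  then have "(\<integral>x. (f x - avg (J n) f x)\<^sup>2 \<partial>M) = (\<integral>x. (g x - avg (J n) g x)\<^sup>2 \<partial>M)" for n
    using eq by (intro Bochner_Integration.integral_cong) auto
  moreover have "g \<in> L2_functions M"
  proof -
    have "f \<in> borel_measurable M \<longleftrightarrow> g \<in> borel_measurable M"
      "integrable M (\<lambda>x. (f x)\<^sup>2) \<longleftrightarrow> integrable M (\<lambda>x. (g x)\<^sup>2)"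
      using eq by (auto intro!: measurable_cong Bochner_Integration.integrable_cong)
    then show ?thesis using f by (auto simp: approximable_def L2_functions_def)
  qed
  ultimately show ?thesis using f by (simp add: approximable_def)
qed

lemma approximable_add:
  assumes "approximable f" "approximable g"
  shows "approximable (\<lambda>x. f x + g x)"
proof -
  have f: "f \<in> L2_functions M" and g: "g \<in> L2_functions M" using assms by (auto simp: approximable_def)
  have "(\<lambda>n. \<integral>x. ((f x + g x) - avg (J n) (\<lambda>x. f x + g x) x)\<^sup>2 \<partial>M) \<longlonglongrightarrow> 0"
  proof (rule tendsto_sandwich[OF _ _ tendsto_const])
    show "(\<lambda>n. 2 * (\<integral>x. (f x - avg (J n) f x)\<^sup>2 \<partial>M) + 2 * (\<integral>x. (g x - avg (J n) g x)\<^sup>2 \<partial>M)) \<longlonglongrightarrow> 0"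
      using assms by (auto simp: approximable_def intro!: tendsto_eq_intros)
  qed (use integral_square_minus_avg_add_le[OF f g] in auto)
  then show ?thesis using L2_functions_add[OF f g] by (simp add: approximable_def)
qed

lemma approximable_cmult:
  assumes "approximable f"
  shows "approximable (\<lambda>x. c * f x)"
proof -
  have "(c * f x - avg I (\<lambda>x. c * f x) x)\<^sup>2 = c\<^sup>2 * (f x - avg I f x)\<^sup>2" for x I
    by (simp add: avg_def right_diff_distrib[symmetric] power_mult_distrib)
  then show ?thesis using assms
    by (auto simp: approximable_def intro!: tendsto_mult_right_zero L2_functions_cmult)
qed

lemma approximable_const: "approximable (\<lambda>x. c)"
  by (simp add: approximable_def L2_functions_def avg_def prob_space)

lemma approximable_sum:
  "(\<And>i. i \<in> A \<Longrightarrow> approximable (f i)) \<Longrightarrow> approximable (\<lambda>x. \<Sum>i\<in>A. f i x)"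
  by (induction A rule: infinite_finite_induct) (auto intro!: approximable_add approximable_const)

lemma approximable_limit:
  assumes f: "f \<in> L2_functions M" and g: "\<And>m. approximable (g m)"
    and lim: "(\<lambda>m. \<integral>x. (f x - g m x)\<^sup>2 \<partial>M) \<longlonglongrightarrow> 0"
  shows "approximable f"
proof -
  have gL: "g m \<in> L2_functions M" for m using g by (simp add: approximable_def)
  have "(\<lambda>n. \<integral>x. (f x - avg (J n) f x)\<^sup>2 \<partial>M) \<longlonglongrightarrow> 0"
  proof (rule LIMSEQ_I)
    fix e :: real assume e: "e > 0"
    have "eventually (\<lambda>m. (\<integral>x. (f x - g m x)\<^sup>2 \<partial>M) < e / 4) sequentially"
      using lim e by (intro order_tendstoD(2)[OF lim]) simp
    then obtain m where m: "(\<integral>x. (f x - g m x)\<^sup>2 \<partial>M) < e / 4" by (auto simp: eventually_sequentially)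
    have "eventually (\<lambda>n. (\<integral>x. (g m x - avg (J n) (g m) x)\<^sup>2 \<partial>M) < e / 4) sequentially"
      using g[of m] e by (intro order_tendstoD(2)[of _ 0]) (auto simp: approximable_def)
    then have "eventually (\<lambda>n. (\<integral>x. (f x - avg (J n) f x)\<^sup>2 \<partial>M) < e) sequentially"
    proof eventually_elim
      case (elim n)
      note D = L2_functions_diff[OF f gL[of m]]
      have "(\<integral>x. (f x - avg (J n) f x)\<^sup>2 \<partial>M) \<le> 2 * (\<integral>x. (g m x - avg (J n) (g m) x)\<^sup>2 \<partial>M)
         + 2 * (\<integral>x. ((f x - g m x) - avg (J n) (\<lambda>x. f x - g m x) x)\<^sup>2 \<partial>M)"
        using integral_square_minus_avg_add_le[OF gL[of m] D, of "J n"] by simp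
      also have "\<dots> < e" using elim m integral_square_minus_avg_le[OF D, of "J n"] by simp
      finally show ?case .
    qed
    then show "\<exists>no. \<forall>n\<ge>no. norm ((\<integral>x. (f x - avg (J n) f x)\<^sup>2 \<partial>M) - 0) < e"
      by (auto simp: eventually_sequentially)
  qed
  then show ?thesis using f by (simp add: approximable_def)
qed

text \<open>
  The sets which depend on the coordinates in \<open>J m\<close> only, for all large \<open>m\<close>. Asking for all large \<open>m\<close>
  makes the family closed under intersection for an arbitrary sequence \<open>J\<close>.
\<close>

definition cylinders :: "'a set set" where
  "cylinders = {A \<in> sets M. \<exists>n. \<forall>m\<ge>n. \<forall>a\<in>space M. \<forall>b\<in>space M. mrg (J m) a b \<in> A \<longleftrightarrow> a \<in> A}"

text \<open>
  The sets with approximable indicator contain the cylinders and are closed under complements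
  and countable disjoint unions, so they contain the generated sigma-algebra.
\<close>

lemma approximable_indicator:
  assumes gen: "sets M \<subseteq> sigma_sets (space M) cylinders" and A: "A \<in> sets M"
  shows "approximable (indicat_real A)"
proof -
  have L2: "indicat_real A \<in> L2_functions M" if "A \<in> sets M" for A
  proof -
    have "(\<lambda>x. (indicat_real A x)\<^sup>2) = indicat_real A" by (auto simp: fun_eq_iff indicator_def)
    then show ?thesis using that by (simp add: L2_functions_def less_top[symmetric])
  qed
  have sub: "B \<in> sets M" if "B \<in> sigma_sets (space M) cylinders" for B
    using sets.sigma_sets_subset[of cylinders M] that by (auto simp: cylinders_def)
  have "Int_stable cylinders"
  proof (rule Int_stableI)
    fix A B assume "A \<in> cylinders" "B \<in> cylinders"
    then obtain n n' where "A \<in> sets M" "B \<in> sets M"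
      "\<And>m a b. m \<ge> n \<Longrightarrow> a \<in> space M \<Longrightarrow> b \<in> space M \<Longrightarrow> mrg (J m) a b \<in> A \<longleftrightarrow> a \<in> A"
      "\<And>m a b. m \<ge> n' \<Longrightarrow> a \<in> space M \<Longrightarrow> b \<in> space M \<Longrightarrow> mrg (J m) a b \<in> B \<longleftrightarrow> a \<in> B"
      unfolding cylinders_def by blast
    then show "A \<inter> B \<in> cylinders"
      unfolding cylinders_def by (auto intro!: exI[of _ "max n n'"])
  qed
  moreover have "cylinders \<subseteq> Pow (space M)" using sets.sets_into_space by (auto simp: cylinders_def)
  moreover have "A \<in> sigma_sets (space M) cylinders" using gen A by blast
  ultimately show ?thesis
  proof (induction rule: sigma_sets_induct_disjoint)
    case (basic A)
    then obtain n where n: "A \<in> sets M"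
      "\<And>m a b. m \<ge> n \<Longrightarrow> a \<in> space M \<Longrightarrow> b \<in> space M \<Longrightarrow> mrg (J m) a b \<in> A \<longleftrightarrow> a \<in> A"
      unfolding cylinders_def by blast
    have "eventually (\<lambda>m. (\<integral>x. (indicat_real A x - avg (J m) (indicat_real A) x)\<^sup>2 \<partial>M) = 0) sequentially"
      using eventually_ge_at_top[of n]
    proof eventually_elim
      case (elim m)
      have "avg (J m) (indicat_real A) a = indicat_real A a" if "a \<in> space M" for a
      proof -
        have "avg (J m) (indicat_real A) a = (\<integral>b. indicat_real A a \<partial>M)"
          unfolding avg_def using n(2)[OF elim that] by (intro Bochner_Integration.integral_cong) (auto simp: indicator_def)
        then show ?thesis by (simp add: prob_space)
      qed
      then show ?case by (intro integral_eq_zero_AE) auto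
    qed
    then show ?case using L2[OF n(1)] by (auto simp: approximable_def intro: tendsto_eventually)
  next
    case empty
    then show ?case using approximable_const[of 0] by simp
  next
    case (compl A)
    have "approximable (\<lambda>x. 1 + (-1) * indicat_real A x)"
      by (intro approximable_add approximable_const approximable_cmult compl)
    then show ?case by (rule approximable_cong) (auto simp: indicator_def)
  next
    case (union A)
    then have A: "range A \<subseteq> sets M" using sub by blast
    have U: "(\<Union>i. A i) \<in> sets M" using A by blast
    show ?case
    proof (rule approximable_limit[OF L2[OF U]])
      show "approximable (\<lambda>x. \<Sum>i<m. indicat_real (A i) x)" for m
        by (intro approximable_sum union)
      have "(\<integral>x. (indicat_real (\<Union>i. A i) x - (\<Sum>i<m. indicat_real (A i) x))\<^sup>2 \<partial>M) = prob (\<Union>i. A i) - (\<Sum>i<m. prob (A i))" for m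
      proof -
        have s: "(\<Sum>i<m. indicat_real (A i) x) = indicat_real (\<Union>i<m. A i) x" for x
          using union(1) by (subst indicator_UN_disjoint) (auto simp: disjoint_family_on_def)
        have "(\<integral>x. (indicat_real (\<Union>i. A i) x - (\<Sum>i<m. indicat_real (A i) x))\<^sup>2 \<partial>M)
          = (\<integral>x. indicat_real (\<Union>i. A i) x - indicat_real (\<Union>i<m. A i) x \<partial>M)"
          unfolding s by (intro Bochner_Integration.integral_cong) (auto simp: indicator_def)
        also have "\<dots> = prob (\<Union>i. A i) - prob (\<Union>i<m. A i)"
          using A U by (subst Bochner_Integration.integral_diff) (auto simp: less_top[symmetric] image_subset_iff)
        also have "prob (\<Union>i<m. A i) = (\<Sum>i<m. prob (A i))"
          using A union(1) by (intro finite_measure_finite_Union) (auto simp: disjoint_family_on_def)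
        finally show ?thesis .
      qed
      moreover have "(\<lambda>m. prob (\<Union>i. A i) - (\<Sum>i<m. prob (A i))) \<longlonglongrightarrow> prob (\<Union>i. A i) - prob (\<Union>i. A i)"
        using finite_measure_UNION[OF A union(1)] by (intro tendsto_diff tendsto_const) (simp add: sums_def)
      ultimately show "(\<lambda>m. \<integral>x. (indicat_real (\<Union>i. A i) x - (\<Sum>i<m. indicat_real (A i) x))\<^sup>2 \<partial>M) \<longlonglongrightarrow> 0" by simp
    qed
  qed
qed

lemma avg_tendsto_L2:
  assumes gen: "sets M \<subseteq> sigma_sets (space M) cylinders" and f: "f \<in> L2_functions M"
  shows "(\<lambda>n. \<integral>x. (f x - avg (J n) f x)\<^sup>2 \<partial>M) \<longlonglongrightarrow> 0"
proof -
  have [measurable]: "f \<in> borel_measurable M" using L2_functionsD[OF f] by simp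
  obtain F where F': "\<forall>i. simple_function M (F i)" "\<forall>x\<in>space M. (\<lambda>i. F i x) \<longlonglongrightarrow> f x"
    "\<forall>i. \<forall>x\<in>space M. dist (F i x) 0 \<le> 2 * dist (f x) 0"
    using borel_measurable_implies_sequence_metric[OF \<open>f \<in> borel_measurable M\<close>, of 0]
    by (elim exE conjE) (rule that)
  have F: "\<And>i. simple_function M (F i)" "\<And>x. x \<in> space M \<Longrightarrow> (\<lambda>i. F i x) \<longlonglongrightarrow> f x"
    "\<And>i x. x \<in> space M \<Longrightarrow> dist (F i x) 0 \<le> 2 * dist (f x) 0"
    using F' by auto
  have [measurable]: "F i \<in> borel_measurable M" for i using F(1) by (rule borel_measurable_simple_function)
  have "approximable f"
  proof (rule approximable_limit[OF f])
    fix i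
    have "approximable (\<lambda>x. \<Sum>y\<in>F i ` space M. y * indicat_real (F i -` {y} \<inter> space M) x)"
      by (intro approximable_sum approximable_cmult approximable_indicator gen) measurable
    then show "approximable (F i)"
    proof (rule approximable_cong)
      fix x assume "x \<in> space M"
      from simple_function_indicator_representation_banach[OF F(1)[of i] this]
      show "(\<Sum>y\<in>F i ` space M. y * indicat_real (F i -` {y} \<inter> space M) x) = F i x"
        unfolding real_scaleR_def by (subst mult.commute) (rule sym)
    qed
  next
    have "(\<lambda>m. \<integral>x. (f x - F m x)\<^sup>2 \<partial>M) \<longlonglongrightarrow> (\<integral>x. 0 \<partial>M)"
    proof (rule integral_dominated_convergence)
      show "integrable M (\<lambda>x. 9 * (f x)\<^sup>2)" using L2_functionsD[OF f] by simp
      show "AE x in M. (\<lambda>m. (f x - F m x)\<^sup>2) \<longlonglongrightarrow> 0"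
      proof (rule AE_I2)
        fix x assume "x \<in> space M"
        then have "(\<lambda>m. (f x - F m x)\<^sup>2) \<longlonglongrightarrow> (f x - f x)\<^sup>2" by (intro tendsto_intros F)
        then show "(\<lambda>m. (f x - F m x)\<^sup>2) \<longlonglongrightarrow> 0" by simp
      qed
      fix m
      show "AE x in M. norm ((f x - F m x)\<^sup>2) \<le> 9 * (f x)\<^sup>2"
      proof (rule AE_I2)
        fix x assume "x \<in> space M"
        then have "\<bar>f x - F m x\<bar> \<le> 3 * \<bar>f x\<bar>" using F(3)[of x m] by (simp add: dist_real_def)
        then have "\<bar>f x - F m x\<bar>\<^sup>2 \<le> (3 * \<bar>f x\<bar>)\<^sup>2" by (intro power_mono) auto
        then show "norm ((f x - F m x)\<^sup>2) \<le> 9 * (f x)\<^sup>2" by (simp add: power_mult_distrib)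
      qed
    qed measurable
    then show "(\<lambda>m. \<integral>x. (f x - F m x)\<^sup>2 \<partial>M) \<longlonglongrightarrow> 0" by simp
  qed
  then show ?thesis by (simp add: approximable_def)
qed

end

end

text \<open>
  The first \<open>n\<close> coordinates of each kind, in an enumeration of \<open>S\<close>.
\<close>

definition mixed_index :: "'s set \<Rightarrow> nat \<Rightarrow> ('s + nat) set" where
  "mixed_index S n = Inl ` {s \<in> S. to_nat_on S s < n} \<union> Inr ` {..<n}"

lemma finite_mixed_index:
  assumes "countable S" shows "finite (mixed_index S n)"
proof -
  have "finite {s \<in> S. to_nat_on S s < n}"
    using finite_vimage_IntI[OF finite_lessThan[of n] inj_on_to_nat_on[OF assms]]
    by (rule finite_subset[rotated]) auto
  then show ?thesis by (simp add: mixed_index_def)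
qed

text \<open>
  Every coordinate is measurable for the sigma-algebra generated by the cylinders, hence so is the
  identity map.
\<close>

lemma sets_mixed_product_cylinders:
  assumes S: "countable S"
  shows "sets (mixed_product p S) \<subseteq> sigma_sets (space (mixed_product p S)) (resampling.cylinders (mixed_product p S) mixed_mrg (mixed_index S))"
proof -
  interpret resampling "mixed_product p S" mixed_mrg by (rule resampling_mixed_product)
  let ?M = "mixed_product p S" and ?C = "cylinders (mixed_index S)"
  let ?G = "sigma (space ?M) ?C"
  have C: "?C \<subseteq> Pow (space ?M)" using sets.sets_into_space by (auto simp: cylinders_def)
  have sG: "sets ?G = sigma_sets (space ?M) ?C" by (rule sets_measure_of[OF C])
  have 1: "(\<lambda>a. fst a s) \<in> ?G \<rightarrow>\<^sub>M measure_pmf (bernoulli_pmf p)" if s: "s \<in> S" for s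
  proof (rule measurableI)
    fix X assume "X \<in> sets (measure_pmf (bernoulli_pmf p))"
    have m: "(\<lambda>a. fst a s) \<in> ?M \<rightarrow>\<^sub>M measure_pmf (bernoulli_pmf p)"
      using measurable_component_singleton[OF s, of "\<lambda>_. measure_pmf (bernoulli_pmf p)"]
      unfolding mixed_product_def two_point_product_def by measurable
    have "(\<lambda>a. fst a s) -` X \<inter> space ?M \<in> ?C"
      unfolding cylinders_def
    proof (intro CollectI conjI exI[of _ "Suc (to_nat_on S s)"] allI impI ballI)
      show "(\<lambda>a. fst a s) -` X \<inter> space ?M \<in> events" by (rule measurable_sets[OF m]) simp
      fix n a b assume n: "Suc (to_nat_on S s) \<le> n" and ab: "a \<in> space ?M" "b \<in> space ?M"
      have "mixed_mrg (mixed_index S n) a b \<in> space ?M"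
        using measurable_space[OF mrg_measurable, of "(a, b)"] ab by (auto simp: space_pair_measure)
      moreover have "Inl s \<in> mixed_index S n" using s n by (auto simp: mixed_index_def)
      ultimately show "mixed_mrg (mixed_index S n) a b \<in> (\<lambda>a. fst a s) -` X \<inter> space ?M \<longleftrightarrow> a \<in> (\<lambda>a. fst a s) -` X \<inter> space ?M"
        using ab by (simp add: mixed_mrg_def)
    qed
    then show "(\<lambda>a. fst a s) -` X \<inter> space ?G \<in> sets ?G" unfolding sG by (simp add: space_measure_of[OF C])
  qed simp
  have 2: "(\<lambda>a. snd a i) \<in> ?G \<rightarrow>\<^sub>M std_normal_distribution" for i
  proof (rule measurableI)
    fix X assume X: "X \<in> sets std_normal_distribution"
    have m: "(\<lambda>a. snd a i) \<in> ?M \<rightarrow>\<^sub>M std_normal_distribution"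
      using measurable_component_singleton[of i UNIV "\<lambda>_. std_normal_distribution"]
      unfolding mixed_product_def gauss_product_def by measurable
    have "(\<lambda>a. snd a i) -` X \<inter> space ?M \<in> ?C"
      unfolding cylinders_def
    proof (intro CollectI conjI exI[of _ "Suc i"] allI impI ballI)
      show "(\<lambda>a. snd a i) -` X \<inter> space ?M \<in> events" by (rule measurable_sets[OF m X])
      fix n a b assume n: "Suc i \<le> n" and ab: "a \<in> space ?M" "b \<in> space ?M"
      have "mixed_mrg (mixed_index S n) a b \<in> space ?M"
        using measurable_space[OF mrg_measurable, of "(a, b)"] ab by (auto simp: space_pair_measure)
      moreover have "Inr i \<in> mixed_index S n" using n by (auto simp: mixed_index_def)
      ultimately show "mixed_mrg (mixed_index S n) a b \<in> (\<lambda>a. snd a i) -` X \<inter> space ?M \<longleftrightarrow> a \<in> (\<lambda>a. snd a i) -` X \<inter> space ?M"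
        using ab by (simp add: mixed_mrg_def)
    qed
    then show "(\<lambda>a. snd a i) -` X \<inter> space ?G \<in> sets ?G" unfolding sG by (simp add: space_measure_of[OF C])
  qed simp
  have sp: "space ?G = space ?M" by (rule space_measure_of[OF C])
  have "(\<lambda>a i. fst a i) \<in> ?G \<rightarrow>\<^sub>M two_point_product p S" unfolding two_point_product_def
  proof (rule measurable_PiM_single'[OF 1])
    show "(\<lambda>a i. fst a i) \<in> space ?G \<rightarrow> (\<Pi>\<^sub>E i\<in>S. space (measure_pmf (bernoulli_pmf p)))"
      unfolding sp by (auto simp: mixed_product_def space_pair_measure two_point_product_def space_PiM)
  qed
  moreover have "(\<lambda>a i. snd a i) \<in> ?G \<rightarrow>\<^sub>M gauss_product" unfolding gauss_product_def
    by (rule measurable_PiM_single'[OF 2]) auto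
  ultimately have id: "(\<lambda>a. (fst a, snd a)) \<in> ?G \<rightarrow>\<^sub>M ?M" unfolding mixed_product_def by (intro measurable_Pair) simp_all
  show ?thesis
  proof
    fix A assume A: "A \<in> sets ?M"
    have "(\<lambda>a. (fst a, snd a)) -` A \<inter> space ?G = A" using sets.sets_into_space[OF A] by (auto simp: sp)
    with measurable_sets[OF id A] show "A \<in> sigma_sets (space ?M) ?C" by (simp add: sG)
  qed
qed

section \<open>Sums of coins and the central limit theorem\<close>

lemma avg_Inl:
  assumes s: "s \<in> S"
  shows "resampling.avg (mixed_product p S) mixed_mrg (-{Inl s}) f (x, y) = (\<integral>b. f (x(s := b), y) \<partial>measure_pmf (bernoulli_pmf p))"
proof -
  interpret resampling "mixed_product p S" mixed_mrg by (rule resampling_mixed_product)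
  have "mixed_mrg (-{Inl s}) (x, y) b = (x(s := fst b s), y)" for b
    by (auto simp: mixed_mrg_def fun_eq_iff)
  then have "avg (-{Inl s}) f (x, y) = (\<integral>b. f (x(s := fst b s), y) \<partial>mixed_product p S)"
    by (simp add: avg_def)
  also have "\<dots> = (\<integral>b. f (x(s := b), y) \<partial>distr (mixed_product p S) (measure_pmf (bernoulli_pmf p)) (\<lambda>a. fst a s))"
    by (rule integral_distr[symmetric, OF measurable_mixed_Inl[OF s]]) simp
  also have "\<dots> = (\<integral>b. f (x(s := b), y) \<partial>measure_pmf (bernoulli_pmf p))"
    by (simp only: distr_mixed_Inl[OF s])
  finally show ?thesis .
qed

lemma Delta_bool_eq_avg:
  assumes "s \<in> S"
  shows "Delta_bool p s f = (\<lambda>a. f a - resampling.avg (mixed_product p S) mixed_mrg (-{Inl s}) f a)"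
  by (simp add: Delta_bool_def avg_Inl[OF assms] fun_eq_iff)

lemma nn_integral_mrg_Inl:
  assumes s: "s \<in> S"
  shows "(\<integral>\<^sup>+b. F (mixed_mrg (-{Inl s}) (x, y) b) \<partial>mixed_product p S) = (\<integral>\<^sup>+b. F (x(s := b), y) \<partial>measure_pmf (bernoulli_pmf p))"
proof -
  have "mixed_mrg (-{Inl s}) (x, y) b = (x(s := fst b s), y)" for b
    by (auto simp: mixed_mrg_def fun_eq_iff)
  then have "(\<integral>\<^sup>+b. F (mixed_mrg (-{Inl s}) (x, y) b) \<partial>mixed_product p S) = (\<integral>\<^sup>+b. F (x(s := fst b s), y) \<partial>mixed_product p S)"
    by simp
  also have "\<dots> = (\<integral>\<^sup>+b. F (x(s := b), y) \<partial>distr (mixed_product p S) (measure_pmf (bernoulli_pmf p)) (\<lambda>a. fst a s))"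
    by (rule nn_integral_distr[symmetric, OF measurable_mixed_Inl[OF s]]) simp
  also have "\<dots> = (\<integral>\<^sup>+b. F (x(s := b), y) \<partial>measure_pmf (bernoulli_pmf p))"
    by (simp only: distr_mixed_Inl[OF s])
  finally show ?thesis .
qed

text \<open>
  The two-point inequality on each fibre, integrated over the other coordinates.
\<close>

lemma mixed_Inl_log_sobolev:
  assumes p: "0 < p" "p < 1" and s: "s \<in> S" and f: "f \<in> L2_functions (mixed_product p S)"
  defines "A \<equiv> resampling.avg (mixed_product p S) mixed_mrg (-{Inl s})"
  shows "(\<integral>\<^sup>+ a. ennreal (rel_ent ((f a)\<^sup>2) (A (\<lambda>a. (f a)\<^sup>2) a)) \<partial>mixed_product p S)
    \<le> ennreal (c_LS p * (\<integral>a. (f a - A f a)\<^sup>2 \<partial>mixed_product p S))"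
proof -
  let ?M = "mixed_product p S" and ?I = "-{Inl s} :: ('a + nat) set"
  interpret resampling ?M mixed_mrg by (rule resampling_mixed_product)
  have A: "A = avg ?I" by (simp add: A_def)
  have [measurable]: "f \<in> borel_measurable ?M" using L2_functionsD[OF f] by simp
  have c: "c_LS p \<ge> 0" using c_LS_ge_2[OF p] by simp
  have D: "(\<lambda>a. f a - avg ?I f a) \<in> L2_functions ?M" by (intro L2_functions_diff avg_L2 f)
  have pw: "(\<integral>\<^sup>+ b. ennreal (rel_ent ((f (mixed_mrg ?I a b))\<^sup>2) (avg ?I (\<lambda>a. (f a)\<^sup>2) (mixed_mrg ?I a b))) \<partial>?M)
    \<le> (\<integral>\<^sup>+ b. ennreal (c_LS p * (f (mixed_mrg ?I a b) - avg ?I f (mixed_mrg ?I a b))\<^sup>2) \<partial>?M)" for a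
  proof (cases a)
    case (Pair x y)
    define u where "u = f (x(s := True), y)"
    define v where "v = f (x(s := False), y)"
    define m where "m = p * u\<^sup>2 + (1 - p) * v\<^sup>2"
    have m: "avg ?I (\<lambda>a. (f a)\<^sup>2) (x, y) = m"
      using p by (simp add: avg_Inl[OF s] m_def u_def v_def mult.commute)
    have g: "avg ?I f (x, y) = p * u + (1 - p) * v"
      using p by (simp add: avg_Inl[OF s] u_def v_def mult.commute)
    have m0: "m \<ge> 0" using p by (simp add: m_def)
    have mz: "m = 0 \<Longrightarrow> u\<^sup>2 = 0 \<and> v\<^sup>2 = 0"
      using p by (simp add: m_def add_nonneg_eq_0_iff)
    have nn: "rel_ent (u\<^sup>2) m \<ge> 0" "rel_ent (v\<^sup>2) m \<ge> 0"
      using m0 mz by (auto intro!: rel_ent_nonneg)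
    have "(\<integral>\<^sup>+ b. ennreal (rel_ent ((f (mixed_mrg ?I a b))\<^sup>2) (avg ?I (\<lambda>a. (f a)\<^sup>2) (mixed_mrg ?I a b))) \<partial>?M)
      = ennreal (p * rel_ent (u\<^sup>2) m + (1 - p) * rel_ent (v\<^sup>2) m)"
      unfolding avg_mrg Pair m using p nn
      by (subst nn_integral_mrg_Inl[OF s, where F="\<lambda>z. ennreal (rel_ent ((f z)\<^sup>2) m)"])
        (simp add: u_def[symmetric] v_def[symmetric] ennreal_mult'[symmetric] ennreal_plus[symmetric] mult.commute del: ennreal_plus)
    also have "\<dots> \<le> ennreal (c_LS p * (p * (1 - p) * (u - v)\<^sup>2))"
      unfolding m_def by (intro ennreal_leI two_point_log_sobolev p)
    also have "\<dots> = ennreal (p * (c_LS p * (u - (p * u + (1 - p) * v))\<^sup>2) + (1 - p) * (c_LS p * (v - (p * u + (1 - p) * v))\<^sup>2))"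
      by (rule arg_cong[where f=ennreal]) (simp add: power2_eq_square algebra_simps)
    also have "\<dots> = (\<integral>\<^sup>+ b. ennreal (c_LS p * (f (mixed_mrg ?I a b) - avg ?I f (mixed_mrg ?I a b))\<^sup>2) \<partial>?M)"
      unfolding avg_mrg Pair g using p c
      by (subst nn_integral_mrg_Inl[OF s, where F="\<lambda>z. ennreal (c_LS p * (f z - (p * u + (1 - p) * v))\<^sup>2)"])
        (simp add: u_def[symmetric] v_def[symmetric] ennreal_mult'[symmetric] ennreal_plus[symmetric] mult.commute del: ennreal_plus)
    finally show ?thesis .
  qed
  have "(\<integral>\<^sup>+ a. ennreal (rel_ent ((f a)\<^sup>2) (avg ?I (\<lambda>a. (f a)\<^sup>2) a)) \<partial>?M)
    = (\<integral>\<^sup>+ a. \<integral>\<^sup>+ b. ennreal (rel_ent ((f (mixed_mrg ?I a b))\<^sup>2) (avg ?I (\<lambda>a. (f a)\<^sup>2) (mixed_mrg ?I a b))) \<partial>?M \<partial>?M)"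
    by (rule nn_integral_mrg[symmetric]) measurable
  also have "\<dots> \<le> (\<integral>\<^sup>+ a. \<integral>\<^sup>+ b. ennreal (c_LS p * (f (mixed_mrg ?I a b) - avg ?I f (mixed_mrg ?I a b))\<^sup>2) \<partial>?M \<partial>?M)"
    by (intro nn_integral_mono pw)
  also have "\<dots> = (\<integral>\<^sup>+ a. ennreal (c_LS p * (f a - avg ?I f a)\<^sup>2) \<partial>?M)"
    by (rule nn_integral_mrg) measurable
  also have "\<dots> = ennreal (c_LS p * (\<integral>a. (f a - avg ?I f a)\<^sup>2 \<partial>?M))"
    using c L2_functionsD(2)[OF D] by (subst nn_integral_eq_integral) auto
  finally show ?thesis by (simp add: A)
qed

lemma continuous_on_rel_ent:
  assumes m: "m > 0" shows "continuous_on {0..} (\<lambda>x. rel_ent x m)"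
proof -
  have "continuous (at x within {0..}) (\<lambda>x. x * ln (x / m))" if x: "x \<in> {0..}" for x :: real
  proof (cases "x = 0")
    case True
    have "((\<lambda>x. x * ln (x / m)) \<longlongrightarrow> 0) (at_right 0)" using m by real_asymp
    then show ?thesis using True by (simp add: continuous_within at_within_Ici_at_right)
  next
    case False
    then have "isCont (\<lambda>x. x * ln (x / m)) x" using x m by (auto intro!: continuous_intros)
    then show ?thesis by (rule continuous_at_imp_continuous_at_within)
  qed
  then have "continuous_on {0..} (\<lambda>x. x * ln (x / m))" by (simp add: continuous_on_eq_continuous_within)
  from continuous_on_add[OF continuous_on_diff[OF this continuous_on_id] continuous_on_const, of m]
  show ?thesis by (simp add: rel_ent_def)
qed

definition coin_sign :: "nat \<Rightarrow> (nat \<Rightarrow> bool) \<times> (nat \<Rightarrow> real) \<Rightarrow> real" where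
  "coin_sign i a = (if fst a i then 1 else -1)"

text \<open>
  The random signs needed for the central limit theorem are taken from the mixed product itself, so that
  tensorization is available for them.
\<close>

abbreviation coins :: "((nat \<Rightarrow> bool) \<times> (nat \<Rightarrow> real)) measure" where
  "coins \<equiv> mixed_product (1/2) UNIV"

lemma coin_sign_measurable [measurable]: "coin_sign i \<in> borel_measurable coins"
  unfolding coin_sign_def[abs_def] by (rule measurable_compose[OF measurable_mixed_Inl]) auto

lemma coin_sign_clt:
  "weak_conv_m (\<lambda>n. distr coins borel (\<lambda>a. (\<Sum>i<n. coin_sign i a) / sqrt n)) std_normal_distribution"
proof -
  let ?B = "measure_pmf (bernoulli_pmf (1/2))"
  let ?g = "\<lambda>b. if b then 1 else (-1::real)"
  interpret resampling coins mixed_mrg by (rule resampling_mixed_product)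
  have X: "coin_sign i = (\<lambda>a. ?g (fst a i))" for i by (simp add: coin_sign_def fun_eq_iff)
  have m: "(\<lambda>a. fst a i) \<in> coins \<rightarrow>\<^sub>M ?B" for i by (rule measurable_mixed_Inl) simp
  have "distr coins (\<Pi>\<^sub>M i\<in>UNIV. ?B) (\<lambda>a. \<lambda>i\<in>UNIV. fst a i) = distr coins (two_point_product (1/2) UNIV) fst"
    by (simp add: two_point_product_def restrict_UNIV)
  also have "\<dots> = (\<Pi>\<^sub>M i\<in>UNIV. ?B)" by (simp only: distr_mixed_fst) (simp add: two_point_product_def)
  also have "\<dots> = (\<Pi>\<^sub>M i\<in>UNIV. distr coins ?B (\<lambda>a. fst a i))" by (simp only: distr_mixed_Inl UNIV_I)
  finally have "indep_vars (\<lambda>_. ?B) (\<lambda>i a. fst a i) (UNIV :: nat set)"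
    by (subst indep_vars_iff_distr_eq_PiM) (use m in auto)
  then have indep: "indep_vars (\<lambda>_. borel) coin_sign UNIV"
    unfolding X[abs_def] by (rule indep_vars_compose2) simp
  have int: "(\<integral>a. h (coin_sign i a) \<partial>coins) = (h 1 + h (-1)) / 2" for h :: "real \<Rightarrow> real" and i
  proof -
    have "(\<integral>a. h (coin_sign i a) \<partial>coins) = (\<integral>b. h (?g b) \<partial>distr coins ?B (\<lambda>a. fst a i))"
      unfolding X by (rule integral_distr[symmetric, OF m]) simp
    then show ?thesis by (simp add: distr_mixed_Inl)
  qed
  have d: "distr coins borel (coin_sign i) = distr ?B borel ?g" for i
  proof -
    have "distr coins borel (coin_sign i) = distr (distr coins ?B (\<lambda>a. fst a i)) borel ?g"
      unfolding X by (subst distr_distr[OF _ m]) (auto simp: comp_def)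
    then show ?thesis by (simp only: distr_mixed_Inl UNIV_I)
  qed
  have E: "expectation (coin_sign i) = 0" for i using int[of "\<lambda>x. x"] by simp
  have "weak_conv_m (\<lambda>n. distr coins borel (\<lambda>a. (\<Sum>i<n. coin_sign i a - 0) / sqrt (real n * 1\<^sup>2))) std_normal_distribution"
  proof (rule central_limit_theorem[OF indep E])
    show "integrable coins (\<lambda>a. (coin_sign i a)\<^sup>2)" for i
    proof (rule integrable_const_bound[where B=1])
      show "AE a in coins. norm ((coin_sign i a)\<^sup>2) \<le> 1" by (simp add: coin_sign_def)
    qed measurable
    show "variance (coin_sign i) = 1\<^sup>2" for i unfolding E using int[of "\<lambda>x. (x - 0)\<^sup>2" i] by simp
    show "distr coins borel (coin_sign i) = distr ?B borel ?g" for i by (rule d)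
  qed simp
  then show ?thesis by simp
qed

text \<open>
  Flipping one of \<open>n\<close> signs moves the normalized sum by \<open>2 / sqrt n\<close>. By the mean value theorem the
  one-coordinate variance of \<open>\<phi>\<close> of the sum is \<open>\<phi>'(t)\<^sup>2 / n\<close> for some nearby \<open>t\<close>, and summing over
  \<open>n\<close> coordinates, each with constant \<open>c_LS (1/2) = 2\<close>, produces the Gaussian energy up to \<open>\<epsilon>\<close>.
\<close>

lemma coin_sum_log_sobolev:
  fixes \<phi> \<phi>' :: "real \<Rightarrow> real" and n :: nat
  assumes d: "\<And>t. (\<phi> has_real_derivative \<phi>' t) (at t)" and n: "n > 0"
    and bdd: "\<And>t. \<bar>\<phi> t\<bar> \<le> B" "\<And>t. \<bar>\<phi>' t\<bar> \<le> B'" and [measurable]: "\<phi>' \<in> borel_measurable borel"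
    and unif: "\<And>s t. \<bar>s - t\<bar> \<le> 2 / sqrt n \<Longrightarrow> \<bar>\<phi>' s\<bar> \<le> \<bar>\<phi>' t\<bar> + \<epsilon>" and \<epsilon>: "\<epsilon> > 0"
  defines "u \<equiv> \<lambda>a. (\<Sum>i<n. coin_sign i a) / sqrt n"
  shows "(\<integral>\<^sup>+a. ennreal (rel_ent ((\<phi> (u a))\<^sup>2) (\<integral>a. (\<phi> (u a))\<^sup>2 \<partial>coins)) \<partial>coins)
    \<le> ennreal (2 * (\<integral>a. (\<bar>\<phi>' (u a)\<bar> + \<epsilon>)\<^sup>2 \<partial>coins))"
proof -
  interpret resampling coins mixed_mrg by (rule resampling_mixed_product)
  define f where "f a = \<phi> (u a)" for a
  have "continuous_on UNIV \<phi>" using d by (intro continuous_at_imp_continuous_on) (auto intro: DERIV_isCont)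
  then have [measurable]: "\<phi> \<in> borel_measurable borel" by (rule borel_measurable_continuous_onI)
  have [measurable]: "u \<in> borel_measurable coins" unfolding u_def by measurable
  have [measurable]: "f \<in> borel_measurable coins" unfolding f_def[abs_def] by measurable
  have f2: "integrable coins (\<lambda>a. (f a)\<^sup>2)"
    by (rule integrable_const_bound[where B="B\<^sup>2"]) (auto simp: f_def abs_le_square_iff[symmetric] intro!: AE_I2 order_trans[OF bdd(1)])
  have f: "f \<in> L2_functions coins" using f2 by (simp add: L2_functions_def)
  have B': "B' \<ge> 0" using bdd(2)[of 0] by linarith
  have g2: "integrable coins (\<lambda>a. (\<bar>\<phi>' (u a)\<bar> + \<epsilon>)\<^sup>2)"
    by (rule integrable_const_bound[where B="(B' + \<epsilon>)\<^sup>2"]) (use \<epsilon> bdd(2) in \<open>auto intro!: AE_I2 power_mono\<close>)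
  let ?J = "Inl ` {..<n} :: (nat + nat) set"
  have dep: "avg ?J (\<lambda>a. (f a)\<^sup>2) a = (f a)\<^sup>2" for a
  proof -
    have "coin_sign i (mixed_mrg ?J a b) = coin_sign i a" if "i < n" for i b
      using that by (auto simp: coin_sign_def mixed_mrg_def)
    then have "f (mixed_mrg ?J a b) = f a" for b by (simp add: f_def u_def)
    then show ?thesis by (simp add: avg_def prob_space)
  qed
  have pw: "(f a - avg (-{Inl k}) f a)\<^sup>2 \<le> (\<bar>\<phi>' (u a)\<bar> + \<epsilon>)\<^sup>2 / n" if k: "k < n" for a k
  proof (cases a)
    case (Pair x y)
    \<comment> \<open>the contribution of the other coins; \<open>v (1)\<close> and \<open>v (-1)\<close> are the two values of the normalized sum\<close>
    define w where "w = (\<Sum>i\<in>{..<n} - {k}. coin_sign i a)"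
    define v where "v b = (w + b) / sqrt n" for b
    have sn: "sqrt n > 0" using n by simp
    have u: "u (x(k := b), y) = v (if b then 1 else -1)" for b
    proof -
      have "(\<Sum>i<n. coin_sign i (x(k := b), y)) = coin_sign k (x(k := b), y) + (\<Sum>i\<in>{..<n} - {k}. coin_sign i (x(k := b), y))"
        using k by (subst sum.remove[of _ k]) auto
      also have "(\<Sum>i\<in>{..<n} - {k}. coin_sign i (x(k := b), y)) = w"
        unfolding w_def by (rule sum.cong) (auto simp: coin_sign_def Pair)
      finally show ?thesis by (simp add: u_def v_def coin_sign_def)
    qed
    have ua: "u a = v (coin_sign k a)" using u[of "x k"] by (simp add: Pair coin_sign_def)
    have "\<exists>t. v (-1) < t \<and> t < v 1 \<and> \<phi> (v 1) - \<phi> (v (-1)) = (v 1 - v (-1)) * \<phi>' t"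
      using sn by (intro MVT2 d) (auto simp: v_def divide_strict_right_mono)
    then obtain t where t: "v (-1) < t" "t < v 1" "\<phi> (v 1) - \<phi> (v (-1)) = (v 1 - v (-1)) * \<phi>' t" by blast
    have v1: "v 1 - v (-1) = 2 / sqrt n" by (simp add: v_def diff_divide_distrib[symmetric])
    have "\<bar>t - u a\<bar> \<le> 2 / sqrt n" using t(1,2) v1 unfolding ua by (auto simp: coin_sign_def)
    then have le: "\<bar>\<phi>' t\<bar> \<le> \<bar>\<phi>' (u a)\<bar> + \<epsilon>" by (rule unif)
    have "avg (-{Inl k}) f a = (\<phi> (v 1) + \<phi> (v (-1))) / 2"
      by (simp add: Pair avg_Inl f_def u)
    then have "\<bar>f a - avg (-{Inl k}) f a\<bar> = \<bar>\<phi> (v 1) - \<phi> (v (-1))\<bar> / 2"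
      by (simp add: f_def ua coin_sign_def) (auto simp: field_simps abs_if)
    also have "\<dots> = \<bar>\<phi>' t\<bar> / sqrt n" unfolding t(3) v1 using sn by (simp add: abs_mult)
    also have "\<dots> \<le> (\<bar>\<phi>' (u a)\<bar> + \<epsilon>) / sqrt n" using le sn by (intro divide_right_mono) auto
    finally have "\<bar>f a - avg (-{Inl k}) f a\<bar>\<^sup>2 \<le> ((\<bar>\<phi>' (u a)\<bar> + \<epsilon>) / sqrt n)\<^sup>2" by (intro power_mono) auto
    then show ?thesis using n by (simp add: power_divide)
  qed
  have "(\<integral>\<^sup>+a. ennreal (rel_ent ((f a)\<^sup>2) (\<integral>a. (f a)\<^sup>2 \<partial>coins)) \<partial>coins)
    \<le> (\<Sum>k\<in>?J. \<integral>\<^sup>+ a. ennreal (rel_ent ((f a)\<^sup>2) (avg (-{k}) (\<lambda>a. (f a)\<^sup>2) a)) \<partial>coins)"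
    by (intro entropy_tensorization f2) (auto simp: dep)
  also have "\<dots> = (\<Sum>k<n. \<integral>\<^sup>+ a. ennreal (rel_ent ((f a)\<^sup>2) (avg (-{Inl k}) (\<lambda>a. (f a)\<^sup>2) a)) \<partial>coins)"
    by (subst sum.reindex) auto
  also have "\<dots> \<le> (\<Sum>k<n. ennreal (2 * ((\<integral>a. (\<bar>\<phi>' (u a)\<bar> + \<epsilon>)\<^sup>2 \<partial>coins) / n)))"
  proof (rule sum_mono)
    fix k assume k: "k \<in> {..<n}"
    have "(\<integral>\<^sup>+ a. ennreal (rel_ent ((f a)\<^sup>2) (avg (-{Inl k}) (\<lambda>a. (f a)\<^sup>2) a)) \<partial>coins)
      \<le> ennreal (c_LS (1/2) * (\<integral>a. (f a - avg (-{Inl k}) f a)\<^sup>2 \<partial>coins))"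
      by (rule mixed_Inl_log_sobolev) (auto intro: f)
    also have "\<dots> = ennreal (2 * (\<integral>a. (f a - avg (-{Inl k}) f a)\<^sup>2 \<partial>coins))" by (simp add: c_LS_def)
    also have "\<dots> \<le> ennreal (2 * (\<integral>a. (\<bar>\<phi>' (u a)\<bar> + \<epsilon>)\<^sup>2 / n \<partial>coins))"
      using k by (intro ennreal_leI mult_left_mono integral_mono pw L2_functionsD(2) L2_functions_diff f avg_L2 integrable_divide g2) auto
    finally show "(\<integral>\<^sup>+ a. ennreal (rel_ent ((f a)\<^sup>2) (avg (-{Inl k}) (\<lambda>a. (f a)\<^sup>2) a)) \<partial>coins)
      \<le> ennreal (2 * ((\<integral>a. (\<bar>\<phi>' (u a)\<bar> + \<epsilon>)\<^sup>2 \<partial>coins) / n))" by simp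
  qed
  also have "\<dots> = ennreal (2 * (\<integral>a. (\<bar>\<phi>' (u a)\<bar> + \<epsilon>)\<^sup>2 \<partial>coins))"
    using n by (simp add: ennreal_of_nat_eq_real_of_nat ennreal_mult'[symmetric])
  finally show ?thesis by (simp add: f_def)
qed

section \<open>The Gaussian inequality for smooth functions\<close>

abbreviation gauss :: "real measure" where
  "gauss \<equiv> std_normal_distribution"

lemma real_distribution_std_normal: "real_distribution gauss"
  using prob_space_std_normal by (intro real_distribution.intro real_distribution_axioms.intro) auto

lemma integrable_bounded_continuous:
  fixes g :: "real \<Rightarrow> real"
  assumes "finite_measure N" "sets N = sets borel" "continuous_on UNIV g" "\<And>x. \<bar>g x\<bar> \<le> B"
  shows "integrable N g"
proof -
  interpret finite_measure N by fact
  have "g \<in> borel_measurable borel" using assms(3) by (rule borel_measurable_continuous_onI)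
  then have "g \<in> borel_measurable N" using measurable_cong_sets[OF assms(2) refl] by blast
  then show ?thesis by (rule integrable_const_bound[rotated]) (use assms(4) in auto)
qed

text \<open>
  Pass to the limit in \<open>coin_sum_log_sobolev\<close> by the central limit theorem. The mean \<open>M n\<close> of the square
  depends on \<open>n\<close>; the chain rule replaces it by its limit \<open>m\<close>, so that the integrand becomes a fixed bounded
  continuous function of the normalized sum.
\<close>

lemma gauss_log_sobolev_smooth:
  fixes \<phi> \<phi>' :: "real \<Rightarrow> real"
  assumes d: "\<And>t. (\<phi> has_real_derivative \<phi>' t) (at t)"
    and bdd: "\<And>t. \<bar>\<phi> t\<bar> \<le> B" "\<And>t. \<bar>\<phi>' t\<bar> \<le> B'" and unif: "uniformly_continuous_on UNIV \<phi>'"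
  shows "(\<integral>\<^sup>+t. ennreal (rel_ent ((\<phi> t)\<^sup>2) (\<integral>t. (\<phi> t)\<^sup>2 \<partial>gauss)) \<partial>gauss) \<le> ennreal (2 * (\<integral>t. (\<phi>' t)\<^sup>2 \<partial>gauss))"
proof -
  interpret N: prob_space gauss by (rule prob_space_std_normal)
  interpret resampling coins mixed_mrg by (rule resampling_mixed_product)
  have c\<phi>: "continuous_on UNIV \<phi>" using d by (intro continuous_at_imp_continuous_on) (auto intro: DERIV_isCont)
  have c\<phi>': "continuous_on UNIV \<phi>'" using unif by (rule uniformly_continuous_imp_continuous)
  have [measurable]: "\<phi> \<in> borel_measurable borel" "\<phi>' \<in> borel_measurable borel"
    using c\<phi> c\<phi>' by (auto intro: borel_measurable_continuous_onI)
  define u where "u n a = (\<Sum>i<n. coin_sign i a) / sqrt n" for n :: nat and a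
  have [measurable]: "u n \<in> borel_measurable coins" for n unfolding u_def[abs_def] by measurable
  have conv: "(\<lambda>n. \<integral>a. g (u n a) \<partial>coins) \<longlonglongrightarrow> (\<integral>t. g t \<partial>gauss)"
    if g: "continuous_on UNIV g" "\<And>x. \<bar>g x\<bar> \<le> D" for g :: "real \<Rightarrow> real" and D
  proof -
    have [measurable]: "g \<in> borel_measurable borel" using g(1) by (rule borel_measurable_continuous_onI)
    have "(\<lambda>n. integral\<^sup>L (distr coins borel (u n)) g) \<longlonglongrightarrow> integral\<^sup>L gauss g"
    proof (rule weak_conv_imp_integral_bdd_continuous_conv)
      show "real_distribution (distr coins borel (u n))" for n
        by (rule real_distribution_distr) simp
      show "weak_conv_m (\<lambda>n. distr coins borel (u n)) gauss"
        using coin_sign_clt by (simp add: u_def[abs_def])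
      show "isCont g x" for x using g(1) by (simp add: continuous_on_eq_continuous_at)
    qed (use g real_distribution_std_normal in auto)
    then show ?thesis by (simp add: integral_distr)
  qed
  define m where "m = (\<integral>t. (\<phi> t)\<^sup>2 \<partial>gauss)"
  have \<phi>2: "\<bar>(\<phi> t)\<^sup>2\<bar> \<le> B\<^sup>2" for t using bdd(1)[of t] by (simp add: abs_le_square_iff[symmetric])
  have c2: "continuous_on UNIV (\<lambda>t. (\<phi> t)\<^sup>2)" by (intro continuous_intros c\<phi>)
  have i2: "integrable gauss (\<lambda>t. (\<phi> t)\<^sup>2)"
    by (rule integrable_bounded_continuous[OF _ _ c2 \<phi>2]) (auto simp: N.finite_measure_axioms)
  show ?thesis
  proof (cases "m = 0")
    case True
    then have "AE t in gauss. (\<phi> t)\<^sup>2 = 0"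
      using integral_nonneg_eq_0_iff_AE[OF i2] by (simp add: m_def)
    then have "(\<integral>\<^sup>+t. ennreal (rel_ent ((\<phi> t)\<^sup>2) m) \<partial>gauss) = (\<integral>\<^sup>+t. 0 \<partial>gauss)"
      by (intro nn_integral_cong_AE) (auto elim!: eventually_mono simp: True)
    then show ?thesis by (simp add: m_def)
  next
    case False
    then have m: "m > 0" using N.prob_space by (simp add: m_def less_le)
    define G where "G t = rel_ent ((\<phi> t)\<^sup>2) m" for t
    have cG: "continuous_on UNIV G"
      unfolding G_def[abs_def] by (rule continuous_on_compose2[OF continuous_on_rel_ent[OF m] c2]) auto
    have "compact ((\<lambda>x. rel_ent x m) ` {0..B\<^sup>2})"
      by (intro compact_continuous_image continuous_on_subset[OF continuous_on_rel_ent[OF m]]) auto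
    then have "bounded ((\<lambda>x. rel_ent x m) ` {0..B\<^sup>2})" by (rule compact_imp_bounded)
    then obtain D where "\<forall>y\<in>(\<lambda>x. rel_ent x m) ` {0..B\<^sup>2}. norm y \<le> D" unfolding bounded_iff by blast
    then have D: "\<bar>rel_ent x m\<bar> \<le> D" if "x \<in> {0..B\<^sup>2}" for x using that by auto
    have GD: "\<bar>G t\<bar> \<le> D" for t unfolding G_def using \<phi>2[of t] by (intro D) auto
    have G0: "G t \<ge> 0" for t unfolding G_def using m by (intro rel_ent_nonneg) auto
    define M where "M n = (\<integral>a. (\<phi> (u n a))\<^sup>2 \<partial>coins)" for n
    have M: "M \<longlonglongrightarrow> m" unfolding M_def[abs_def] m_def by (rule conv[OF c2 \<phi>2])
    have "((\<lambda>x. rel_ent x m) \<longlongrightarrow> rel_ent m m) (at m within {0..})"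
      using continuous_on_rel_ent[OF m] unfolding continuous_on_def by (rule bspec) (use m in simp)
    then have "isCont (\<lambda>x. rel_ent x m) m"
      using at_within_interior[of m "{0..}"] m by (simp add: isCont_def interior_Ici[of "-1"])
    then have relM: "(\<lambda>n. rel_ent (M n) m) \<longlonglongrightarrow> 0"
      using isCont_tendsto_compose[OF _ M] by fastforce
    have main: "(\<integral>t. G t \<partial>gauss) \<le> 2 * (\<integral>t. (\<bar>\<phi>' t\<bar> + \<epsilon>)\<^sup>2 \<partial>gauss)" if \<epsilon>: "\<epsilon> > 0" for \<epsilon>
    proof -
      have H: "continuous_on UNIV (\<lambda>t. (\<bar>\<phi>' t\<bar> + \<epsilon>)\<^sup>2)" "\<bar>(\<bar>\<phi>' t\<bar> + \<epsilon>)\<^sup>2\<bar> \<le> (B' + \<epsilon>)\<^sup>2" for t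
        using bdd(2)[of t] \<epsilon> by (auto intro!: continuous_intros c\<phi>' power_mono)
      from unif \<epsilon> obtain \<delta> where \<delta>: "\<delta> > 0" "\<And>s t. dist s t < \<delta> \<Longrightarrow> dist (\<phi>' s) (\<phi>' t) < \<epsilon>"
        unfolding uniformly_continuous_on_def by blast
      have "(\<lambda>n. 2 / sqrt (real n)) \<longlonglongrightarrow> 0" by real_asymp
      then have ev: "eventually (\<lambda>n. 2 / sqrt (real n) < \<delta>) sequentially"
        using \<delta>(1) by (rule order_tendstoD)
      show ?thesis
      proof (rule tendsto_le[OF sequentially_bot])
        show "(\<lambda>n. 2 * (\<integral>a. (\<bar>\<phi>' (u n a)\<bar> + \<epsilon>)\<^sup>2 \<partial>coins) + rel_ent (M n) m) \<longlonglongrightarrow> 2 * (\<integral>t. (\<bar>\<phi>' t\<bar> + \<epsilon>)\<^sup>2 \<partial>gauss)"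
          using tendsto_add[OF tendsto_mult_left[OF conv[OF H]] relM, of 2] by simp
        show "(\<lambda>n. \<integral>a. G (u n a) \<partial>coins) \<longlonglongrightarrow> (\<integral>t. G t \<partial>gauss)" by (rule conv[OF cG GD])
        show "eventually (\<lambda>n. (\<integral>a. G (u n a) \<partial>coins) \<le> 2 * (\<integral>a. (\<bar>\<phi>' (u n a)\<bar> + \<epsilon>)\<^sup>2 \<partial>coins) + rel_ent (M n) m) sequentially"
          using ev eventually_gt_at_top[of 0]
        proof eventually_elim
          case (elim n)
          have un: "\<bar>\<phi>' s\<bar> \<le> \<bar>\<phi>' t\<bar> + \<epsilon>" if "\<bar>s - t\<bar> \<le> 2 / sqrt n" for s t
            using \<delta>(2)[of s t] that elim by (auto simp: dist_real_def)
          have iY: "integrable coins (\<lambda>a. (\<phi> (u n a))\<^sup>2)"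
            by (rule integrable_const_bound[where B="B\<^sup>2"]) (use \<phi>2 in auto)
          have [measurable]: "G \<in> borel_measurable borel" using cG by (rule borel_measurable_continuous_onI)
          have iG: "integrable coins (\<lambda>a. G (u n a))"
            by (rule integrable_const_bound[where B=D]) (use GD in auto)
          have "ennreal (\<integral>a. G (u n a) \<partial>coins) = (\<integral>\<^sup>+a. ennreal (rel_ent ((\<phi> (u n a))\<^sup>2) m) \<partial>coins)"
            using nn_integral_eq_integral[OF iG] G0 by (simp add: G_def)
          also have "\<dots> \<le> (\<integral>\<^sup>+a. ennreal (rel_ent ((\<phi> (u n a))\<^sup>2) (M n)) \<partial>coins) + ennreal (rel_ent (M n) m)"
            unfolding M_def by (rule rel_ent_chain[OF iY _ m]) simp
          also have "\<dots> \<le> ennreal (2 * (\<integral>a. (\<bar>\<phi>' (u n a)\<bar> + \<epsilon>)\<^sup>2 \<partial>coins)) + ennreal (rel_ent (M n) m)"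
            unfolding M_def u_def using elim by (intro add_right_mono coin_sum_log_sobolev[where B=B and B'=B'] d bdd \<epsilon> un) auto
          also have "ennreal (2 * (\<integral>a. (\<bar>\<phi>' (u n a)\<bar> + \<epsilon>)\<^sup>2 \<partial>coins)) + ennreal (rel_ent (M n) m)
            = ennreal (2 * (\<integral>a. (\<bar>\<phi>' (u n a)\<bar> + \<epsilon>)\<^sup>2 \<partial>coins) + rel_ent (M n) m)"
            using m by (subst ennreal_plus) (auto intro!: rel_ent_nonneg simp: M_def)
          finally show ?case
            using m by (subst (asm) ennreal_le_iff) (auto intro!: rel_ent_nonneg add_nonneg_nonneg simp: M_def add_right_mono)
        qed
      qed
    qed
    have ia: "integrable gauss (\<lambda>t. \<bar>\<phi>' t\<bar>)" "integrable gauss (\<lambda>t. (\<phi>' t)\<^sup>2)"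
    proof -
      show "integrable gauss (\<lambda>t. \<bar>\<phi>' t\<bar>)"
        by (rule integrable_bounded_continuous[where B=B'])
          (use bdd(2) in \<open>auto simp: N.finite_measure_axioms intro!: continuous_intros c\<phi>'\<close>)
      show "integrable gauss (\<lambda>t. (\<phi>' t)\<^sup>2)"
        by (rule integrable_bounded_continuous[where B="B'\<^sup>2"])
          (use bdd(2) in \<open>auto simp: N.finite_measure_axioms abs_le_square_iff[symmetric] intro!: continuous_intros c\<phi>' order_trans[OF bdd(2)]\<close>)
    qed
    have eq: "(\<integral>t. (\<bar>\<phi>' t\<bar> + \<epsilon>)\<^sup>2 \<partial>gauss) = (\<integral>t. (\<phi>' t)\<^sup>2 \<partial>gauss) + 2 * \<epsilon> * (\<integral>t. \<bar>\<phi>' t\<bar> \<partial>gauss) + \<epsilon>\<^sup>2" for \<epsilon>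
    proof -
      have "(\<integral>t. (\<bar>\<phi>' t\<bar> + \<epsilon>)\<^sup>2 \<partial>gauss) = (\<integral>t. (\<phi>' t)\<^sup>2 + 2 * \<epsilon> * \<bar>\<phi>' t\<bar> + \<epsilon>\<^sup>2 \<partial>gauss)"
        by (simp add: power2_sum algebra_simps)
      then show ?thesis using ia N.prob_space by simp
    qed
    have "(\<integral>t. G t \<partial>gauss) \<le> 2 * (\<integral>t. (\<phi>' t)\<^sup>2 \<partial>gauss)"
    proof (rule tendsto_lowerbound)
      show "((\<lambda>\<epsilon>. 2 * (\<integral>t. (\<bar>\<phi>' t\<bar> + \<epsilon>)\<^sup>2 \<partial>gauss)) \<longlongrightarrow> 2 * (\<integral>t. (\<phi>' t)\<^sup>2 \<partial>gauss)) (at_right 0)"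
        unfolding eq by (auto intro!: tendsto_eq_intros)
      show "eventually (\<lambda>\<epsilon>. (\<integral>t. G t \<partial>gauss) \<le> 2 * (\<integral>t. (\<bar>\<phi>' t\<bar> + \<epsilon>)\<^sup>2 \<partial>gauss)) (at_right 0)"
        using eventually_at_right_less[of "0::real"] by eventually_elim (rule main)
    qed simp
    moreover have "integrable gauss G"
      by (rule integrable_bounded_continuous[OF _ _ cG GD]) (auto simp: N.finite_measure_axioms)
    then have "(\<integral>\<^sup>+t. ennreal (G t) \<partial>gauss) = ennreal (\<integral>t. G t \<partial>gauss)"
      using G0 by (intro nn_integral_eq_integral) auto
    ultimately show ?thesis by (simp add: G_def m_def ennreal_leI)
  qed
qed

lemma tendsto_integral_square:
  assumes f: "f \<in> L2_functions N" and g: "\<And>n. g n \<in> L2_functions N"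
    and lim: "(\<lambda>n. \<integral>x. (g n x - f x)\<^sup>2 \<partial>N) \<longlonglongrightarrow> 0"
  shows "(\<lambda>n. \<integral>x. (g n x)\<^sup>2 \<partial>N) \<longlonglongrightarrow> (\<integral>x. (f x)\<^sup>2 \<partial>N)"
proof -
  let ?F = "\<integral>x. (f x)\<^sup>2 \<partial>N" and ?E = "\<lambda>n. \<integral>x. (g n x - f x)\<^sup>2 \<partial>N"
  have d: "(\<lambda>x. g n x - f x) \<in> L2_functions N" for n by (intro L2_functions_diff g f)
  have le: "\<bar>(\<integral>x. (g n x)\<^sup>2 \<partial>N) - ?F\<bar> \<le> (1 + 1 / \<delta>) * ?E n + \<delta> * ?F" if \<delta>: "\<delta> > 0" for \<delta> n
  proof -
    have pw: "\<bar>(g n x)\<^sup>2 - (f x)\<^sup>2\<bar> \<le> (1 + 1 / \<delta>) * (g n x - f x)\<^sup>2 + \<delta> * (f x)\<^sup>2" for x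
    proof -
      define a where "a = g n x - f x"
      have e: "(g n x)\<^sup>2 - (f x)\<^sup>2 = a\<^sup>2 + 2 * a * f x" by (simp add: a_def power2_eq_square algebra_simps)
      have "0 \<le> (a / sqrt \<delta> - sqrt \<delta> * f x)\<^sup>2" "0 \<le> (a / sqrt \<delta> + sqrt \<delta> * f x)\<^sup>2" by simp_all
      then have "2 * a * f x \<le> a\<^sup>2 / \<delta> + \<delta> * (f x)\<^sup>2" "- (2 * a * f x) \<le> a\<^sup>2 / \<delta> + \<delta> * (f x)\<^sup>2"
        using \<delta> by (simp_all add: power2_diff power2_sum power_divide power_mult_distrib)
      then have "\<bar>2 * a * f x\<bar> \<le> a\<^sup>2 / \<delta> + \<delta> * (f x)\<^sup>2" by (simp add: abs_le_iff)
      moreover have "\<bar>a\<^sup>2 + 2 * a * f x\<bar> \<le> a\<^sup>2 + \<bar>2 * a * f x\<bar>"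
        using abs_triangle_ineq[of "a\<^sup>2" "2 * a * f x"] by simp
      ultimately show ?thesis unfolding e a_def[symmetric] by (simp add: algebra_simps)
    qed
    have "\<bar>(\<integral>x. (g n x)\<^sup>2 \<partial>N) - ?F\<bar> = \<bar>\<integral>x. (g n x)\<^sup>2 - (f x)\<^sup>2 \<partial>N\<bar>"
      using L2_functionsD(2)[OF f] L2_functionsD(2)[OF g] by simp
    also have "\<dots> \<le> (\<integral>x. \<bar>(g n x)\<^sup>2 - (f x)\<^sup>2\<bar> \<partial>N)" by (rule integral_abs_bound)
    also have "\<dots> \<le> (\<integral>x. (1 + 1 / \<delta>) * (g n x - f x)\<^sup>2 + \<delta> * (f x)\<^sup>2 \<partial>N)"
      using L2_functionsD(2)[OF f] L2_functionsD(2)[OF g] L2_functionsD(2)[OF d]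
      by (intro integral_mono pw) auto
    also have "\<dots> = (1 + 1 / \<delta>) * ?E n + \<delta> * ?F"
      using L2_functionsD(2)[OF f] L2_functionsD(2)[OF d] by simp
    finally show ?thesis .
  qed
  have F0: "?F \<ge> 0" by simp
  show ?thesis
  proof (rule LIMSEQ_I)
    fix e :: real assume e: "e > 0"
    \<comment> \<open>makes the fixed part \<open>\<delta> * ?F\<close> of the error smaller than \<open>e / 2\<close>; the summand \<open>1\<close> avoids division by zero\<close>
    define \<delta> where "\<delta> = e / (2 * (1 + ?F))"
    have \<delta>: "\<delta> > 0" using e F0 by (simp add: \<delta>_def add_pos_nonneg)
    have "\<delta> * ?F < e / 2"
    proof -
      have "\<delta> * ?F = e / 2 * (?F / (1 + ?F))" by (simp add: \<delta>_def)
      also have "1 + ?F > 0" using F0 by linarith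
      then have "e / 2 * (?F / (1 + ?F)) < e / 2 * 1"
        using e by (intro mult_strict_left_mono) (auto simp: divide_less_eq)
      finally show ?thesis by simp
    qed
    note small = this
    have "eventually (\<lambda>n. (1 + 1 / \<delta>) * ?E n < e / 2) sequentially"
      using e by (intro order_tendstoD(2)[OF tendsto_mult_right_zero[OF lim]]) auto
    then have "eventually (\<lambda>n. \<bar>(\<integral>x. (g n x)\<^sup>2 \<partial>N) - ?F\<bar> < e) sequentially"
    proof eventually_elim
      case (elim n)
      then show ?case using le[OF \<delta>, of n] small by linarith
    qed
    then show "\<exists>no. \<forall>n\<ge>no. norm ((\<integral>x. (g n x)\<^sup>2 \<partial>N) - ?F) < e"
      by (simp add: eventually_sequentially)
  qed
qed

text \<open>
  The entropy is the integral of a nonnegative integrand that converges pointwise, so Fatou's lemma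
  gives lower semicontinuity. In this way logarithmic Sobolev inequalities pass to limits.
\<close>

lemma (in prob_space) rel_ent_square_lower_semicontinuous:
  assumes f: "f \<in> L2_functions M" and g: "\<And>n. g n \<in> L2_functions M"
    and lim: "(\<lambda>n. \<integral>x. (g n x - f x)\<^sup>2 \<partial>M) \<longlonglongrightarrow> 0" and AE: "AE x in M. (\<lambda>n. g n x) \<longlonglongrightarrow> f x"
    and bound: "\<And>n. (\<integral>\<^sup>+x. ennreal (rel_ent ((g n x)\<^sup>2) (\<integral>x. (g n x)\<^sup>2 \<partial>M)) \<partial>M) \<le> ennreal (c n)" and c: "c \<longlonglongrightarrow> c'"
  shows "(\<integral>\<^sup>+x. ennreal (rel_ent ((f x)\<^sup>2) (\<integral>x. (f x)\<^sup>2 \<partial>M)) \<partial>M) \<le> ennreal c'"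
proof -
  define m where "m = (\<integral>x. (f x)\<^sup>2 \<partial>M)"
  define m' where "m' n = (\<integral>x. (g n x)\<^sup>2 \<partial>M)" for n
  have [measurable]: "f \<in> borel_measurable M" "g n \<in> borel_measurable M" for n
    using f g by (auto dest: L2_functionsD)
  show ?thesis
  proof (cases "m = 0")
    case True
    then have "AE x in M. (f x)\<^sup>2 = 0"
      using integral_nonneg_eq_0_iff_AE[OF L2_functionsD(2)[OF f]] by (simp add: m_def)
    then have "(\<integral>\<^sup>+x. ennreal (rel_ent ((f x)\<^sup>2) m) \<partial>M) = (\<integral>\<^sup>+x. 0 \<partial>M)"
      by (intro nn_integral_cong_AE) (auto elim!: eventually_mono simp: True)
    then show ?thesis by (simp add: m_def)
  next
    case False
    then have m: "m > 0" by (simp add: m_def less_le)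
    have m': "m' \<longlonglongrightarrow> m" unfolding m'_def[abs_def] m_def by (rule tendsto_integral_square[OF f g lim])
    have "AE x in M. (\<lambda>n. ennreal (rel_ent ((g n x)\<^sup>2) (m' n))) \<longlonglongrightarrow> ennreal (rel_ent ((f x)\<^sup>2) m)"
      using AE
    proof eventually_elim
      case (elim x)
      have "(\<lambda>n. rel_ent ((g n x)\<^sup>2) m) \<longlonglongrightarrow> rel_ent ((f x)\<^sup>2) m"
        by (rule continuous_on_tendsto_compose[OF continuous_on_rel_ent[OF m]])
          (auto intro!: tendsto_power elim)
      moreover have "(\<lambda>n. (g n x)\<^sup>2 * (ln m - ln (m' n)) - m + m' n) \<longlonglongrightarrow> (f x)\<^sup>2 * (ln m - ln m) - m + m"
        using m by (intro tendsto_intros elim m') auto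
      ultimately have "(\<lambda>n. rel_ent ((g n x)\<^sup>2) m + ((g n x)\<^sup>2 * (ln m - ln (m' n)) - m + m' n)) \<longlonglongrightarrow> rel_ent ((f x)\<^sup>2) m"
        using tendsto_add by fastforce
      moreover have "eventually (\<lambda>n. m' n > 0) sequentially" using m' m by (rule order_tendstoD)
      then have "eventually (\<lambda>n. rel_ent ((g n x)\<^sup>2) m + ((g n x)\<^sup>2 * (ln m - ln (m' n)) - m + m' n) = rel_ent ((g n x)\<^sup>2) (m' n)) sequentially"
      proof eventually_elim
        case (elim n)
        then show ?case using m by (cases "g n x = 0") (auto simp: rel_ent_def ln_div algebra_simps)
      qed
      ultimately have "(\<lambda>n. rel_ent ((g n x)\<^sup>2) (m' n)) \<longlonglongrightarrow> rel_ent ((f x)\<^sup>2) m"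
        by (rule Lim_transform_eventually)
      then show ?case by (rule tendsto_ennrealI)
    qed
    then have "(\<integral>\<^sup>+x. ennreal (rel_ent ((f x)\<^sup>2) m) \<partial>M) = (\<integral>\<^sup>+x. liminf (\<lambda>n. ennreal (rel_ent ((g n x)\<^sup>2) (m' n))) \<partial>M)"
      by (intro nn_integral_cong_AE) (auto elim!: eventually_mono dest: lim_imp_Liminf[OF trivial_limit_sequentially])
    also have "\<dots> \<le> liminf (\<lambda>n. \<integral>\<^sup>+x. ennreal (rel_ent ((g n x)\<^sup>2) (m' n)) \<partial>M)"
      by (rule nn_integral_liminf) measurable
    also have "\<dots> \<le> liminf (\<lambda>n. ennreal (c n))"
      unfolding m'_def by (intro Liminf_mono always_eventually allI bound)
    also have "\<dots> = ennreal c'"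
      by (intro lim_imp_Liminf trivial_limit_sequentially tendsto_ennrealI c)
    finally show ?thesis by (simp add: m_def)
  qed
qed

section \<open>The Gaussian inequality for primitives of square-integrable functions\<close>

text \<open>
  Indicator of the open interval with end points \<open>0\<close> and \<open>t\<close>, for \<open>t\<close> of either sign; a single kernel in
  \<open>(t, s)\<close> to which Fubini's theorem can be applied.
\<close>

definition between0 :: "real \<Rightarrow> real \<Rightarrow> real" where
  "between0 t s = (if 0 < s \<and> s < t \<or> t < s \<and> s < 0 then 1 else 0)"

text \<open>
  The primitive that vanishes at \<open>0\<close>.
\<close>

definition prim :: "(real \<Rightarrow> real) \<Rightarrow> real \<Rightarrow> real" where
  "prim u t = sgn t * (\<integral>s. between0 t s * u s \<partial>lborel)"

lemma between0_measurable [measurable]: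
  "(\<lambda>(t, s). between0 t s) \<in> borel_measurable (borel \<Otimes>\<^sub>M borel)"
  unfolding between0_def by measurable

lemma between0_measurable_section [measurable]: "between0 t \<in> borel_measurable borel"
  unfolding between0_def[abs_def] by measurable

lemma between0_eq: "between0 t = (if 0 \<le> t then indicator {0<..<t} else indicator {t<..<0})"
  by (auto simp: between0_def indicator_def fun_eq_iff)

lemma between0_0_1: "0 \<le> between0 t s" "between0 t s \<le> 1" "between0 t s * between0 t s = between0 t s"
  by (auto simp: between0_def)

lemma prim_eq_LBINT: "prim u t = (LBINT s=ereal 0..ereal t. u s)"
  unfolding prim_def between0_eq interval_lebesgue_integral_def set_lebesgue_integral_def
  by (cases "t = 0") (auto simp: sgn_if)

lemma prim_measurable [measurable]:
  assumes [measurable]: "u \<in> borel_measurable borel"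
  shows "prim u \<in> borel_measurable borel"
  unfolding prim_def[abs_def] by measurable

lemma std_normal_density_ge:
  assumes "\<bar>s\<bar> \<le> R" shows "std_normal_density R \<le> std_normal_density s"
proof -
  have "s\<^sup>2 \<le> R\<^sup>2" using assms abs_le_square_iff[of s R] by auto
  then show ?thesis by (simp add: std_normal_density_def field_simps)
qed

lemma AE_gauss_iff:
  assumes [measurable]: "Measurable.pred borel P"
  shows "(AE x in gauss. P x) \<longleftrightarrow> (AE x in lborel. P x)"
  by (subst AE_density) (auto simp: normal_density_pos)

lemma nn_integral_gauss:
  assumes [measurable]: "F \<in> borel_measurable borel"
  shows "(\<integral>\<^sup>+x. F x \<partial>gauss) = (\<integral>\<^sup>+x. ennreal (std_normal_density x) * F x \<partial>lborel)"
  by (subst nn_integral_density) auto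

text \<open>
  The Gaussian density is bounded below on bounded intervals, so functions in \<open>L\<^sup>2\<close> of the Gaussian
  measure are locally integrable for Lebesgue measure.
\<close>

lemma nn_integral_interval_le_gauss:
  assumes [measurable]: "F \<in> borel_measurable borel"
  shows "(\<integral>\<^sup>+x. F x * indicator {-R..R} x \<partial>lborel) \<le> ennreal (1 / std_normal_density R) * (\<integral>\<^sup>+x. F x \<partial>gauss)"
proof -
  have "(\<integral>\<^sup>+x. F x * indicator {-R..R} x \<partial>lborel) \<le> (\<integral>\<^sup>+x. ennreal (1 / std_normal_density R) * (ennreal (std_normal_density x) * F x) \<partial>lborel)"
  proof (rule nn_integral_mono)
    fix x :: real
    show "F x * indicator {-R..R} x \<le> ennreal (1 / std_normal_density R) * (ennreal (std_normal_density x) * F x)"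
    proof (cases "x \<in> {-R..R}")
      case True
      then have "1 \<le> 1 / std_normal_density R * std_normal_density x"
        using std_normal_density_ge[of x R] normal_density_pos[of 1 0 R] by (simp add: abs_le_iff)
      then have "1 \<le> ennreal (1 / std_normal_density R * std_normal_density x)"
        using ennreal_leI by fastforce
      then have "1 * F x \<le> ennreal (1 / std_normal_density R * std_normal_density x) * F x"
        by (intro mult_right_mono) auto
      also have "ennreal (1 / std_normal_density R * std_normal_density x) = ennreal (1 / std_normal_density R) * ennreal (std_normal_density x)"
        by (rule ennreal_mult) auto
      finally show ?thesis using True by (simp add: mult.assoc)
    qed simp
  qed
  also have "\<dots> = ennreal (1 / std_normal_density R) * (\<integral>\<^sup>+x. F x \<partial>gauss)"
    by (simp add: nn_integral_cmult nn_integral_gauss)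
  finally show ?thesis .
qed

lemma L2_gauss_measurable: "u \<in> L2_functions gauss \<Longrightarrow> u \<in> borel_measurable borel"
  by (auto simp: L2_functions_def)

lemma L2_gauss_nn_finite:
  assumes "u \<in> L2_functions gauss"
  shows "(\<integral>\<^sup>+x. ennreal ((u x)\<^sup>2) \<partial>gauss) = ennreal (\<integral>x. (u x)\<^sup>2 \<partial>gauss)"
  using L2_functionsD(2)[OF assms] by (intro nn_integral_eq_integral) auto

lemma L2_gauss_local:
  assumes u: "u \<in> L2_functions gauss" and R: "\<bar>t\<bar> \<le> R"
  shows "integrable lborel (\<lambda>s. between0 t s * (u s)\<^sup>2)" "integrable lborel (\<lambda>s. between0 t s * u s)"
    "integrable lborel (between0 t)" "(\<integral>s. between0 t s \<partial>lborel) = \<bar>t\<bar>"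
    "(\<integral>s. between0 t s * (u s)\<^sup>2 \<partial>lborel) \<le> 1 / std_normal_density R * (\<integral>x. (u x)\<^sup>2 \<partial>gauss)"
proof -
  have [measurable]: "u \<in> borel_measurable borel" by (rule L2_gauss_measurable[OF u])
  have "(\<integral>\<^sup>+s. ennreal (between0 t s * (u s)\<^sup>2) \<partial>lborel) \<le> (\<integral>\<^sup>+s. ennreal ((u s)\<^sup>2) * indicator {-R..R} s \<partial>lborel)"
    using R by (intro nn_integral_mono) (auto simp: between0_def indicator_def)
  also have "\<dots> \<le> ennreal (1 / std_normal_density R) * (\<integral>\<^sup>+x. ennreal ((u x)\<^sup>2) \<partial>gauss)"
    by (rule nn_integral_interval_le_gauss) measurable
  also have "\<dots> = ennreal (1 / std_normal_density R * (\<integral>x. (u x)\<^sup>2 \<partial>gauss))"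
    unfolding L2_gauss_nn_finite[OF u] by (rule ennreal_mult[symmetric]) auto
  finally have le: "(\<integral>\<^sup>+s. ennreal (between0 t s * (u s)\<^sup>2) \<partial>lborel) \<le> ennreal (1 / std_normal_density R * (\<integral>x. (u x)\<^sup>2 \<partial>gauss))" .
  show i2: "integrable lborel (\<lambda>s. between0 t s * (u s)\<^sup>2)"
  proof (rule integrableI_nonneg)
    show "(\<integral>\<^sup>+s. ennreal (between0 t s * (u s)\<^sup>2) \<partial>lborel) < \<infinity>"
      using le by (rule le_less_trans) simp
  qed (auto simp: between0_0_1)
  show k: "integrable lborel (between0 t)" unfolding between0_eq by (auto simp: integrable_indicator_iff)
  show "(\<integral>s. between0 t s \<partial>lborel) = \<bar>t\<bar>" unfolding between0_eq by auto
  show "integrable lborel (\<lambda>s. between0 t s * u s)"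
  proof (rule Bochner_Integration.integrable_bound[OF Bochner_Integration.integrable_add[OF k i2]])
    have "\<bar>a\<bar> \<le> 1 + a\<^sup>2" for a :: real
    proof -
      have "0 \<le> (\<bar>a\<bar> - 1)\<^sup>2" by simp
      then have "2 * \<bar>a\<bar> \<le> 1 + a\<^sup>2" by (simp add: power2_diff)
      then show ?thesis by (simp add: abs_if split: if_splits)
    qed
    then show "AE s in lborel. norm (between0 t s * u s) \<le> norm (between0 t s + between0 t s * (u s)\<^sup>2)"
      by (auto simp: between0_def)
  qed auto
  have "ennreal (\<integral>s. between0 t s * (u s)\<^sup>2 \<partial>lborel) = (\<integral>\<^sup>+s. ennreal (between0 t s * (u s)\<^sup>2) \<partial>lborel)"
    by (intro nn_integral_eq_integral[symmetric] i2) (auto simp: between0_0_1)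
  also note le
  finally show "(\<integral>s. between0 t s * (u s)\<^sup>2 \<partial>lborel) \<le> 1 / std_normal_density R * (\<integral>x. (u x)\<^sup>2 \<partial>gauss)"
    by (subst (asm) ennreal_le_iff) auto
qed

text \<open>
  The Cauchy-Schwarz inequality on the interval between \<open>0\<close> and \<open>t\<close>, whose length is \<open>\<bar>t\<bar>\<close>.
\<close>

lemma prim_square_le:
  assumes u: "u \<in> L2_functions gauss"
  shows "(prim u t)\<^sup>2 \<le> \<bar>t\<bar> * (\<integral>s. between0 t s * (u s)\<^sup>2 \<partial>lborel)"
proof (cases "t = 0")
  case True
  then show ?thesis by (simp add: prim_def)
next
  case False
  note i = L2_gauss_local(1-4)[OF u order_refl, of t]
  define I where "I = (\<integral>s. between0 t s * u s \<partial>lborel)"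
  define Q where "Q = (\<integral>s. between0 t s * (u s)\<^sup>2 \<partial>lborel)"
  \<comment> \<open>the square that expands to \<open>\<bar>t\<bar> (\<bar>t\<bar> Q - I\<^sup>2)\<close>\<close>
  have "0 \<le> (\<integral>s. between0 t s * (\<bar>t\<bar> * u s - I)\<^sup>2 \<partial>lborel)"
    by (intro integral_nonneg_AE) (auto simp: between0_0_1)
  also have "(\<lambda>s. between0 t s * (\<bar>t\<bar> * u s - I)\<^sup>2) = (\<lambda>s. \<bar>t\<bar>\<^sup>2 * (between0 t s * (u s)\<^sup>2) - 2 * \<bar>t\<bar> * I * (between0 t s * u s) + I\<^sup>2 * between0 t s)"
    by (auto simp: fun_eq_iff power2_eq_square algebra_simps)
  also have "(\<integral>s. \<bar>t\<bar>\<^sup>2 * (between0 t s * (u s)\<^sup>2) - 2 * \<bar>t\<bar> * I * (between0 t s * u s) + I\<^sup>2 * between0 t s \<partial>lborel)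
    = \<bar>t\<bar>\<^sup>2 * Q - 2 * \<bar>t\<bar> * I * I + I\<^sup>2 * \<bar>t\<bar>"
    using i by (simp add: I_def Q_def del: power2_abs)
  also have "\<dots> = \<bar>t\<bar> * (\<bar>t\<bar> * Q - I\<^sup>2)" by (simp only: power2_eq_square) (simp add: algebra_simps)
  finally have "I\<^sup>2 \<le> \<bar>t\<bar> * Q" using False by (simp add: zero_le_mult_iff)
  moreover have "(prim u t)\<^sup>2 = I\<^sup>2" using False by (simp add: prim_def I_def power_mult_distrib sgn_if)
  ultimately show ?thesis by (simp add: Q_def)
qed

lemma nn_integral_normal_tail:
  assumes "a > 0"
  shows "(\<integral>\<^sup>+t. ennreal (t * std_normal_density t) * indicator {a..} t \<partial>lborel) = ennreal (std_normal_density a)"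
proof -
  have "(\<integral>\<^sup>+t. ennreal (t * std_normal_density t) * indicator {a..} t \<partial>lborel) = ennreal (0 - (- std_normal_density a))"
  proof (rule nn_integral_FTC_atLeast)
    show "((\<lambda>t. - std_normal_density t) \<longlongrightarrow> 0) at_top"
      unfolding std_normal_density_def by real_asymp
    fix t assume t: "a \<le> t"
    show "0 \<le> t * std_normal_density t" using t assms by simp
    have "DERIV (\<lambda>t. - (c * exp (- t\<^sup>2 / 2))) t :> t * (c * exp (- t\<^sup>2 / 2))" for c :: real
      by (auto intro!: derivative_eq_intros)
    then show "DERIV (\<lambda>t. - std_normal_density t) t :> t * std_normal_density t"
      unfolding std_normal_density_def .
  qed measurable
  then show ?thesis by simp
qed

text \<open>
  For \<open>s > 0\<close> the integral runs over \<open>t > s\<close> and equals the density at \<open>s\<close>, because \<open>t\<close> times the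
  density is minus its derivative. The case \<open>s < 0\<close> is the reflection.
\<close>

lemma between0_gauss_moment:
  "(\<integral>\<^sup>+t. ennreal (std_normal_density t * (\<bar>t\<bar> * between0 t s)) \<partial>lborel) \<le> ennreal (std_normal_density s)"
proof -
  consider "s > 0" | "s < 0" | "s = 0" by linarith
  then show ?thesis
  proof cases
    case 1
    have "(\<integral>\<^sup>+t. ennreal (std_normal_density t * (\<bar>t\<bar> * between0 t s)) \<partial>lborel) \<le> (\<integral>\<^sup>+t. ennreal (t * std_normal_density t) * indicator {s..} t \<partial>lborel)"
      using 1 by (intro nn_integral_mono) (auto simp: between0_def indicator_def mult.commute)
    then show ?thesis by (simp add: nn_integral_normal_tail[OF 1])
  next
    case 2
    have "(\<integral>\<^sup>+t. ennreal (std_normal_density t * (\<bar>t\<bar> * between0 t s)) \<partial>lborel)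
       = (\<integral>\<^sup>+t. ennreal (std_normal_density (-t) * (\<bar>-t\<bar> * between0 (-t) s)) \<partial>lborel)"
      by (subst nn_integral_real_affine[where c="-1" and t=0]) auto
    also have "\<dots> \<le> (\<integral>\<^sup>+t. ennreal (t * std_normal_density t) * indicator {-s..} t \<partial>lborel)"
      using 2 by (intro nn_integral_mono) (auto simp: between0_def indicator_def mult.commute std_normal_density_def)
    also have "\<dots> = ennreal (std_normal_density (-s))" using 2 by (intro nn_integral_normal_tail) simp
    finally show ?thesis by (simp add: std_normal_density_def)
  next
    case 3
    then have "between0 t s = 0" for t by (simp add: between0_def)
    then show ?thesis by simp
  qed
qed

text \<open>
  Taking the primitive is a contraction for the Gaussian measure: insert \<open>prim_square_le\<close> and exchange
  the integrals; the weight that remains at \<open>s\<close> is at most the density by \<open>between0_gauss_moment\<close>.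
\<close>

lemma nn_integral_prim_square_le:
  assumes u: "u \<in> L2_functions gauss"
  shows "(\<integral>\<^sup>+t. ennreal ((prim u t)\<^sup>2) \<partial>gauss) \<le> (\<integral>\<^sup>+t. ennreal ((u t)\<^sup>2) \<partial>gauss)"
proof -
  have [measurable]: "u \<in> borel_measurable borel" by (rule L2_gauss_measurable[OF u])
  have [measurable]: "(\<lambda>(t, s). ennreal (std_normal_density t * (\<bar>t\<bar> * between0 t s)) * ennreal ((u s)\<^sup>2)) \<in> borel_measurable (lborel \<Otimes>\<^sub>M lborel)"
    unfolding between0_def by measurable
  have "(\<integral>\<^sup>+t. ennreal ((prim u t)\<^sup>2) \<partial>gauss) = (\<integral>\<^sup>+t. ennreal (std_normal_density t) * ennreal ((prim u t)\<^sup>2) \<partial>lborel)"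
    by (rule nn_integral_gauss) measurable
  also have "\<dots> \<le> (\<integral>\<^sup>+t. \<integral>\<^sup>+s. ennreal (std_normal_density t * (\<bar>t\<bar> * between0 t s)) * ennreal ((u s)\<^sup>2) \<partial>lborel \<partial>lborel)"
  proof (rule nn_integral_mono)
    fix t :: real
    note i = L2_gauss_local(1)[OF u order_refl, of t]
    have "ennreal (std_normal_density t) * ennreal ((prim u t)\<^sup>2) = ennreal (std_normal_density t * (prim u t)\<^sup>2)"
      by (simp add: ennreal_mult)
    also have "\<dots> \<le> ennreal (std_normal_density t * (\<bar>t\<bar> * (\<integral>s. between0 t s * (u s)\<^sup>2 \<partial>lborel)))"
      by (intro ennreal_leI mult_left_mono prim_square_le u) auto
    also have "\<dots> = ennreal (\<integral>s. std_normal_density t * (\<bar>t\<bar> * (between0 t s * (u s)\<^sup>2)) \<partial>lborel)"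
      by simp
    also have "\<dots> = (\<integral>\<^sup>+s. ennreal (std_normal_density t * (\<bar>t\<bar> * (between0 t s * (u s)\<^sup>2))) \<partial>lborel)"
      using i by (intro nn_integral_eq_integral[symmetric]) (auto simp: between0_0_1)
    also have "\<dots> = (\<integral>\<^sup>+s. ennreal (std_normal_density t * (\<bar>t\<bar> * between0 t s)) * ennreal ((u s)\<^sup>2) \<partial>lborel)"
      by (intro nn_integral_cong) (simp add: ennreal_mult'[symmetric] ac_simps)
    finally show "ennreal (std_normal_density t) * ennreal ((prim u t)\<^sup>2) \<le> (\<integral>\<^sup>+s. ennreal (std_normal_density t * (\<bar>t\<bar> * between0 t s)) * ennreal ((u s)\<^sup>2) \<partial>lborel)" .
  qed
  also have "\<dots> = (\<integral>\<^sup>+s. \<integral>\<^sup>+t. ennreal (std_normal_density t * (\<bar>t\<bar> * between0 t s)) * ennreal ((u s)\<^sup>2) \<partial>lborel \<partial>lborel)"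
    by (subst lborel_pair.Fubini') auto
  also have "\<dots> = (\<integral>\<^sup>+s. (\<integral>\<^sup>+t. ennreal (std_normal_density t * (\<bar>t\<bar> * between0 t s)) \<partial>lborel) * ennreal ((u s)\<^sup>2) \<partial>lborel)"
    unfolding between0_def by (intro nn_integral_cong nn_integral_multc) measurable
  also have "\<dots> \<le> (\<integral>\<^sup>+s. ennreal (std_normal_density s) * ennreal ((u s)\<^sup>2) \<partial>lborel)"
    by (intro nn_integral_mono mult_right_mono between0_gauss_moment) simp
  also have "\<dots> = (\<integral>\<^sup>+t. ennreal ((u t)\<^sup>2) \<partial>gauss)" by (rule nn_integral_gauss[symmetric]) measurable
  finally show ?thesis .
qed

lemma prim_L2:
  assumes u: "u \<in> L2_functions gauss"
  shows "prim u \<in> L2_functions gauss" "(\<integral>t. (prim u t)\<^sup>2 \<partial>gauss) \<le> (\<integral>t. (u t)\<^sup>2 \<partial>gauss)"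
proof -
  have [measurable]: "u \<in> borel_measurable borel" by (rule L2_gauss_measurable[OF u])
  have "(\<integral>\<^sup>+t. ennreal ((prim u t)\<^sup>2) \<partial>gauss) < \<infinity>"
    using nn_integral_prim_square_le[OF u] by (rule le_less_trans) (simp add: L2_gauss_nn_finite[OF u])
  then have "integrable gauss (\<lambda>t. (prim u t)\<^sup>2)" by (intro integrableI_nonneg) auto
  then show L: "prim u \<in> L2_functions gauss" by (simp add: L2_functions_def)
  show "(\<integral>t. (prim u t)\<^sup>2 \<partial>gauss) \<le> (\<integral>t. (u t)\<^sup>2 \<partial>gauss)"
    using nn_integral_prim_square_le[OF u] unfolding L2_gauss_nn_finite[OF u] L2_gauss_nn_finite[OF L]
    by (subst (asm) ennreal_le_iff) auto
qed

lemma prim_diff: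
  assumes "u \<in> L2_functions gauss" "v \<in> L2_functions gauss"
  shows "prim (\<lambda>s. u s - v s) t = prim u t - prim v t"
  using L2_gauss_local(2)[OF assms(1) order_refl, of t] L2_gauss_local(2)[OF assms(2) order_refl, of t]
  by (simp add: prim_def right_diff_distrib)

text \<open>
  The logarithmic Sobolev inequality for all functions with derivative \<open>h\<close>; as a property of the
  derivative it is closed under \<open>L\<^sup>2\<close> limits.
\<close>

definition gauss_lsi :: "(real \<Rightarrow> real) \<Rightarrow> bool" where
  "gauss_lsi h \<longleftrightarrow> (\<forall>C. (\<integral>\<^sup>+t. ennreal (rel_ent ((C + prim h t)\<^sup>2) (\<integral>t. (C + prim h t)\<^sup>2 \<partial>gauss)) \<partial>gauss)
     \<le> ennreal (2 * (\<integral>t. (h t)\<^sup>2 \<partial>gauss)))"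

lemma L2_gauss_const: "(\<lambda>t. C) \<in> L2_functions gauss"
proof -
  interpret N: prob_space gauss by (rule prob_space_std_normal)
  show ?thesis by (simp add: L2_functions_def)
qed

text \<open>
  If the derivatives converge in \<open>L\<^sup>2\<close>, the primitives converge in \<open>L\<^sup>2\<close> because taking the primitive is a
  contraction, and pointwise by \<open>prim_square_le\<close>.
\<close>

lemma gauss_lsi_limit:
  assumes h: "h \<in> L2_functions gauss" and g: "\<And>n. g n \<in> L2_functions gauss"
    and lim: "(\<lambda>n. \<integral>t. (g n t - h t)\<^sup>2 \<partial>gauss) \<longlonglongrightarrow> 0" and lsi: "\<And>n. gauss_lsi (g n)"
  shows "gauss_lsi h"
  unfolding gauss_lsi_def
proof
  fix C
  interpret N: prob_space gauss by (rule prob_space_std_normal)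
  have d: "(\<lambda>t. g n t - h t) \<in> L2_functions gauss" for n by (intro L2_functions_diff g h)
  have e: "C + prim (g n) t - (C + prim h t) = prim (\<lambda>t. g n t - h t) t" for n t
    by (simp add: prim_diff[OF g h])
  show "(\<integral>\<^sup>+t. ennreal (rel_ent ((C + prim h t)\<^sup>2) (\<integral>t. (C + prim h t)\<^sup>2 \<partial>gauss)) \<partial>gauss) \<le> ennreal (2 * (\<integral>t. (h t)\<^sup>2 \<partial>gauss))"
  proof (rule N.rel_ent_square_lower_semicontinuous)
    show "(\<lambda>t. C + prim h t) \<in> L2_functions gauss" "(\<lambda>t. C + prim (g n) t) \<in> L2_functions gauss" for n
      by (intro L2_functions_add L2_gauss_const prim_L2 h g)+
    show "(\<lambda>n. \<integral>t. (C + prim (g n) t - (C + prim h t))\<^sup>2 \<partial>gauss) \<longlonglongrightarrow> 0"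
      unfolding e
      by (rule tendsto_sandwich[OF _ _ tendsto_const lim]) (auto intro!: always_eventually prim_L2 d)
    show "AE t in gauss. (\<lambda>n. C + prim (g n) t) \<longlonglongrightarrow> C + prim h t"
    proof (rule AE_I2)
      fix t
      have "(\<lambda>n. (prim (\<lambda>t. g n t - h t) t)\<^sup>2) \<longlonglongrightarrow> 0"
      proof (rule tendsto_sandwich[OF _ _ tendsto_const])
        show "(\<lambda>n. \<bar>t\<bar> * (1 / std_normal_density \<bar>t\<bar> * (\<integral>t. (g n t - h t)\<^sup>2 \<partial>gauss))) \<longlonglongrightarrow> 0"
          by (intro tendsto_mult_right_zero lim)
        have "(prim (\<lambda>t. g n t - h t) t)\<^sup>2 \<le> \<bar>t\<bar> * (1 / std_normal_density \<bar>t\<bar> * (\<integral>t. (g n t - h t)\<^sup>2 \<partial>gauss))" for n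
          using prim_square_le[OF d] by (rule order_trans) (intro mult_left_mono L2_gauss_local(5) d order_refl, simp)
        then show "eventually (\<lambda>n. (prim (\<lambda>t. g n t - h t) t)\<^sup>2 \<le> \<bar>t\<bar> * (1 / std_normal_density \<bar>t\<bar> * (\<integral>t. (g n t - h t)\<^sup>2 \<partial>gauss))) sequentially"
          by (rule always_eventually[OF allI])
      qed simp
      then have "(\<lambda>n. sqrt ((prim (\<lambda>t. g n t - h t) t)\<^sup>2)) \<longlonglongrightarrow> sqrt 0" by (rule tendsto_real_sqrt)
      then have "(\<lambda>n. C + prim (g n) t - (C + prim h t)) \<longlonglongrightarrow> 0"
        unfolding e by (simp add: tendsto_rabs_zero_iff)
      then show "(\<lambda>n. C + prim (g n) t) \<longlonglongrightarrow> C + prim h t" by (rule LIM_zero_cancel)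
    qed
    show "(\<integral>\<^sup>+t. ennreal (rel_ent ((C + prim (g n) t)\<^sup>2) (\<integral>t. (C + prim (g n) t)\<^sup>2 \<partial>gauss)) \<partial>gauss) \<le> ennreal (2 * (\<integral>t. (g n t)\<^sup>2 \<partial>gauss))" for n
      using lsi[of n] by (simp add: gauss_lsi_def)
    show "(\<lambda>n. 2 * (\<integral>t. (g n t)\<^sup>2 \<partial>gauss)) \<longlonglongrightarrow> 2 * (\<integral>t. (h t)\<^sup>2 \<partial>gauss)"
      by (intro tendsto_mult_left tendsto_integral_square[OF h g lim])
  qed
qed

lemma compact_support_bounded_uniformly_continuous:
  fixes h :: "real \<Rightarrow> real"
  assumes c: "continuous_on UNIV h" and supp: "\<And>t. \<bar>t\<bar> > R \<Longrightarrow> h t = 0"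
  obtains B where "\<And>t. \<bar>h t\<bar> \<le> B" "uniformly_continuous_on UNIV h"
proof -
  have cK: "continuous_on {-R-1..R+1} h" using c by (rule continuous_on_subset) simp
  have "bounded (h ` {-R-1..R+1})" by (intro compact_imp_bounded compact_continuous_image cK) simp
  then obtain B where "\<forall>y\<in>h ` {-R-1..R+1}. norm y \<le> B" unfolding bounded_iff by blast
  then have B: "\<bar>h t\<bar> \<le> \<bar>B\<bar>" for t
  proof (cases "t \<in> {-R-1..R+1}")
    case True
    then have "\<bar>h t\<bar> \<le> B" using \<open>\<forall>y\<in>h ` {-R-1..R+1}. norm y \<le> B\<close> by auto
    then show ?thesis by simp
  next
    case False
    then have "\<bar>t\<bar> > R" by auto
    then show ?thesis using supp by simp
  qed
  have uK: "uniformly_continuous_on {-R-1..R+1} h" by (intro compact_uniformly_continuous cK) simp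
  have "uniformly_continuous_on UNIV h"
    unfolding uniformly_continuous_on_def
  proof (intro allI impI)
    fix e :: real assume e: "e > 0"
    then obtain d where d: "d > 0" "\<And>s t. s \<in> {-R-1..R+1} \<Longrightarrow> t \<in> {-R-1..R+1} \<Longrightarrow> dist s t < d \<Longrightarrow> dist (h s) (h t) < e"
      using uK unfolding uniformly_continuous_on_def by blast
    have "dist (h s) (h t) < e" if st: "dist s t < min d 1" for s t
    proof (cases "s \<in> {-R-1..R+1} \<and> t \<in> {-R-1..R+1}")
      case True
      then show ?thesis using d st by auto
    next
      case False
      then have "\<bar>s\<bar> > R" "\<bar>t\<bar> > R" using st by (auto simp: dist_real_def)
      then show ?thesis using supp e by simp
    qed
    then show "\<exists>d>0. \<forall>s\<in>UNIV. \<forall>t\<in>UNIV. dist t s < d \<longrightarrow> dist (h t) (h s) < e"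
      using d(1) by (intro exI[of _ "min d 1"]) auto
  qed
  with B show ?thesis by (rule that)
qed

lemma prim_has_real_derivative:
  assumes c: "continuous_on UNIV h"
  shows "(prim h has_real_derivative h t) (at t)"
proof -
  define a where "a = min 0 t - 1"
  define b where "b = max 0 t + 1"
  have "((\<lambda>u. LBINT y=ereal 0..ereal u. h y) has_vector_derivative h t) (at t within {a..b})"
    by (rule interval_integral_FTC2) (auto simp: a_def b_def intro: continuous_on_subset[OF c])
  then have "(prim h has_vector_derivative h t) (at t within {a..b})"
    unfolding prim_eq_LBINT[abs_def] .
  moreover have "at t within {a..b} = at t"
    by (rule at_within_interior) (auto simp: a_def b_def)
  ultimately show ?thesis by (simp add: has_real_derivative_iff_has_vector_derivative)
qed

text \<open>
  With a derivative that is continuous with compact support, the primitive is bounded and the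
  smooth case applies.
\<close>

lemma gauss_lsi_compact_support:
  assumes c: "continuous_on UNIV h" and supp: "\<And>t. \<bar>t\<bar> > R \<Longrightarrow> h t = 0"
  shows "gauss_lsi h"
  unfolding gauss_lsi_def
proof
  fix C
  obtain B where B: "\<And>t. \<bar>h t\<bar> \<le> B" and u: "uniformly_continuous_on UNIV h"
    using compact_support_bounded_uniformly_continuous[OF c supp] by blast
  have [measurable]: "h \<in> borel_measurable borel" using c by (rule borel_measurable_continuous_onI)
  have "integrable lborel (\<lambda>s. indicator {-R..R} s *\<^sub>R h s)"
    by (rule borel_integrable_compact) (auto intro: continuous_on_subset[OF c])
  moreover have "(\<lambda>s. indicator {-R..R} s *\<^sub>R h s) = h"
  proof
    fix s show "indicator {-R..R} s *\<^sub>R h s = h s"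
      using supp[of s] by (cases "s \<in> {-R..R}") auto
  qed
  ultimately have hi: "integrable lborel h" by simp
  have P: "\<bar>C + prim h t\<bar> \<le> \<bar>C\<bar> + (\<integral>s. \<bar>h s\<bar> \<partial>lborel)" for t
  proof -
    have "\<bar>prim h t\<bar> \<le> \<bar>\<integral>s. between0 t s * h s \<partial>lborel\<bar>" by (simp add: prim_def abs_mult sgn_if)
    also have "\<dots> \<le> (\<integral>s. \<bar>between0 t s * h s\<bar> \<partial>lborel)" by (rule integral_abs_bound)
    also have "\<dots> \<le> (\<integral>s. \<bar>h s\<bar> \<partial>lborel)"
    proof (rule integral_mono)
      show "integrable lborel (\<lambda>s. \<bar>between0 t s * h s\<bar>)"
        by (rule Bochner_Integration.integrable_bound[OF hi]) (auto simp: between0_def)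
    qed (use hi in \<open>auto simp: between0_def\<close>)
    finally show ?thesis using abs_triangle_ineq[of C "prim h t"] by linarith
  qed
  show "(\<integral>\<^sup>+t. ennreal (rel_ent ((C + prim h t)\<^sup>2) (\<integral>t. (C + prim h t)\<^sup>2 \<partial>gauss)) \<partial>gauss) \<le> ennreal (2 * (\<integral>t. (h t)\<^sup>2 \<partial>gauss))"
  proof (rule gauss_log_sobolev_smooth[OF _ P B u])
    show "((\<lambda>t. C + prim h t) has_real_derivative h t) (at t)" for t
      using DERIV_add[OF DERIV_const prim_has_real_derivative[OF c]] by simp
  qed
qed

lemma L2_gauss_bounded:
  assumes "h \<in> borel_measurable borel" "\<And>t. \<bar>h t\<bar> \<le> B"
  shows "h \<in> L2_functions gauss"
proof -
  interpret N: prob_space gauss by (rule prob_space_std_normal)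
  have "\<bar>h t\<bar> \<le> \<bar>B\<bar>" for t using assms(2)[of t] by linarith
  then have "integrable gauss (\<lambda>t. (h t)\<^sup>2)"
    by (intro N.integrable_const_bound[where B="B\<^sup>2"])
      (use assms(1) in \<open>auto simp: abs_le_square_iff[symmetric]\<close>)
  then show ?thesis using assms(1) by (simp add: L2_functions_def)
qed

text \<open>
  A measurable function is almost everywhere a limit of continuous functions. Truncating these
  at height \<open>B\<close> and multiplying by a continuous cutoff makes the convergence dominated.
\<close>

lemma gauss_lsi_bounded:
  assumes [measurable]: "h \<in> borel_measurable borel" and B: "\<And>t. \<bar>h t\<bar> \<le> B" and supp: "\<And>t. \<bar>t\<bar> > R \<Longrightarrow> h t = 0"
  shows "gauss_lsi h"
proof -
  interpret N: prob_space gauss by (rule prob_space_std_normal)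
  have "h \<in> borel_measurable lebesgue" by (rule measurable_completion) simp
  then have "h measurable_on UNIV" by (rule lebesgue_measurable_imp_measurable_on) simp
  then obtain Z g where Z: "negligible Z" and g: "\<And>n. continuous_on UNIV (g n)" "\<And>x. x \<notin> Z \<Longrightarrow> (\<lambda>n. g n x) \<longlonglongrightarrow> h x"
    unfolding measurable_on_def by auto
  have [measurable]: "g n \<in> borel_measurable borel" for n using g(1) by (rule borel_measurable_continuous_onI)
  have "AE x in lebesgue. (\<lambda>n. g n x) \<longlonglongrightarrow> h x"
    using Z g(2) by (intro AE_I'[of Z]) (auto simp: negligible_iff_null_sets)
  then have "AE x in lborel. (\<lambda>n. g n x) \<longlonglongrightarrow> h x" by (simp only: AE_completion_iff)
  then have AE: "AE x in gauss. (\<lambda>n. g n x) \<longlonglongrightarrow> h x"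
    by (subst AE_density) (auto elim: eventually_mono)
  have B0: "B \<ge> 0" using B[of 0] by linarith
  define cutoff where "cutoff t = max 0 (min 1 (\<bar>R\<bar> + 1 - \<bar>t\<bar>))" for t :: real
  have cutoff: "0 \<le> cutoff t" "cutoff t \<le> 1" for t by (auto simp: cutoff_def)
  define k where "k n t = cutoff t * max (-B) (min B (g n t))" for n t
  have kB: "\<bar>k n t\<bar> \<le> B" for n t
  proof -
    have "\<bar>k n t\<bar> = cutoff t * \<bar>max (-B) (min B (g n t))\<bar>" using cutoff by (simp add: k_def abs_mult)
    also have "\<dots> \<le> 1 * B" using cutoff B0 by (intro mult_mono) auto
    finally show ?thesis by simp
  qed
  have ck: "continuous_on UNIV (k n)" for n
    unfolding k_def[abs_def] cutoff_def by (intro continuous_intros g)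
  have [measurable]: "k n \<in> borel_measurable borel" for n using ck by (rule borel_measurable_continuous_onI)
  have klim: "(\<lambda>n. k n t) \<longlonglongrightarrow> h t" if "(\<lambda>n. g n t) \<longlonglongrightarrow> h t" for t
  proof -
    have "(\<lambda>n. k n t) \<longlonglongrightarrow> cutoff t * max (-B) (min B (h t))"
      unfolding k_def by (intro tendsto_intros that)
    moreover have "max (-B) (min B (h t)) = h t" using B[of t] by (auto simp: abs_le_iff)
    moreover have "cutoff t * h t = h t" using supp[of t] by (auto simp: cutoff_def max_def min_def)
    ultimately show ?thesis by simp
  qed
  have "(\<lambda>n. \<integral>t. (k n t - h t)\<^sup>2 \<partial>gauss) \<longlonglongrightarrow> (\<integral>t. 0 \<partial>gauss)"
  proof (rule integral_dominated_convergence[where w="\<lambda>_. (2 * B)\<^sup>2"])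
    show "AE t in gauss. (\<lambda>n. (k n t - h t)\<^sup>2) \<longlonglongrightarrow> 0"
      using AE
    proof eventually_elim
      case (elim t)
      have "(\<lambda>n. (k n t - h t)\<^sup>2) \<longlonglongrightarrow> (h t - h t)\<^sup>2" by (intro tendsto_intros klim elim)
      then show ?case by simp
    qed
    show "AE t in gauss. norm ((k n t - h t)\<^sup>2) \<le> (2 * B)\<^sup>2" for n
    proof (rule AE_I2)
      fix t
      have "\<bar>k n t - h t\<bar> \<le> \<bar>2 * B\<bar>" using kB[of n t] B[of t] by linarith
      then show "norm ((k n t - h t)\<^sup>2) \<le> (2 * B)\<^sup>2" by (simp only: abs_le_square_iff real_norm_def abs_power2)
    qed
  qed auto
  then have lim: "(\<lambda>n. \<integral>t. (k n t - h t)\<^sup>2 \<partial>gauss) \<longlonglongrightarrow> 0" by simp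
  show ?thesis
  proof (rule gauss_lsi_limit[OF _ _ lim])
    show "h \<in> L2_functions gauss" by (rule L2_gauss_bounded[OF _ B]) simp
    show "k n \<in> L2_functions gauss" for n by (rule L2_gauss_bounded[OF _ kB]) simp
    show "gauss_lsi (k n)" for n
    proof (rule gauss_lsi_compact_support[OF ck])
      fix t assume "\<bar>t\<bar> > \<bar>R\<bar> + 1"
      then show "k n t = 0" by (simp add: k_def cutoff_def)
    qed
  qed
qed

lemma gauss_lsi_L2:
  assumes h: "h \<in> L2_functions gauss"
  shows "gauss_lsi h"
proof -
  have [measurable]: "h \<in> borel_measurable borel" by (rule L2_gauss_measurable[OF h])
  define k where "k n t = (if \<bar>t\<bar> \<le> real n \<and> \<bar>h t\<bar> \<le> real n then h t else 0)" for n t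
  have [measurable]: "k n \<in> borel_measurable borel" for n unfolding k_def[abs_def] by measurable
  have kB: "\<bar>k n t\<bar> \<le> real n" for n t by (simp add: k_def)
  have "(\<lambda>n. \<integral>t. (k n t - h t)\<^sup>2 \<partial>gauss) \<longlonglongrightarrow> (\<integral>t. 0 \<partial>gauss)"
  proof (rule integral_dominated_convergence)
    show "integrable gauss (\<lambda>t. (h t)\<^sup>2)" using h by (rule L2_functionsD)
    show "AE t in gauss. norm ((k n t - h t)\<^sup>2) \<le> (h t)\<^sup>2" for n by (simp add: k_def)
    show "AE t in gauss. (\<lambda>n. (k n t - h t)\<^sup>2) \<longlonglongrightarrow> 0"
    proof (rule AE_I2)
      fix t
      obtain N :: nat where N: "real N \<ge> max \<bar>t\<bar> \<bar>h t\<bar>" using real_arch_simple by blast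
      have "eventually (\<lambda>n. (k n t - h t)\<^sup>2 = 0) sequentially"
        using eventually_ge_at_top[of N] by eventually_elim (use N in \<open>auto simp: k_def\<close>)
      then show "(\<lambda>n. (k n t - h t)\<^sup>2) \<longlonglongrightarrow> 0" by (rule tendsto_eventually)
    qed
  qed auto
  then have lim: "(\<lambda>n. \<integral>t. (k n t - h t)\<^sup>2 \<partial>gauss) \<longlonglongrightarrow> 0" by simp
  show ?thesis
  proof (rule gauss_lsi_limit[OF h _ lim])
    show "k n \<in> L2_functions gauss" for n by (rule L2_gauss_bounded[OF _ kB]) simp
    show "gauss_lsi (k n)" for n
      by (rule gauss_lsi_bounded[where B="real n" and R="real n"]) (auto simp: k_def)
  qed
qed

section \<open>Smooth functions with compact support\<close>

definition smooth :: "(real \<Rightarrow> real) \<Rightarrow> bool" where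
  "smooth g \<longleftrightarrow> (\<forall>n t. (deriv ^^ n) g differentiable (at t))"

text \<open>
  Smoothness is proved by exhibiting a class of functions that is closed under differentiation,
  instead of computing higher derivatives.
\<close>

lemma smooth_coinduct:
  assumes "g \<in> F" and F: "\<And>g t. g \<in> F \<Longrightarrow> g differentiable (at t)" "\<And>g. g \<in> F \<Longrightarrow> deriv g \<in> F"
  shows "smooth g"
proof -
  have "(deriv ^^ n) g \<in> F" for n using assms by (induction n) auto
  then show ?thesis using F by (simp add: smooth_def)
qed

lemma smooth_coinduct_derivative:
  assumes "g \<in> F" and F: "\<And>g. g \<in> F \<Longrightarrow> \<exists>g'\<in>F. \<forall>t. (g has_real_derivative g' t) (at t)"
  shows "smooth g"
proof (rule smooth_coinduct[OF assms(1)])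
  fix g assume "g \<in> F"
  then obtain g' where g': "g' \<in> F" "\<And>t. (g has_real_derivative g' t) (at t)" using F by blast
  then have "deriv g = g'" by (auto simp: fun_eq_iff DERIV_imp_deriv)
  then show "deriv g \<in> F" using g' by simp
  show "g differentiable (at t)" for t using g'(2)[of t] by (auto simp: real_differentiable_def)
qed

lemma smooth_deriv:
  assumes "smooth g"
  shows "smooth (deriv g)" "(g has_real_derivative deriv g t) (at t)"
proof -
  have "(deriv ^^ n) (deriv g) = (deriv ^^ Suc n) g" for n by (simp add: funpow_swap1)
  then show "smooth (deriv g)" using assms by (simp add: smooth_def del: funpow.simps)
  show "(g has_real_derivative deriv g t) (at t)"
    using assms[unfolded smooth_def, rule_format, of 0 t] by (simp add: DERIV_deriv_iff_real_differentiable)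
qed

lemma smooth_primitive:
  assumes "\<And>t. (g has_real_derivative g' t) (at t)" "smooth g'"
  shows "smooth g"
proof (rule smooth_coinduct_derivative[of g "insert g (Collect smooth)"])
  fix k assume "k \<in> insert g (Collect smooth)"
  then consider "k = g" | "smooth k" by blast
  then show "\<exists>k'\<in>insert g (Collect smooth). \<forall>t. (k has_real_derivative k' t) (at t)"
  proof cases
    case 1
    then show ?thesis using assms by (intro bexI[of _ g']) auto
  next
    case 2
    then show ?thesis by (intro bexI[of _ "deriv k"]) (auto intro: smooth_deriv)
  qed
qed simp

lemma smooth_affine:
  assumes "smooth g" shows "smooth (\<lambda>t. g (c * t + d))"
proof (rule smooth_coinduct_derivative[of _ "{\<lambda>t. k * u (c * t + d) | k u. smooth u}"])
  show "(\<lambda>t. g (c * t + d)) \<in> {\<lambda>t. k * u (c * t + d) | k u. smooth u}"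
    using assms by (auto intro!: exI[of _ 1] exI[of _ g])
  fix v assume "v \<in> {\<lambda>t. k * u (c * t + d) | k u. smooth u}"
  then obtain k u where v: "v = (\<lambda>t. k * u (c * t + d))" "smooth u" by blast
  have "(v has_real_derivative (k * c) * deriv u (c * t + d)) (at t)" for t
    unfolding v(1)
    by (rule DERIV_cong[OF DERIV_cmult[OF DERIV_chain2[OF smooth_deriv(2)[OF v(2)]]]])
      (auto intro!: derivative_eq_intros)
  moreover have "(\<lambda>t. (k * c) * deriv u (c * t + d)) \<in> {\<lambda>t. k * u (c * t + d) | k u. smooth u}"
    using smooth_deriv(1)[OF v(2)] by blast
  ultimately show "\<exists>v'\<in>{\<lambda>t. k * u (c * t + d) | k u. smooth u}. \<forall>t. (v has_real_derivative v' t) (at t)"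
    by (intro bexI[where x="\<lambda>t. (k * c) * deriv u (c * t + d)"]) auto
qed

lemma smooth_lincomb:
  assumes "smooth g" "smooth h" shows "smooth (\<lambda>t. a * g t + b * h t)"
proof (rule smooth_coinduct_derivative[of _ "{\<lambda>t. a * u t + b * v t | u v. smooth u \<and> smooth v}"])
  fix w assume "w \<in> {\<lambda>t. a * u t + b * v t | u v. smooth u \<and> smooth v}"
  then obtain u v where w: "w = (\<lambda>t. a * u t + b * v t)" "smooth u" "smooth v" by blast
  have "(w has_real_derivative a * deriv u t + b * deriv v t) (at t)" for t
    unfolding w(1) by (intro DERIV_add DERIV_cmult smooth_deriv w)
  then show "\<exists>w'\<in>{\<lambda>t. a * u t + b * v t | u v. smooth u \<and> smooth v}. \<forall>t. (w has_real_derivative w' t) (at t)"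
  proof (intro bexI allI)
    show "(\<lambda>t. a * deriv u t + b * deriv v t) \<in> {\<lambda>t. a * u t + b * v t | u v. smooth u \<and> smooth v}"
      using smooth_deriv(1)[OF w(2)] smooth_deriv(1)[OF w(3)] by blast
  qed
qed (use assms in blast)

text \<open>
  The closure of the products of smooth functions under sums; by the product rule it is closed
  under differentiation.
\<close>

inductive_set product_span :: "(real \<Rightarrow> real) set" where
  mult: "smooth u \<Longrightarrow> smooth v \<Longrightarrow> (\<lambda>t. u t * v t) \<in> product_span"
| add: "u \<in> product_span \<Longrightarrow> v \<in> product_span \<Longrightarrow> (\<lambda>t. u t + v t) \<in> product_span"

lemma smooth_mult:
  assumes "smooth g" "smooth h" shows "smooth (\<lambda>t. g t * h t)"
proof (rule smooth_coinduct_derivative[of _ product_span])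
  fix w assume "w \<in> product_span"
  then show "\<exists>w'\<in>product_span. \<forall>t. (w has_real_derivative w' t) (at t)"
  proof induction
    case (mult u v)
    have "((\<lambda>t. u t * v t) has_real_derivative deriv u t * v t + deriv v t * u t) (at t)" for t
      using mult by (intro DERIV_mult smooth_deriv)
    moreover have "(\<lambda>t. deriv u t * v t + deriv v t * u t) \<in> product_span"
      using mult by (intro product_span.add product_span.mult smooth_deriv)
    ultimately show ?case by (intro bexI[where x="\<lambda>t. deriv u t * v t + deriv v t * u t"]) auto
  next
    case (add u v)
    then obtain u' v' where "u' \<in> product_span" "v' \<in> product_span"
      "\<And>t. (u has_real_derivative u' t) (at t)" "\<And>t. (v has_real_derivative v' t) (at t)" by blast
    then show ?case
      by (intro bexI[where x="\<lambda>t. u' t + v' t"]) (auto intro!: DERIV_add product_span.add)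
  qed
qed (use assms in \<open>auto intro: product_span.mult\<close>)

text \<open>
  The standard function that is smooth on the line and vanishes on the negative half-line.
\<close>

definition exp_inv :: "real \<Rightarrow> real" where
  "exp_inv t = (if t > 0 then exp (- 1 / t) else 0)"

lemma poly_div_exp_tendsto_0:
  "((\<lambda>x. x ^ k * poly p x / exp x) \<longlongrightarrow> (0::real)) at_top"
proof (induction p arbitrary: k)
  case (pCons a p)
  have "((\<lambda>x. a * (x ^ k / exp x) + x ^ Suc k * poly p x / exp x) \<longlongrightarrow> a * 0 + 0) at_top"
    by (intro tendsto_intros tendsto_power_div_exp_0 pCons.IH)
  then show ?case by (simp add: algebra_simps add_divide_distrib)
qed simp

text \<open>
  Derivatives have the form \<open>q(1/t) exp(-1/t)\<close> on the positive half-line with a polynomial \<open>q\<close>, and these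
  functions are differentiable at \<open>0\<close> since the exponential dominates every polynomial.
\<close>

lemma smooth_exp_inv: "smooth exp_inv"
proof -
  define F where "F = (\<lambda>q t. if t > 0 then poly q (1 / t) * exp (- 1 / t) else 0 :: real)"
  have e: "exp_inv = F 1" by (auto simp: exp_inv_def F_def fun_eq_iff)
  have "smooth (F q)" for q
  proof (rule smooth_coinduct_derivative[of _ "range F"])
    fix g assume "g \<in> range F"
    then obtain q where g: "g = F q" by blast
    define r where "r = [:0, 0, 1:] * (q - pderiv q)"
    have r: "poly r x = x\<^sup>2 * (poly q x - poly (pderiv q) x)" for x by (simp add: r_def power2_eq_square)
    have "(F q has_real_derivative F r t) (at t)" for t
    proof -
      consider "t > 0" | "t < 0" | "t = 0" by linarith
      then show ?thesis
      proof cases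
        case 1
        have "((\<lambda>t. poly q (1 / t) * exp (- 1 / t)) has_real_derivative F r t) (at t)"
        proof (rule DERIV_cong[OF DERIV_mult[OF DERIV_chain2[OF poly_DERIV] DERIV_chain2[OF DERIV_exp]]])
          show "((\<lambda>t. 1 / t) has_real_derivative - 1 / t\<^sup>2) (at t)" "((\<lambda>t. - 1 / t) has_real_derivative 1 / t\<^sup>2) (at t)"
            using 1 by (auto intro!: derivative_eq_intros simp: power2_eq_square)
          show "poly (pderiv q) (1 / t) * (- 1 / t\<^sup>2) * exp (- 1 / t) + exp (- 1 / t) * (1 / t\<^sup>2) * poly q (1 / t) = F r t"
            using 1 by (simp add: F_def r power_divide) (simp add: field_simps)
        qed
        then show ?thesis
          by (rule has_field_derivative_transform_within_open[where S="{0<..}"]) (use 1 in \<open>auto simp: F_def\<close>)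
      next
        case 2
        have "((\<lambda>_. 0) has_real_derivative F r t) (at t)" using 2 by (simp add: F_def)
        then show ?thesis
          by (rule has_field_derivative_transform_within_open[where S="{..<0}"]) (use 2 in \<open>auto simp: F_def\<close>)
      next
        case 3
        have "((\<lambda>h. F q h / h) \<longlongrightarrow> 0) (at_left 0)"
          by (rule tendsto_eventually) (simp add: eventually_at_filter F_def)
        moreover have "((\<lambda>h. F q h / h) \<longlongrightarrow> 0) (at_right 0)"
        proof (rule Lim_transform_eventually)
          show "((\<lambda>h. inverse h ^ 1 * poly q (inverse h) / exp (inverse h)) \<longlongrightarrow> 0) (at_right 0)"
            by (rule filterlim_compose[OF poly_div_exp_tendsto_0 filterlim_inverse_at_top_right])
          show "eventually (\<lambda>h. inverse h ^ 1 * poly q (inverse h) / exp (inverse h) = F q h / h) (at_right 0)"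
            using eventually_at_right_less[of "0::real"]
            by eventually_elim (simp add: F_def exp_minus field_simps)
        qed
        ultimately have "((\<lambda>h. F q h / h) \<longlongrightarrow> 0) (at 0)" by (rule filterlim_split_at)
        moreover have "F q 0 = 0" "F r 0 = 0" by (simp_all add: F_def)
        ultimately show ?thesis using 3 by (simp add: DERIV_def)
      qed
    qed
    then show "\<exists>g'\<in>range F. \<forall>t. (g has_real_derivative g' t) (at t)" unfolding g by blast
  qed simp
  then show ?thesis unfolding e .
qed

lemma exp_inv_0_1: "0 \<le> exp_inv t" "exp_inv t \<le> 1"
  by (auto simp: exp_inv_def)

text \<open>
  Smooth, supported in \<open>[a, b]\<close>, and increasing to the indicator of \<open>(a, b)\<close> as \<open>n\<close> grows.
\<close>

definition bump :: "real \<Rightarrow> real \<Rightarrow> nat \<Rightarrow> real \<Rightarrow> real" where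
  "bump a b n t = exp_inv (real (Suc n) * (t - a)) * exp_inv (real (Suc n) * (b - t))"

lemma smooth_bump: "smooth (bump a b n)"
proof -
  have "smooth (\<lambda>t. exp_inv (c * t + d))" for c d by (rule smooth_affine[OF smooth_exp_inv])
  then have "smooth (\<lambda>t. exp_inv (real (Suc n) * t + (- real (Suc n) * a)) * exp_inv (- real (Suc n) * t + real (Suc n) * b))"
    by (intro smooth_mult)
  moreover have "(\<lambda>t. exp_inv (real (Suc n) * t + (- real (Suc n) * a)) * exp_inv (- real (Suc n) * t + real (Suc n) * b)) = bump a b n"
    by (simp add: bump_def fun_eq_iff algebra_simps)
  ultimately show ?thesis by (simp only:)
qed

lemma smooth_imp_continuous: "smooth g \<Longrightarrow> continuous_on A g"
  by (intro continuous_at_imp_continuous_on ballI DERIV_isCont[OF smooth_deriv(2)])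

lemma bump_measurable [measurable]: "bump a b n \<in> borel_measurable borel"
  by (intro borel_measurable_continuous_onI smooth_imp_continuous smooth_bump)

lemma bump_0_1: "0 \<le> bump a b n t" "bump a b n t \<le> 1"
  by (simp_all add: bump_def exp_inv_0_1 mult_le_one)

lemma bump_support: "\<not> (a < t \<and> t < b) \<Longrightarrow> bump a b n t = 0"
  by (auto simp: bump_def exp_inv_def zero_less_mult_iff)

lemma bump_pos: "a < t \<Longrightarrow> t < b \<Longrightarrow> bump a b n t > 0"
  by (simp add: bump_def exp_inv_def)

lemma bump_tendsto: "(\<lambda>n. bump a b n t) \<longlonglongrightarrow> indicator {a<..<b} t"
proof (cases "a < t \<and> t < b")
  case True
  have *: "(\<lambda>n. exp_inv (real (Suc n) * c)) \<longlonglongrightarrow> 1" if "c > 0" for c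
  proof -
    have "(\<lambda>n. exp (- 1 / (real (Suc n) * c))) \<longlonglongrightarrow> 1" using that by real_asymp
    then show ?thesis using that by (simp add: exp_inv_def)
  qed
  have "(\<lambda>n. bump a b n t) \<longlonglongrightarrow> 1 * 1"
    unfolding bump_def using True by (intro tendsto_mult *) auto
  then show ?thesis using True by simp
next
  case False
  then have "bump a b n t = 0" for n by (rule bump_support)
  moreover have "t \<notin> {a<..<b}" using False by simp
  ultimately show ?thesis by simp
qed

lemma compact_support_integrable:
  fixes \<psi> :: "real \<Rightarrow> real"
  assumes c: "continuous_on UNIV \<psi>" and supp: "\<And>t. \<bar>t\<bar> > R \<Longrightarrow> \<psi> t = 0"
  shows "integrable lborel \<psi>"
proof -
  have "integrable lborel (\<lambda>s. indicator {-R..R} s *\<^sub>R \<psi> s)"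
    by (rule borel_integrable_compact) (auto intro: continuous_on_subset[OF c])
  moreover have "(\<lambda>s. indicator {-R..R} s *\<^sub>R \<psi> s) = \<psi>"
  proof
    fix s show "indicator {-R..R} s *\<^sub>R \<psi> s = \<psi> s"
      using supp[of s] by (cases "s \<in> {-R..R}") auto
  qed
  ultimately show ?thesis by simp
qed

text \<open>
  The primitive that vanishes at \<open>-\<infinity>\<close>. Unlike \<open>prim\<close> it has compact support when \<open>\<psi>\<close> has compact support and
  integral zero.
\<close>

definition cumulative :: "(real \<Rightarrow> real) \<Rightarrow> real \<Rightarrow> real" where
  "cumulative \<psi> s = (\<integral>t. indicator {..s} t * \<psi> t \<partial>lborel)"

lemma cumulative_derivative:
  assumes c: "continuous_on UNIV \<psi>" and i: "integrable lborel \<psi>"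
  shows "(cumulative \<psi> has_real_derivative \<psi> s) (at s)"
proof -
  have ii: "integrable lborel (\<lambda>t. indicator {..s} t * \<psi> t)" for s :: real
    using integrable_mult_indicator[OF _ i, of "{..s}"] by simp
  have "cumulative \<psi> s - cumulative \<psi> 0 = prim \<psi> s" for s
  proof -
    have "cumulative \<psi> s - cumulative \<psi> 0 = (\<integral>t. indicator {..s} t * \<psi> t - indicator {..0} t * \<psi> t \<partial>lborel)"
      unfolding cumulative_def by (rule Bochner_Integration.integral_diff[symmetric, OF ii ii])
    also have "\<dots> = (\<integral>t. sgn s * (between0 s t * \<psi> t) \<partial>lborel)"
    proof (rule integral_cong_AE)
      show "AE t in lborel. indicator {..s} t * \<psi> t - indicator {..0} t * \<psi> t = sgn s * (between0 s t * \<psi> t)"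
        using AE_lborel_singleton[of 0] AE_lborel_singleton[of s]
        by eventually_elim (auto simp: between0_def indicator_def sgn_if)
      have [measurable]: "\<psi> \<in> borel_measurable borel" using c by (rule borel_measurable_continuous_onI)
      show "(\<lambda>t. indicator {..s} t * \<psi> t - indicator {..0} t * \<psi> t) \<in> borel_measurable lborel"
        "(\<lambda>t. sgn s * (between0 s t * \<psi> t)) \<in> borel_measurable lborel" by measurable
    qed
    also have "\<dots> = prim \<psi> s" by (simp add: prim_def)
    finally show ?thesis .
  qed
  note diff = this
  have e: "cumulative \<psi> = (\<lambda>s. cumulative \<psi> 0 + prim \<psi> s)"
  proof
    fix s show "cumulative \<psi> s = cumulative \<psi> 0 + prim \<psi> s" using diff[of s] by linarith
  qed
  show ?thesis by (subst e) (rule DERIV_cong[OF DERIV_add[OF DERIV_const prim_has_real_derivative[OF c]]], simp)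
qed

lemma cumulative_support:
  assumes supp: "\<And>t. \<bar>t\<bar> > R \<Longrightarrow> \<psi> t = 0" and 0: "integral\<^sup>L lborel \<psi> = 0" and s: "\<bar>s\<bar> > R"
  shows "cumulative \<psi> s = 0"
proof (cases "s > 0")
  case True
  have "indicator {..s} t * \<psi> t = \<psi> t" for t using supp[of t] s True by (auto simp: indicator_def)
  then have "cumulative \<psi> s = integral\<^sup>L lborel \<psi>"
    unfolding cumulative_def by (intro Bochner_Integration.integral_cong) auto
  then show ?thesis using 0 by simp
next
  case False
  have "indicator {..s} t * \<psi> t = 0" for t using supp[of t] s False by (auto simp: indicator_def)
  then have "cumulative \<psi> s = (\<integral>t. 0 \<partial>(lborel :: real measure))"
    unfolding cumulative_def by (intro Bochner_Integration.integral_cong) auto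
  then show ?thesis by simp
qed

lemma bump_integrable: "integrable lborel (bump a b n)"
  by (rule compact_support_integrable[where R="\<bar>a\<bar> + \<bar>b\<bar>"])
    (auto intro!: smooth_imp_continuous smooth_bump bump_support)

lemma bump_integral_pos: "a < b \<Longrightarrow> integral\<^sup>L lborel (bump a b n) > 0"
proof -
  assume ab: "a < b"
  have "integral\<^sup>L lborel (bump a b n) \<noteq> 0"
  proof
    assume "integral\<^sup>L lborel (bump a b n) = 0"
    then have "AE t in lborel. bump a b n t = 0"
      using integral_nonneg_eq_0_iff_AE[OF bump_integrable] bump_0_1 by auto
    then have "AE t in lborel. t \<notin> {a<..<b}" by eventually_elim (auto dest: bump_pos[of a _ b n])
    then have "emeasure lborel {a<..<b} = 0" by (subst (asm) AE_iff_measurable[of "{a<..<b}"]) auto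
    then show False using ab by simp
  qed
  moreover have "integral\<^sup>L lborel (bump a b n) \<ge> 0" using bump_0_1 by (intro integral_nonneg_AE) auto
  ultimately show ?thesis by simp
qed

text \<open>
  Subtracting a multiple of a fixed bump makes the integral zero, which is what the derivative of
  a test function must satisfy.
\<close>

definition balanced_bump :: "real \<Rightarrow> real \<Rightarrow> nat \<Rightarrow> real \<Rightarrow> real" where
  "balanced_bump a b n t = bump a b n t - integral\<^sup>L lborel (bump a b n) / integral\<^sup>L lborel (bump 0 1 0) * bump 0 1 0 t"

lemma balanced_bump:
  shows "smooth (balanced_bump a b n)" "integral\<^sup>L lborel (balanced_bump a b n) = 0"
    "\<bar>t\<bar> > \<bar>a\<bar> + \<bar>b\<bar> + 1 \<Longrightarrow> balanced_bump a b n t = 0"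
proof -
  define c where "c = integral\<^sup>L lborel (bump a b n) / integral\<^sup>L lborel (bump 0 1 0)"
  have b: "balanced_bump a b n = (\<lambda>t. 1 * bump a b n t + (- c) * bump 0 1 0 t)"
    by (simp add: balanced_bump_def fun_eq_iff c_def)
  show "smooth (balanced_bump a b n)" unfolding b by (intro smooth_lincomb smooth_bump)
  have "integral\<^sup>L lborel (balanced_bump a b n) = integral\<^sup>L lborel (bump a b n) - c * integral\<^sup>L lborel (bump 0 1 0)"
    unfolding b using bump_integrable by simp
  then show "integral\<^sup>L lborel (balanced_bump a b n) = 0" using bump_integral_pos[of 0 1 0] by (simp add: c_def)
  show "\<bar>t\<bar> > \<bar>a\<bar> + \<bar>b\<bar> + 1 \<Longrightarrow> balanced_bump a b n t = 0"
    unfolding balanced_bump_def by (subst (1 2) bump_support) auto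
qed

definition bump_test :: "real \<Rightarrow> real \<Rightarrow> nat \<Rightarrow> real \<Rightarrow> real" where
  "bump_test a b n = cumulative (balanced_bump a b n)"

lemma bump_test:
  shows "test_function (bump_test a b n)" "deriv (bump_test a b n) = balanced_bump a b n"
    "\<bar>t\<bar> > \<bar>a\<bar> + \<bar>b\<bar> + 1 \<Longrightarrow> bump_test a b n t = 0"
proof -
  have c: "continuous_on UNIV (balanced_bump a b n)" by (intro smooth_imp_continuous balanced_bump)
  have i: "integrable lborel (balanced_bump a b n)"
    by (rule compact_support_integrable[OF c, where R="\<bar>a\<bar> + \<bar>b\<bar> + 1"]) (rule balanced_bump)
  have d: "(bump_test a b n has_real_derivative balanced_bump a b n t) (at t)" for t
    unfolding bump_test_def by (rule cumulative_derivative[OF c i])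
  then show "deriv (bump_test a b n) = balanced_bump a b n" by (auto simp: fun_eq_iff DERIV_imp_deriv)
  show supp: "\<bar>t\<bar> > \<bar>a\<bar> + \<bar>b\<bar> + 1 \<Longrightarrow> bump_test a b n t = 0" for t
    unfolding bump_test_def by (rule cumulative_support[where R="\<bar>a\<bar> + \<bar>b\<bar> + 1"]) (auto intro: balanced_bump)
  have "smooth (bump_test a b n)" by (rule smooth_primitive[OF d balanced_bump(1)])
  moreover have "bounded {t. bump_test a b n t \<noteq> 0}"
    unfolding bounded_iff using supp by (intro exI[of _ "\<bar>a\<bar> + \<bar>b\<bar> + 1"]) (force simp: not_less[symmetric])
  ultimately show "test_function (bump_test a b n)"
    by (simp add: test_function_def smooth_def compact_eq_bounded_closed bounded_closure)
qed

section \<open>Weak derivatives on the line\<close>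

lemma L2_gauss_compact_mult_integrable:
  fixes B u :: "real \<Rightarrow> real"
  assumes u: "u \<in> L2_functions gauss" and [measurable]: "B \<in> borel_measurable borel"
    and c: "\<And>t. \<bar>B t\<bar> \<le> c" and supp: "\<And>t. \<bar>t\<bar> > R \<Longrightarrow> B t = 0"
  shows "integrable lborel (\<lambda>t. B t * u t)"
proof -
  interpret N: prob_space gauss by (rule prob_space_std_normal)
  have [measurable]: "u \<in> borel_measurable borel" by (rule L2_gauss_measurable[OF u])
  have c0: "c \<ge> 0" using c[of 0] by linarith
  have ui: "integrable gauss u" by (rule N.L2_functions_integrable[OF u])
  have "(\<integral>\<^sup>+t. ennreal (norm (B t * u t)) \<partial>lborel) \<le> (\<integral>\<^sup>+t. ennreal (c * \<bar>u t\<bar>) * indicator {-R..R} t \<partial>lborel)"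
  proof (rule nn_integral_mono)
    fix t
    show "ennreal (norm (B t * u t)) \<le> ennreal (c * \<bar>u t\<bar>) * indicator {-R..R} t"
    proof (cases "t \<in> {-R..R}")
      case True
      then show ?thesis using c[of t] by (auto simp: abs_mult intro!: ennreal_leI mult_right_mono)
    next
      case False
      then have "\<bar>t\<bar> > R" by auto
      then show ?thesis using supp by simp
    qed
  qed
  also have "\<dots> \<le> ennreal (1 / std_normal_density R) * (\<integral>\<^sup>+t. ennreal (c * \<bar>u t\<bar>) \<partial>gauss)"
    by (rule nn_integral_interval_le_gauss) measurable
  also have "(\<integral>\<^sup>+t. ennreal (c * \<bar>u t\<bar>) \<partial>gauss) = ennreal (\<integral>t. c * \<bar>u t\<bar> \<partial>gauss)"
    using ui c0 by (intro nn_integral_eq_integral) auto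
  also have "ennreal (1 / std_normal_density R) * ennreal (\<integral>t. c * \<bar>u t\<bar> \<partial>gauss) < \<infinity>"
    by (simp add: ennreal_mult_less_top)
  finally show ?thesis by (intro integrableI_bounded) auto
qed

text \<open>
  Integration by parts against a function that is merely locally integrable: write
  \<open>prim h t\<close> as an integral over \<open>s\<close> and exchange the integrals. For fixed \<open>s \<noteq> 0\<close> the inner integral of \<open>\<psi>\<close> over
  the \<open>t\<close> beyond \<open>s\<close>, with sign, is \<open>- cumulative \<psi> s\<close> since \<open>\<psi>\<close> has integral zero.
\<close>

lemma integral_prim_by_parts:
  fixes \<psi> h :: "real \<Rightarrow> real"
  assumes h: "h \<in> L2_functions gauss" and c: "continuous_on UNIV \<psi>"
    and supp: "\<And>t. \<bar>t\<bar> > R \<Longrightarrow> \<psi> t = 0" and 0: "integral\<^sup>L lborel \<psi> = 0"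
  shows "(\<integral>t. \<psi> t * prim h t \<partial>lborel) = - (\<integral>s. cumulative \<psi> s * h s \<partial>lborel)"
proof -
  have [measurable]: "h \<in> borel_measurable borel" by (rule L2_gauss_measurable[OF h])
  have [measurable]: "\<psi> \<in> borel_measurable borel" using c by (rule borel_measurable_continuous_onI)
  have \<psi>i: "integrable lborel \<psi>" by (rule compact_support_integrable[OF c supp])
  define k where "k t s = \<psi> t * (sgn t * (between0 t s * h s))" for t s
  have [measurable]: "(\<lambda>(t, s). k t s) \<in> borel_measurable (lborel \<Otimes>\<^sub>M lborel)"
    unfolding k_def between0_def by measurable
  define D where "D = (\<integral>s. indicator {-R..R} s * \<bar>h s\<bar> \<partial>lborel)"
  have Di: "integrable lborel (\<lambda>s. indicator {-R..R} s * \<bar>h s\<bar>)"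
  proof -
    have "integrable lborel (\<lambda>s. indicator {-R..R} s * h s)"
      by (rule L2_gauss_compact_mult_integrable[OF h, where c=1 and R=R]) (auto simp: indicator_def)
    then have "integrable lborel (\<lambda>s. \<bar>indicator {-R..R} s * h s\<bar>)" by (rule integrable_abs)
    then show ?thesis by (simp add: abs_mult)
  qed
  have ks: "integrable lborel (\<lambda>s. k t s)" for t
    unfolding k_def using L2_gauss_local(2)[OF h order_refl, of t] by simp
  have kn: "(\<integral>s. norm (k t s) \<partial>lborel) \<le> \<bar>\<psi> t\<bar> * D" for t
  proof (cases "\<bar>t\<bar> > R")
    case True
    then show ?thesis using supp by (simp add: k_def)
  next
    case False
    have "(\<integral>s. norm (k t s) \<partial>lborel) \<le> (\<integral>s. \<bar>\<psi> t\<bar> * (indicator {-R..R} s * \<bar>h s\<bar>) \<partial>lborel)"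
    proof (rule integral_mono)
      show "integrable lborel (\<lambda>s. norm (k t s))" using ks by (rule integrable_norm)
      show "integrable lborel (\<lambda>s. \<bar>\<psi> t\<bar> * (indicator {-R..R} s * \<bar>h s\<bar>))" using Di by simp
      show "norm (k t s) \<le> \<bar>\<psi> t\<bar> * (indicator {-R..R} s * \<bar>h s\<bar>)" for s
        using False by (auto simp: k_def between0_def abs_mult indicator_def sgn_if)
    qed
    then show ?thesis by (simp add: D_def)
  qed
  have kint: "integrable (lborel \<Otimes>\<^sub>M lborel) (\<lambda>(t, s). k t s)"
  proof (rule lborel_pair.Fubini_integrable)
    show "integrable lborel (\<lambda>t. \<integral>s. norm (case (t, s) of (t, s) \<Rightarrow> k t s) \<partial>lborel)"
    proof (rule Bochner_Integration.integrable_bound)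
      show "integrable lborel (\<lambda>t. \<bar>\<psi> t\<bar> * D)" using \<psi>i by simp
      show "AE t in lborel. norm (\<integral>s. norm (case (t, s) of (t, s) \<Rightarrow> k t s) \<partial>lborel) \<le> norm (\<bar>\<psi> t\<bar> * D)"
        using kn by (intro AE_I2) (auto intro: order_trans[OF _ abs_ge_self])
    qed measurable
    show "AE t in lborel. integrable lborel (\<lambda>s. case (t, s) of (t, s) \<Rightarrow> k t s)" using ks by simp
  qed measurable
  have "(\<integral>t. \<psi> t * prim h t \<partial>lborel) = (\<integral>t. (\<integral>s. k t s \<partial>lborel) \<partial>lborel)"
    by (simp add: prim_def k_def)
  also have "\<dots> = (\<integral>s. (\<integral>t. k t s \<partial>lborel) \<partial>lborel)"
    using lborel_pair.Fubini_integral[OF kint] by simp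
  also have "\<dots> = (\<integral>s. - (cumulative \<psi> s * h s) \<partial>lborel)"
  proof (rule integral_cong_AE)
    have "(\<integral>t. k t s \<partial>lborel) = - (cumulative \<psi> s * h s)" if s: "s \<noteq> 0" for s
    proof -
      \<comment> \<open>for \<open>s > 0\<close> the kernel is the indicator of \<open>t > s\<close>, that is \<open>1\<close> minus the indicator of \<open>t \<le> s\<close>;
        for \<open>s < 0\<close> it is minus the indicator of \<open>t < s\<close>\<close>
      define e where "e = (if s > 0 then 1 else 0 :: real)"
      have i2: "integrable lborel (\<lambda>t. indicator {..s} t * \<psi> t)"
        using integrable_mult_indicator[OF _ \<psi>i, of "{..s}"] by simp
      have "(\<integral>t. k t s \<partial>lborel) = (\<integral>t. (e * \<psi> t - indicator {..s} t * \<psi> t) * h s \<partial>lborel)"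
      proof (rule integral_cong_AE)
        show "AE t in lborel. k t s = (e * \<psi> t - indicator {..s} t * \<psi> t) * h s"
          using AE_lborel_singleton[of s]
          by eventually_elim (use s in \<open>auto simp: k_def between0_def indicator_def e_def sgn_if\<close>)
      qed (auto simp: k_def between0_def)
      also have "\<dots> = (e * integral\<^sup>L lborel \<psi> - cumulative \<psi> s) * h s"
        using \<psi>i i2 by (simp add: cumulative_def)
      finally show ?thesis by (simp add: 0)
    qed
    then show "AE s in lborel. (\<integral>t. k t s \<partial>lborel) = - (cumulative \<psi> s * h s)"
      using AE_lborel_singleton[of 0] by (auto elim!: eventually_mono)
    have "continuous_on UNIV (cumulative \<psi>)"
      using cumulative_derivative[OF c \<psi>i] by (intro continuous_at_imp_continuous_on) (auto intro: DERIV_isCont)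
    then have [measurable]: "cumulative \<psi> \<in> borel_measurable borel" by (rule borel_measurable_continuous_onI)
    show "(\<lambda>s. - (cumulative \<psi> s * h s)) \<in> borel_measurable lborel" by measurable
  qed measurable
  finally show ?thesis by simp
qed

text \<open>
  Rational end points approximate real ones, half-lines generate the Borel sets, and a function
  all of whose integrals over Borel sets vanish is zero almost everywhere. The localization to
  \<open>(-N, N)\<close> makes the function integrable.
\<close>

lemma AE_zero_if_integral_rational_intervals_zero:
  fixes w :: "real \<Rightarrow> real"
  assumes loc: "\<And>R. integrable lborel (\<lambda>t. indicator {-R..R} t * w t)"
    and 0: "\<And>a b. a \<in> \<rat> \<Longrightarrow> b \<in> \<rat> \<Longrightarrow> a < b \<Longrightarrow> (\<integral>t. indicator {a<..<b} t * w t \<partial>lborel) = 0"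
  shows "AE t in lborel. w t = 0"
proof -
  have "AE t in lborel. indicator {-real N<..<real N} t * w t = 0" for N :: nat
  proof -
    define v where "v t = indicator {-real N<..<real N} t * w t" for t
    have v: "integrable lborel v"
    proof -
      have "integrable lborel (\<lambda>t. indicator {-real N<..<real N} t *\<^sub>R (indicator {-real N..real N} t * w t))"
        by (rule integrable_mult_indicator[OF _ loc]) simp
      moreover have "(\<lambda>t. indicator {-real N<..<real N} t *\<^sub>R (indicator {-real N..real N} t * w t)) = v"
        by (auto simp: v_def fun_eq_iff indicator_def)
      ultimately show ?thesis by simp
    qed
    have vi: "integrable lborel (\<lambda>t. indicator A t * v t)" if "A \<in> sets borel" for A
      using integrable_mult_indicator[OF _ v, of A] that by simp
    have v0: "integral\<^sup>L lborel v = 0"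
    proof (cases "N = 0")
      case False
      then show ?thesis unfolding v_def by (intro 0) auto
    qed (simp add: v_def[abs_def])
    have ray: "(\<integral>t. indicator {x<..} t * v t \<partial>lborel) = 0" for x :: real
    proof -
      have "\<exists>r. r \<in> \<rat> \<and> x < r \<and> r < x + 1 / real (Suc n)" for n
        using Rats_dense_in_real[of x "x + 1 / real (Suc n)"] by auto
      then obtain r where r: "\<And>n. r n \<in> \<rat>" "\<And>n. x < r n" "\<And>n. r n < x + 1 / real (Suc n)" by metis
      have rx: "r \<longlonglongrightarrow> x"
      proof (rule tendsto_sandwich[OF _ _ tendsto_const])
        show "(\<lambda>n. x + 1 / real (Suc n)) \<longlonglongrightarrow> x" by real_asymp
      qed (use r in \<open>auto intro!: always_eventually less_imp_le\<close>)
      have "(\<lambda>n. \<integral>t. indicator {r n<..} t * v t \<partial>lborel) \<longlonglongrightarrow> (\<integral>t. indicator {x<..} t * v t \<partial>lborel)"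
      proof (rule integral_dominated_convergence)
        show "integrable lborel (\<lambda>t. \<bar>v t\<bar>)" using v by (rule integrable_abs)
        show "AE t in lborel. norm (indicator {r n<..} t * v t) \<le> \<bar>v t\<bar>" for n
          by (auto simp: indicator_def)
        show "AE t in lborel. (\<lambda>n. indicator {r n<..} t * v t) \<longlonglongrightarrow> indicator {x<..} t * v t"
        proof (rule AE_I2)
          fix t
          have "eventually (\<lambda>n. indicator {r n<..} t * v t = indicator {x<..} t * v t) sequentially"
          proof (cases "x < t")
            case True
            with rx have "eventually (\<lambda>n. r n < t) sequentially" by (rule order_tendstoD)
            then show ?thesis by eventually_elim (use True in auto)
          next
            case False
            then have "\<not> r n < t" for n using r(2)[of n] by linarith
            then show ?thesis using False by simp
          qed
          then show "(\<lambda>n. indicator {r n<..} t * v t) \<longlonglongrightarrow> indicator {x<..} t * v t" by (rule tendsto_eventually)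
        qed
      qed (use borel_measurable_integrable[OF v] in measurable)
      moreover have "(\<integral>t. indicator {r n<..} t * v t \<partial>lborel) = 0" for n
      proof (cases "max (r n) (- real N) < real N")
        case True
        have "(\<integral>t. indicator {r n<..} t * v t \<partial>lborel) = (\<integral>t. indicator {max (r n) (- real N)<..<real N} t * w t \<partial>lborel)"
          by (intro Bochner_Integration.integral_cong) (auto simp: v_def indicator_def)
        also have "\<dots> = 0" using r(1)[of n] True by (intro 0) (auto simp: max_def)
        finally show ?thesis .
      next
        case False
        then have "(\<integral>t. indicator {r n<..} t * v t \<partial>lborel) = (\<integral>t. 0 \<partial>(lborel :: real measure))"
          by (intro Bochner_Integration.integral_cong) (auto simp: v_def indicator_def)
        then show ?thesis by simp
      qed
      ultimately show ?thesis by (simp add: LIMSEQ_const_iff)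
    qed
    have "(\<integral>t. indicator A t * v t \<partial>lborel) = 0" if A: "A \<in> sets borel" for A
    proof -
      have s: "B \<in> sets borel" if "B \<in> sigma_sets UNIV (range greaterThan)" for B :: "real set"
        using that by (simp add: borel_Ioi)
      have "Int_stable (range greaterThan :: real set set)"
      proof (rule Int_stableI)
        fix a b :: "real set" assume "a \<in> range greaterThan" "b \<in> range greaterThan"
        then obtain x y where "a = {x<..}" "b = {y<..}" by auto
        then have "a \<inter> b = {max x y<..}" by auto
        then show "a \<inter> b \<in> range greaterThan" by blast
      qed
      moreover have "range greaterThan \<subseteq> Pow (UNIV :: real set)" by simp
      moreover have "A \<in> sigma_sets UNIV (range greaterThan)" using A by (simp add: borel_Ioi)
      ultimately show ?thesis
      proof (induction rule: sigma_sets_induct_disjoint)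
        case (basic A)
        then show ?case using ray by auto
      next
        case empty
        show ?case by simp
      next
        case (compl A)
        have "(\<integral>t. indicator (UNIV - A) t * v t \<partial>lborel) = (\<integral>t. v t - indicator A t * v t \<partial>lborel)"
          by (intro Bochner_Integration.integral_cong) (auto simp: indicator_def)
        also have "\<dots> = 0" using v vi[OF s[OF compl(1)]] v0 compl by simp
        finally show ?case .
      next
        case (union A)
        have A: "A i \<in> sets borel" for i using union(2) by (intro s) auto
        have "(LINT t:(\<Union>i. A i)|lborel. v t) = (\<Sum>i. (LINT t:(A i)|lborel. v t))"
        proof (rule lebesgue_integral_countable_add)
          show "A i \<in> sets lborel" for i using A by simp
          show "i \<noteq> j \<Longrightarrow> A i \<inter> A j = {}" for i j using union(1) by (auto simp: disjoint_family_on_def)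
          show "set_integrable lborel (\<Union>i. A i) v"
            unfolding set_integrable_def using A v by (intro integrable_mult_indicator) auto
        qed
        then show ?case using union(3) by (simp add: set_lebesgue_integral_def)
      qed
    qed
    then have "AE t in lborel. v t = 0"
      by (intro sigma_finite_measure.density_zero[OF sigma_finite_lborel v]) (auto simp: set_lebesgue_integral_def)
    then show ?thesis by (simp add: v_def)
  qed
  then have "AE t in lborel. \<forall>N :: nat. indicator {-real N<..<real N} t * w t = 0" by (subst AE_all_countable) auto
  then show ?thesis
  proof eventually_elim
    case (elim t)
    obtain N :: nat where "\<bar>t\<bar> < real N" using reals_Archimedean2 by blast
    then have "t \<in> {- real N<..<real N}" by auto
    then show ?case using elim[rule_format, of N] by simp
  qed
qed

text \<open>
  For \<open>u = f - prim h\<close> the weak identity says that \<open>u\<close> is orthogonal to all balanced bumps. Hence the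
  integral of \<open>u\<close> against \<open>bump a b n\<close> is \<open>\<kappa>\<close> times the integral of that bump, and as \<open>n\<close> grows \<open>u - \<kappa>\<close> is seen to have integral
  zero over every interval with rational end points. Only countably many test functions are involved,
  so that on the product space the identity holds for all of them simultaneously, almost surely.
\<close>

lemma weak_derivative_imp_primitive:
  assumes f: "f \<in> L2_functions gauss" and h: "h \<in> L2_functions gauss"
    and weak: "\<And>a b n. a \<in> \<rat> \<Longrightarrow> b \<in> \<rat> \<Longrightarrow>
      - (\<integral>t. balanced_bump a b n t * f t \<partial>lborel) = (\<integral>t. bump_test a b n t * h t \<partial>lborel)"
  shows "\<exists>C. AE t in lborel. f t = C + prim h t"
proof -
  have [measurable]: "f \<in> borel_measurable borel" "h \<in> borel_measurable borel"
    using f h by (auto intro: L2_gauss_measurable)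
  define u where "u t = f t - prim h t" for t
  have u: "u \<in> L2_functions gauss" unfolding u_def[abs_def] by (intro L2_functions_diff f prim_L2 h)
  have [measurable]: "u \<in> borel_measurable borel" by (rule L2_gauss_measurable[OF u])
  have bi: "integrable lborel (\<lambda>t. bump a b n t * u t)" if "u \<in> L2_functions gauss" for a b n and u :: "real \<Rightarrow> real"
    by (rule L2_gauss_compact_mult_integrable[OF that, where c=1 and R="\<bar>a\<bar> + \<bar>b\<bar>"])
      (auto simp: bump_0_1 intro!: bump_support)
  define I where "I a b n = integral\<^sup>L lborel (bump a b n)" for a b n
  define \<kappa> where "\<kappa> = (\<integral>t. bump 0 1 0 t * u t \<partial>lborel) / I 0 1 0"
  have eqn: "(\<integral>t. bump a b n t * u t \<partial>lborel) = I a b n * \<kappa>" if ab: "a \<in> \<rat>" "b \<in> \<rat>" for a b n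
  proof -
    have split: "balanced_bump a b n t * g t = bump a b n t * g t - I a b n / I 0 1 0 * (bump 0 1 0 t * g t)" for g :: "real \<Rightarrow> real" and t
      by (simp add: balanced_bump_def I_def algebra_simps)
    have int: "integrable lborel (\<lambda>t. balanced_bump a b n t * g t)" if "g \<in> L2_functions gauss" for g
      unfolding split using bi[OF that] by simp
    have "(\<integral>t. balanced_bump a b n t * prim h t \<partial>lborel) = - (\<integral>t. bump_test a b n t * h t \<partial>lborel)"
      unfolding bump_test_def
      by (rule integral_prim_by_parts[OF h, where R="\<bar>a\<bar> + \<bar>b\<bar> + 1"])
        (auto intro: balanced_bump smooth_imp_continuous)
    also have "\<dots> = (\<integral>t. balanced_bump a b n t * f t \<partial>lborel)" using weak[OF ab, of n] by simp
    finally have "(\<integral>t. balanced_bump a b n t * f t \<partial>lborel) - (\<integral>t. balanced_bump a b n t * prim h t \<partial>lborel) = 0" by simp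
    then have "(\<integral>t. balanced_bump a b n t * u t \<partial>lborel) = 0"
      using int[OF f] int[OF prim_L2(1)[OF h]] by (simp add: u_def right_diff_distrib)
    then show ?thesis unfolding split using bi[OF u] by (simp add: \<kappa>_def)
  qed
  define w where "w t = u t - \<kappa>" for t
  have wL: "w \<in> L2_functions gauss" unfolding w_def[abs_def] by (intro L2_functions_diff u L2_gauss_const)
  have [measurable]: "w \<in> borel_measurable borel" by (rule L2_gauss_measurable[OF wL])
  have "AE t in lborel. w t = 0"
  proof (rule AE_zero_if_integral_rational_intervals_zero)
    show loc: "integrable lborel (\<lambda>t. indicator {-R..R} t * w t)" for R
      by (rule L2_gauss_compact_mult_integrable[OF wL, where c=1 and R=R]) (auto simp: indicator_def)
    fix a b :: real assume ab: "a \<in> \<rat>" "b \<in> \<rat>" "a < b"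
    have "(\<lambda>n. \<integral>t. bump a b n t * w t \<partial>lborel) \<longlonglongrightarrow> (\<integral>t. indicator {a<..<b} t * w t \<partial>lborel)"
    proof (rule integral_dominated_convergence)
      define R where "R = \<bar>a\<bar> + \<bar>b\<bar>"
      show "integrable lborel (\<lambda>t. \<bar>indicator {-R..R} t * w t\<bar>)" by (rule integrable_abs[OF loc])
      show "AE t in lborel. (\<lambda>n. bump a b n t * w t) \<longlonglongrightarrow> indicator {a<..<b} t * w t"
        by (intro AE_I2 tendsto_intros bump_tendsto)
      show "AE t in lborel. norm (bump a b n t * w t) \<le> \<bar>indicator {-R..R} t * w t\<bar>" for n
      proof (rule AE_I2)
        fix t
        show "norm (bump a b n t * w t) \<le> \<bar>indicator {-R..R} t * w t\<bar>"
        proof (cases "a < t \<and> t < b")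
          case True
          then have "t \<in> {-R..R}" by (auto simp: R_def)
          then show ?thesis using bump_0_1[of a b n t] by (simp add: abs_mult mult_left_le_one_le)
        qed (simp add: bump_support)
      qed
    qed measurable
    moreover have "(\<integral>t. bump a b n t * w t \<partial>lborel) = 0" for n
    proof -
      have "(\<integral>t. bump a b n t * w t \<partial>lborel) = (\<integral>t. bump a b n t * u t - bump a b n t * \<kappa> \<partial>lborel)"
        by (simp add: w_def right_diff_distrib)
      also have "\<dots> = (\<integral>t. bump a b n t * u t \<partial>lborel) - I a b n * \<kappa>"
        using bi[OF u] bump_integrable by (simp add: I_def)
      finally show ?thesis using eqn[OF ab(1,2)] by simp
    qed
    ultimately show "(\<integral>t. indicator {a<..<b} t * w t \<partial>lborel) = 0" by (simp add: LIMSEQ_const_iff)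
  qed
  then have "AE t in lborel. f t = \<kappa> + prim h t" by eventually_elim (simp add: w_def u_def)
  then show ?thesis by blast
qed

lemma gauss_log_sobolev_weak:
  assumes f: "f \<in> L2_functions gauss" and h: "h \<in> L2_functions gauss"
    and weak: "\<And>a b n. a \<in> \<rat> \<Longrightarrow> b \<in> \<rat> \<Longrightarrow>
      - (\<integral>t. balanced_bump a b n t * f t \<partial>lborel) = (\<integral>t. bump_test a b n t * h t \<partial>lborel)"
  shows "(\<integral>\<^sup>+t. ennreal (rel_ent ((f t)\<^sup>2) (\<integral>t. (f t)\<^sup>2 \<partial>gauss)) \<partial>gauss) \<le> ennreal (2 * (\<integral>t. (h t)\<^sup>2 \<partial>gauss))"
proof -
  have [measurable]: "f \<in> borel_measurable borel" "h \<in> borel_measurable borel"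
    using f h by (auto intro: L2_gauss_measurable)
  obtain C where "AE t in lborel. f t = C + prim h t"
    using weak_derivative_imp_primitive[OF assms] by blast
  then have AE: "AE t in gauss. f t = C + prim h t" by (subst AE_gauss_iff) auto
  have eq: "(\<integral>t. (f t)\<^sup>2 \<partial>gauss) = (\<integral>t. (C + prim h t)\<^sup>2 \<partial>gauss)"
    using AE by (intro integral_cong_AE) (auto elim: eventually_mono)
  have "(\<integral>\<^sup>+t. ennreal (rel_ent ((f t)\<^sup>2) (\<integral>t. (f t)\<^sup>2 \<partial>gauss)) \<partial>gauss)
    = (\<integral>\<^sup>+t. ennreal (rel_ent ((C + prim h t)\<^sup>2) (\<integral>t. (C + prim h t)\<^sup>2 \<partial>gauss)) \<partial>gauss)"
    unfolding eq using AE by (intro nn_integral_cong_AE) (auto elim: eventually_mono)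
  also have "\<dots> \<le> ennreal (2 * (\<integral>t. (h t)\<^sup>2 \<partial>gauss))" using gauss_lsi_L2[OF h] by (simp add: gauss_lsi_def)
  finally show ?thesis .
qed

section \<open>Gradients in the coordinates of the mixed product\<close>

context resampling begin

lemma L2_bounded_mult_integrable:
  assumes f: "f \<in> L2_functions M" and [measurable]: "A \<in> borel_measurable M" and A: "\<And>x. \<bar>A x\<bar> \<le> B"
  shows "integrable M (\<lambda>x. A x * f x)"
proof (rule Bochner_Integration.integrable_bound)
  show "integrable M (\<lambda>x. B * f x)" using L2_functions_integrable[OF f] by simp
  have [measurable]: "f \<in> borel_measurable M" using L2_functionsD[OF f] by simp
  show "(\<lambda>x. A x * f x) \<in> borel_measurable M" by measurable
  show "AE x in M. norm (A x * f x) \<le> norm (B * f x)"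
    using A by (intro AE_I2) (auto simp: abs_mult intro!: mult_right_mono order_trans[OF A])
qed

text \<open>
  Integration by parts in the coordinate \<open>k\<close>, in a form that mentions only averaging operators. For a
  Gaussian coordinate \<open>y\<close> and a test function \<open>g\<close>, the weights are \<open>A = g'(y)/\<phi>(y)\<close> and \<open>B = g(y)/\<phi>(y)\<close>, where \<open>\<phi>\<close> is
  the normal density that turns Lebesgue integrals into Gaussian ones.
\<close>

definition weak_identity :: "'k \<Rightarrow> ('a \<Rightarrow> real) \<Rightarrow> ('a \<Rightarrow> real) \<Rightarrow> ('a \<Rightarrow> real) \<Rightarrow> ('a \<Rightarrow> real) \<Rightarrow> bool" where
  "weak_identity k A B f h \<longleftrightarrow> (AE x in M. - avg (-{k}) (\<lambda>x. A x * f x) x = avg (-{k}) (\<lambda>x. B x * h x) x)"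

text \<open>
  Weights that depend on a coordinate in \<open>I\<close> can be pulled out of \<open>avg I\<close>, and averages commute. Thus weak
  derivatives commute with integrating out other coordinates.
\<close>

lemma weak_identity_avg:
  assumes f: "f \<in> L2_functions M" and h: "h \<in> L2_functions M"
    and A [measurable]: "A \<in> borel_measurable M" "\<And>x. \<bar>A x\<bar> \<le> C" "\<And>a b. A (mrg I a b) = A a"
    and B [measurable]: "B \<in> borel_measurable M" "\<And>x. \<bar>B x\<bar> \<le> C'" "\<And>a b. B (mrg I a b) = B a"
    and weak: "weak_identity k A B f h"
  shows "weak_identity k A B (avg I f) (avg I h)"
proof -
  have [measurable]: "f \<in> borel_measurable M" "h \<in> borel_measurable M" using f h by (auto dest: L2_functionsD)
  have Ai: "integrable M (\<lambda>x. A x * f x)" by (rule L2_bounded_mult_integrable[OF f A(1,2)])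
  have Bi: "integrable M (\<lambda>x. B x * h x)" by (rule L2_bounded_mult_integrable[OF h B(1,2)])
  have eA: "(\<lambda>x. A x * avg I f x) = avg I (\<lambda>x. A x * f x)"
    by (rule ext, rule avg_mult_left[symmetric]) (rule A)
  have eB: "(\<lambda>x. B x * avg I h x) = avg I (\<lambda>x. B x * h x)"
    by (rule ext, rule avg_mult_left[symmetric]) (rule B)
  have neg: "avg I (\<lambda>x. - g x) a = - avg I g a" for g a by (simp add: avg_def)
  have "AE x in M. avg I (\<lambda>x. - avg (-{k}) (\<lambda>x. A x * f x) x) x = avg I (avg (-{k}) (\<lambda>x. B x * h x)) x"
    using weak unfolding weak_identity_def by (intro avg_cong_AE) auto
  with avg_commute[OF Ai, of "-{k}" I] avg_commute[OF Bi, of "-{k}" I]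
  show ?thesis unfolding weak_identity_def eA eB
    by eventually_elim (simp add: neg)
qed

text \<open>
  A function that does not depend on the coordinate \<open>k\<close> has weak derivative zero, since the weight \<open>A\<close>
  has average zero.
\<close>

lemma weak_identity_self:
  assumes f: "f \<in> L2_functions M" and A [measurable]: "A \<in> borel_measurable M" "\<And>x. \<bar>A x\<bar> \<le> C"
    and A0: "\<And>x. x \<in> space M \<Longrightarrow> avg (-{k}) A x = 0"
    and weak: "weak_identity k A B f h"
  shows "weak_identity k A B (\<lambda>x. f x - avg (-{k}) f x) h"
proof -
  have Ai: "integrable M (\<lambda>x. A x * f x)" by (rule L2_bounded_mult_integrable[OF f A])
  have Ai2: "integrable M (\<lambda>x. A x * avg (-{k}) f x)" by (rule L2_bounded_mult_integrable[OF avg_L2[OF f] A])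
  have "avg (-{k}) (\<lambda>x. A x * avg (-{k}) f x) x = 0" if "x \<in> space M" for x
    using avg_mult_left[of "avg (-{k}) f" "-{k}" x A] A0[OF that] by (simp add: avg_mrg mult.commute)
  then have 0: "AE x in M. avg (-{k}) (\<lambda>x. A x * avg (-{k}) f x) x = 0" by (rule AE_I2)
  have e: "(\<lambda>x. A x * (f x - avg (-{k}) f x)) = (\<lambda>x. A x * f x - A x * avg (-{k}) f x)"
    by (simp add: right_diff_distrib)
  show ?thesis
    using avg_diff[OF Ai Ai2, of "-{k}"] 0 weak unfolding weak_identity_def e
    by eventually_elim simp
qed

lemma weak_identity_diff:
  assumes f: "f \<in> L2_functions M" "f' \<in> L2_functions M" and h: "h \<in> L2_functions M" "h' \<in> L2_functions M"
    and A [measurable]: "A \<in> borel_measurable M" "\<And>x. \<bar>A x\<bar> \<le> C" and B [measurable]: "B \<in> borel_measurable M" "\<And>x. \<bar>B x\<bar> \<le> C'"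
    and weak: "weak_identity k A B f h" "weak_identity k A B f' h'"
  shows "weak_identity k A B (\<lambda>x. f x - f' x) (\<lambda>x. h x - h' x)"
proof -
  note i = L2_bounded_mult_integrable[OF f(1) A] L2_bounded_mult_integrable[OF f(2) A]
    L2_bounded_mult_integrable[OF h(1) B] L2_bounded_mult_integrable[OF h(2) B]
  show ?thesis using weak avg_diff[OF i(1,2), of "-{k}"] avg_diff[OF i(3,4), of "-{k}"]
    unfolding weak_identity_def right_diff_distrib by eventually_elim simp
qed

end

lemma measurable_mixed_update [measurable]:
  assumes a: "a \<in> space (mixed_product p S)"
  shows "(\<lambda>t. (fst a, (snd a)(i := t))) \<in> borel \<rightarrow>\<^sub>M mixed_product p S"
  unfolding mixed_product_def
proof (rule measurable_Pair)
  have "fst a \<in> space (two_point_product p S)" using a by (auto simp: mixed_product_def space_pair_measure)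
  then show "(\<lambda>t. fst a) \<in> borel \<rightarrow>\<^sub>M two_point_product p S" by simp
  show "(\<lambda>t. (snd a)(i := t)) \<in> borel \<rightarrow>\<^sub>M gauss_product"
    unfolding gauss_product_def
  proof (rule measurable_PiM_single'[where f="\<lambda>j t. ((snd a)(i := t)) j"])
    show "(\<lambda>t. ((snd a)(i := t)) j) \<in> borel \<rightarrow>\<^sub>M gauss" for j by (cases "j = i") auto
  qed auto
qed

lemma mixed_mrg_Inr: "mixed_mrg (-{Inr i}) a b = (fst a, (snd a)(i := snd b i))"
  by (auto simp: mixed_mrg_def fun_eq_iff)

lemma avg_Inr:
  assumes [measurable]: "f \<in> borel_measurable (mixed_product p S)" and a: "a \<in> space (mixed_product p S)"
  shows "resampling.avg (mixed_product p S) mixed_mrg (-{Inr i}) f a = (\<integral>t. f (fst a, (snd a)(i := t)) \<partial>gauss)"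
proof -
  interpret resampling "mixed_product p S" mixed_mrg by (rule resampling_mixed_product)
  note [measurable] = measurable_mixed_update[OF a]
  have "avg (-{Inr i}) f a = (\<integral>b. f (fst a, (snd a)(i := snd b i)) \<partial>mixed_product p S)"
    by (simp add: avg_def mixed_mrg_Inr)
  also have "\<dots> = (\<integral>t. f (fst a, (snd a)(i := t)) \<partial>distr (mixed_product p S) borel (\<lambda>a. snd a i))"
    by (rule integral_distr[symmetric]) measurable
  finally show ?thesis by (simp only: distr_mixed_Inr)
qed

lemma nn_integral_mrg_Inr:
  assumes [measurable]: "F \<in> borel_measurable (mixed_product p S)" and a: "a \<in> space (mixed_product p S)"
  shows "(\<integral>\<^sup>+b. F (mixed_mrg (-{Inr i}) a b) \<partial>mixed_product p S) = (\<integral>\<^sup>+t. F (fst a, (snd a)(i := t)) \<partial>gauss)"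
proof -
  note [measurable] = measurable_mixed_update[OF a]
  have "(\<integral>\<^sup>+b. F (mixed_mrg (-{Inr i}) a b) \<partial>mixed_product p S) = (\<integral>\<^sup>+b. F (fst a, (snd a)(i := snd b i)) \<partial>mixed_product p S)"
    by (simp add: mixed_mrg_Inr)
  also have "\<dots> = (\<integral>\<^sup>+t. F (fst a, (snd a)(i := t)) \<partial>distr (mixed_product p S) borel (\<lambda>a. snd a i))"
    by (rule nn_integral_distr[symmetric]) measurable
  finally show ?thesis by (simp only: distr_mixed_Inr)
qed

text \<open>
  The density of the normal distribution cancels, so the average is an integral with respect to
  Lebesgue measure, as in the definition of the weak derivative.
\<close>

lemma avg_Inr_lborel:
  assumes [measurable]: "f \<in> borel_measurable (mixed_product p S)" "q \<in> borel_measurable borel" and a: "a \<in> space (mixed_product p S)"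
  shows "resampling.avg (mixed_product p S) mixed_mrg (-{Inr i}) (\<lambda>a. q (snd a i) / std_normal_density (snd a i) * f a) a
    = (\<integral>t. q t * f (fst a, (snd a)(i := t)) \<partial>lborel)"
proof -
  note [measurable] = measurable_mixed_update[OF a]
  have "resampling.avg (mixed_product p S) mixed_mrg (-{Inr i}) (\<lambda>a. q (snd a i) / std_normal_density (snd a i) * f a) a
    = (\<integral>t. q t / std_normal_density t * f (fst a, (snd a)(i := t)) \<partial>gauss)"
    by (subst avg_Inr[OF _ a]) auto
  also have "\<dots> = (\<integral>t. std_normal_density t *\<^sub>R (q t / std_normal_density t * f (fst a, (snd a)(i := t))) \<partial>lborel)"
    by (rule integral_density) auto
  also have "\<dots> = (\<integral>t. q t * f (fst a, (snd a)(i := t)) \<partial>lborel)"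
    by (intro Bochner_Integration.integral_cong refl) (simp add: less_imp_neq[OF normal_density_pos, symmetric])
  finally show ?thesis .
qed

text \<open>
  Division by the normal density, to be used in \<open>weak_identity\<close>.
\<close>

definition bump_weight :: "(real \<Rightarrow> real) \<Rightarrow> nat \<Rightarrow> ('s \<Rightarrow> bool) \<times> (nat \<Rightarrow> real) \<Rightarrow> real" where
  "bump_weight q i a = q (snd a i) / std_normal_density (snd a i)"

lemma bump_weight_bounded:
  assumes c: "continuous_on UNIV q" and supp: "\<And>t. \<bar>t\<bar> > R \<Longrightarrow> q t = 0"
  shows "\<exists>C. \<forall>a. \<bar>bump_weight q i a\<bar> \<le> C"
proof -
  have "continuous_on UNIV (\<lambda>t. q t / std_normal_density t)"
    unfolding normal_density_def by (intro continuous_intros c) auto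
  then obtain C where "\<And>t. \<bar>q t / std_normal_density t\<bar> \<le> C"
    by (rule compact_support_bounded_uniformly_continuous[where R=R]) (use supp in auto)
  then show ?thesis by (auto simp: bump_weight_def)
qed

lemma bump_test_continuous: "continuous_on A (bump_test a b n)"
proof (intro continuous_at_imp_continuous_on ballI)
  fix t
  have "bump_test a b n differentiable (at t)"
    using bump_test(1)[of a b n] unfolding test_function_def by (metis funpow_0)
  then show "isCont (bump_test a b n) t"
    by (simp add: differentiable_imp_continuous_within)
qed

lemma bump_weights:
  fixes i a b n p and S :: "'s set"
  defines "A \<equiv> bump_weight (balanced_bump a b n) i" and "B \<equiv> bump_weight (bump_test a b n) i"
  shows "A \<in> borel_measurable (mixed_product p S)" "B \<in> borel_measurable (mixed_product p S)"
    "\<exists>C. \<forall>x. \<bar>A x\<bar> \<le> C" "\<exists>C. \<forall>x. \<bar>B x\<bar> \<le> C"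
    "Inr i \<in> I \<Longrightarrow> A (mixed_mrg I x y) = A x" "Inr i \<in> I \<Longrightarrow> B (mixed_mrg I x y) = B x"
    "x \<in> space (mixed_product p S) \<Longrightarrow> resampling.avg (mixed_product p S) mixed_mrg (-{Inr i}) A x = 0"
proof -
  have c: "continuous_on UNIV (balanced_bump a b n)" by (intro smooth_imp_continuous balanced_bump)
  have c': "continuous_on UNIV (bump_test a b n)" by (rule bump_test_continuous)
  have [measurable]: "balanced_bump a b n \<in> borel_measurable borel" "bump_test a b n \<in> borel_measurable borel"
    using c c' by (auto intro: borel_measurable_continuous_onI)
  show "A \<in> borel_measurable (mixed_product p S)" "B \<in> borel_measurable (mixed_product p S)"
    unfolding A_def B_def bump_weight_def[abs_def] by measurable
  show "\<exists>C. \<forall>x. \<bar>A x\<bar> \<le> C" unfolding A_def by (rule bump_weight_bounded[OF c balanced_bump(3)])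
  show "\<exists>C. \<forall>x. \<bar>B x\<bar> \<le> C" unfolding B_def by (rule bump_weight_bounded[OF c' bump_test(3)])
  show "Inr i \<in> I \<Longrightarrow> A (mixed_mrg I x y) = A x" "Inr i \<in> I \<Longrightarrow> B (mixed_mrg I x y) = B x"
    by (auto simp: A_def B_def bump_weight_def mixed_mrg_def)
  assume x: "x \<in> space (mixed_product p S)"
  show "resampling.avg (mixed_product p S) mixed_mrg (-{Inr i}) A x = 0"
    using avg_Inr_lborel[of "\<lambda>_. 1" p S "balanced_bump a b n" x i] x
    by (simp add: A_def bump_weight_def[abs_def] balanced_bump(2))
qed

text \<open>
  The relation \<open>R\<close> of \<open>energy_inequality\<close>: \<open>\<Delta>\<^sub>s f\<close> for a coin, the weak derivative for a Gaussian coordinate, tested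
  with the countable family \<open>bump_test\<close> at rational end points.
\<close>

definition coordinate_gradient :: "real \<Rightarrow> 's set \<Rightarrow> 's + nat \<Rightarrow> (('s \<Rightarrow> bool) \<times> (nat \<Rightarrow> real) \<Rightarrow> real)
    \<Rightarrow> (('s \<Rightarrow> bool) \<times> (nat \<Rightarrow> real) \<Rightarrow> real) \<Rightarrow> bool" where
  "coordinate_gradient p S k f h \<longleftrightarrow> f \<in> L2_functions (mixed_product p S) \<and> h \<in> L2_functions (mixed_product p S) \<and>
    (case k of
       Inl s \<Rightarrow> s \<in> S \<and> (AE x in mixed_product p S. h x = f x - resampling.avg (mixed_product p S) mixed_mrg (-{Inl s}) f x)
     | Inr i \<Rightarrow> \<forall>a\<in>\<rat>. \<forall>b\<in>\<rat>. \<forall>n. resampling.weak_identity (mixed_product p S) mixed_mrg (Inr i)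
         (bump_weight (balanced_bump a b n) i) (bump_weight (bump_test a b n) i) f h)"

definition log_sobolev_constant :: "real \<Rightarrow> 's + nat \<Rightarrow> real" where
  "log_sobolev_constant p k = (case k of Inl s \<Rightarrow> c_LS p | Inr i \<Rightarrow> 2)"

context
  fixes p :: real and S :: "'s set"
begin

interpretation resampling "mixed_product p S" mixed_mrg by (rule resampling_mixed_product)

lemma coordinate_gradient_avg:
  assumes R: "coordinate_gradient p S k f h" and I: "k \<in> I"
  shows "coordinate_gradient p S k (avg I f) (avg I h)"
proof -
  have f: "f \<in> L2_functions (mixed_product p S)" and h: "h \<in> L2_functions (mixed_product p S)"
    using R by (auto simp: coordinate_gradient_def)
  note fi = L2_functions_integrable[OF f]
  have [measurable]: "f \<in> borel_measurable (mixed_product p S)" "h \<in> borel_measurable (mixed_product p S)"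
    using f h by (auto dest: L2_functionsD)
  show ?thesis
  proof (cases k)
    case (Inl s)
    then have s: "s \<in> S" and AE: "AE x in mixed_product p S. h x = f x - avg (-{Inl s}) f x"
      using R by (auto simp: coordinate_gradient_def)
    have "AE x in mixed_product p S. avg I h x = avg I (\<lambda>x. f x - avg (-{Inl s}) f x) x"
      using AE by (intro avg_cong_AE) auto
    with avg_diff[OF fi integrable_avg[OF fi], of I "-{Inl s}"] avg_commute[OF fi, of I "-{Inl s}"]
    have "AE x in mixed_product p S. avg I h x = avg I f x - avg (-{Inl s}) (avg I f) x"
      by eventually_elim simp
    then show ?thesis using Inl s avg_L2[OF f] avg_L2[OF h] by (simp add: coordinate_gradient_def)
  next
    case (Inr i)
    have "weak_identity (Inr i) (bump_weight (balanced_bump a b n) i) (bump_weight (bump_test a b n) i) (avg I f) (avg I h)"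
      if ab: "a \<in> \<rat>" "b \<in> \<rat>" for a b n
    proof -
      obtain C C' where "\<forall>x. \<bar>bump_weight (balanced_bump a b n) i (x :: ('s \<Rightarrow> bool) \<times> (nat \<Rightarrow> real))\<bar> \<le> C"
        "\<forall>x. \<bar>bump_weight (bump_test a b n) i (x :: ('s \<Rightarrow> bool) \<times> (nat \<Rightarrow> real))\<bar> \<le> C'"
        using bump_weights(3,4) by blast
      then show ?thesis
        using R ab I Inr bump_weights(1,2)
        by (intro weak_identity_avg[OF f h, where C=C and C'=C'])
          (auto simp: coordinate_gradient_def intro: bump_weights(5,6))
    qed
    then show ?thesis using Inr avg_L2[OF f] avg_L2[OF h] by (simp add: coordinate_gradient_def)
  qed
qed

lemma coordinate_gradient_self:
  assumes R: "coordinate_gradient p S k f h"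
  shows "coordinate_gradient p S k (\<lambda>x. f x - avg (-{k}) f x) h"
proof -
  have f: "f \<in> L2_functions (mixed_product p S)" and h: "h \<in> L2_functions (mixed_product p S)"
    using R by (auto simp: coordinate_gradient_def)
  note fi = L2_functions_integrable[OF f]
  have L: "(\<lambda>x. f x - avg (-{k}) f x) \<in> L2_functions (mixed_product p S)" by (intro L2_functions_diff f avg_L2)
  show ?thesis
  proof (cases k)
    case (Inl s)
    then have s: "s \<in> S" and AE: "AE x in mixed_product p S. h x = f x - avg (-{Inl s}) f x"
      using R by (auto simp: coordinate_gradient_def)
    have "AE x in mixed_product p S. avg (-{Inl s}) (\<lambda>x. f x - avg (-{Inl s}) f x) x = 0"
      using avg_diff[OF fi integrable_avg[OF fi], of "-{Inl s}" "-{Inl s}"] avg_avg[OF fi, of "-{Inl s}" "-{Inl s}"]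
      by eventually_elim simp
    with AE have "AE x in mixed_product p S. h x = (f x - avg (-{Inl s}) f x) - avg (-{Inl s}) (\<lambda>x. f x - avg (-{Inl s}) f x) x"
      by eventually_elim simp
    then show ?thesis using Inl s L h by (simp add: coordinate_gradient_def)
  next
    case (Inr i)
    have "weak_identity (Inr i) (bump_weight (balanced_bump a b n) i) (bump_weight (bump_test a b n) i) (\<lambda>x. f x - avg (-{k}) f x) h"
      if ab: "a \<in> \<rat>" "b \<in> \<rat>" for a b n
    proof -
      obtain C where "\<forall>x. \<bar>bump_weight (balanced_bump a b n) i (x :: ('s \<Rightarrow> bool) \<times> (nat \<Rightarrow> real))\<bar> \<le> C"
        using bump_weights(3) by blast
      then show ?thesis
        using R ab unfolding Inr
        by (intro weak_identity_self[OF f, where C=C])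
          (auto simp: coordinate_gradient_def intro: bump_weights)
    qed
    then show ?thesis using Inr L h by (simp add: coordinate_gradient_def)
  qed
qed

lemma coordinate_gradient_diff:
  assumes R: "coordinate_gradient p S k f h" "coordinate_gradient p S k f' h'"
  shows "coordinate_gradient p S k (\<lambda>x. f x - f' x) (\<lambda>x. h x - h' x)"
proof -
  have f: "f \<in> L2_functions (mixed_product p S)" "f' \<in> L2_functions (mixed_product p S)"
    and h: "h \<in> L2_functions (mixed_product p S)" "h' \<in> L2_functions (mixed_product p S)"
    using R by (auto simp: coordinate_gradient_def)
  have L: "(\<lambda>x. f x - f' x) \<in> L2_functions (mixed_product p S)" "(\<lambda>x. h x - h' x) \<in> L2_functions (mixed_product p S)"
    by (intro L2_functions_diff f h)+
  show ?thesis
  proof (cases k)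
    case (Inl s)
    then have s: "s \<in> S" and AE: "AE x in mixed_product p S. h x = f x - avg (-{Inl s}) f x"
      "AE x in mixed_product p S. h' x = f' x - avg (-{Inl s}) f' x"
      using R by (auto simp: coordinate_gradient_def)
    from AE avg_diff[OF L2_functions_integrable[OF f(1)] L2_functions_integrable[OF f(2)], of "-{Inl s}"]
    have "AE x in mixed_product p S. h x - h' x = (f x - f' x) - avg (-{Inl s}) (\<lambda>x. f x - f' x) x"
      by eventually_elim simp
    then show ?thesis using Inl s L by (simp add: coordinate_gradient_def)
  next
    case (Inr i)
    have "weak_identity (Inr i) (bump_weight (balanced_bump a b n) i) (bump_weight (bump_test a b n) i) (\<lambda>x. f x - f' x) (\<lambda>x. h x - h' x)"
      if ab: "a \<in> \<rat>" "b \<in> \<rat>" for a b n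
    proof -
      obtain C C' where "\<forall>x. \<bar>bump_weight (balanced_bump a b n) i (x :: ('s \<Rightarrow> bool) \<times> (nat \<Rightarrow> real))\<bar> \<le> C"
        "\<forall>x. \<bar>bump_weight (bump_test a b n) i (x :: ('s \<Rightarrow> bool) \<times> (nat \<Rightarrow> real))\<bar> \<le> C'"
        using bump_weights(3,4) by blast
      then show ?thesis
        using R ab Inr
        by (intro weak_identity_diff[OF f h, where C=C and C'=C'])
          (auto simp: coordinate_gradient_def intro: bump_weights)
    qed
    then show ?thesis using Inr L by (simp add: coordinate_gradient_def)
  qed
qed

text \<open>
  On almost every fibre the section of \<open>f\<close> is square integrable and satisfies all countably many
  weak identities, so \<open>gauss_log_sobolev_weak\<close> applies to it.
\<close>

lemma coordinate_log_sobolev_Inr: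
  assumes R: "coordinate_gradient p S (Inr i) f h"
  shows "(\<integral>\<^sup>+ x. ennreal (rel_ent ((f x)\<^sup>2) (avg (-{Inr i}) (\<lambda>x. (f x)\<^sup>2) x)) \<partial>mixed_product p S)
    \<le> ennreal (2 * (\<integral>x. (h x)\<^sup>2 \<partial>mixed_product p S))"
proof -
  let ?M = "mixed_product p S" and ?I = "-{Inr i} :: ('s + nat) set"
  have f: "f \<in> L2_functions ?M" and h: "h \<in> L2_functions ?M"
    using R by (auto simp: coordinate_gradient_def)
  have [measurable]: "f \<in> borel_measurable ?M" "h \<in> borel_measurable ?M"
    using f h by (auto dest: L2_functionsD)
  let ?u = "\<lambda>a t. f (fst a, (snd a)(i := t))" and ?v = "\<lambda>a t. h (fst a, (snd a)(i := t))"
  have weak: "AE x in ?M. \<forall>a\<in>\<rat>. \<forall>b\<in>\<rat>. \<forall>n. - (\<integral>t. balanced_bump a b n t * ?u x t \<partial>lborel) = (\<integral>t. bump_test a b n t * ?v x t \<partial>lborel)"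
  proof (intro AE_ball_countable' AE_all_countable[THEN iffD2] allI countable_rat)
    fix a b :: real and n assume ab: "a \<in> \<rat>" "b \<in> \<rat>"
    have [measurable]: "balanced_bump a b n \<in> borel_measurable borel" "bump_test a b n \<in> borel_measurable borel"
      by (auto intro!: borel_measurable_continuous_onI smooth_imp_continuous balanced_bump bump_test_continuous)
    have "weak_identity (Inr i) (bump_weight (balanced_bump a b n) i) (bump_weight (bump_test a b n) i) f h"
      using R ab by (simp add: coordinate_gradient_def)
    then show "AE x in ?M. - (\<integral>t. balanced_bump a b n t * ?u x t \<partial>lborel) = (\<integral>t. bump_test a b n t * ?v x t \<partial>lborel)"
      unfolding weak_identity_def bump_weight_def using AE_space
    proof eventually_elim
      case (elim x)
      have "avg ?I (\<lambda>x. balanced_bump a b n (snd x i) / std_normal_density (snd x i) * f x) x = (\<integral>t. balanced_bump a b n t * ?u x t \<partial>lborel)"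
        "avg ?I (\<lambda>x. bump_test a b n (snd x i) / std_normal_density (snd x i) * h x) x = (\<integral>t. bump_test a b n t * ?v x t \<partial>lborel)"
        by (intro avg_Inr_lborel elim; measurable)+
      then show ?case using elim(1) by (simp only:)
    qed
  qed
  have L2: "AE x in ?M. (\<lambda>t. g (fst x, (snd x)(i := t))) \<in> L2_functions gauss" if g: "g \<in> L2_functions ?M" for g
    using AE_integrable_mrg[OF L2_functionsD(2)[OF g], of ?I] AE_space
  proof eventually_elim
    case (elim x)
    note [measurable] = measurable_mixed_update[OF elim(2)]
    have [measurable]: "g \<in> borel_measurable ?M" using g by (auto dest: L2_functionsD)
    have "integrable (distr ?M borel (\<lambda>b. snd b i)) (\<lambda>t. (g (fst x, (snd x)(i := t)))\<^sup>2)"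
      using elim(1) by (subst integrable_distr_eq) (auto simp: mixed_mrg_Inr)
    then show ?case unfolding distr_mixed_Inr by (simp add: L2_functions_def)
  qed
  have avg2: "avg ?I (\<lambda>x. (g x)\<^sup>2) x = (\<integral>t. (g (fst x, (snd x)(i := t)))\<^sup>2 \<partial>gauss)" if "g \<in> borel_measurable ?M" "x \<in> space ?M" for g x
    using that by (intro avg_Inr) auto
  have "(\<integral>\<^sup>+ x. ennreal (rel_ent ((f x)\<^sup>2) (avg ?I (\<lambda>x. (f x)\<^sup>2) x)) \<partial>?M)
    = (\<integral>\<^sup>+ x. \<integral>\<^sup>+ b. ennreal (rel_ent ((f (mixed_mrg ?I x b))\<^sup>2) (avg ?I (\<lambda>x. (f x)\<^sup>2) (mixed_mrg ?I x b))) \<partial>?M \<partial>?M)"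
    by (rule nn_integral_mrg[symmetric]) measurable
  also have "\<dots> \<le> (\<integral>\<^sup>+ x. ennreal (2 * avg ?I (\<lambda>x. (h x)\<^sup>2) x) \<partial>?M)"
  proof (rule nn_integral_mono_AE)
    show "AE x in ?M. (\<integral>\<^sup>+ b. ennreal (rel_ent ((f (mixed_mrg ?I x b))\<^sup>2) (avg ?I (\<lambda>x. (f x)\<^sup>2) (mixed_mrg ?I x b))) \<partial>?M)
      \<le> ennreal (2 * avg ?I (\<lambda>x. (h x)\<^sup>2) x)"
      using weak L2[OF f] L2[OF h] AE_space
    proof eventually_elim
      case (elim x)
      have "(\<integral>\<^sup>+ b. ennreal (rel_ent ((f (mixed_mrg ?I x b))\<^sup>2) (avg ?I (\<lambda>x. (f x)\<^sup>2) (mixed_mrg ?I x b))) \<partial>?M)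
        = (\<integral>\<^sup>+ t. ennreal (rel_ent ((?u x t)\<^sup>2) (avg ?I (\<lambda>x. (f x)\<^sup>2) x)) \<partial>gauss)"
        unfolding avg_mrg
        by (rule nn_integral_mrg_Inr[where F="\<lambda>z. ennreal (rel_ent ((f z)\<^sup>2) (avg ?I (\<lambda>x. (f x)\<^sup>2) x))", OF _ elim(4)]) measurable
      also have "\<dots> = (\<integral>\<^sup>+ t. ennreal (rel_ent ((?u x t)\<^sup>2) (\<integral>t. (?u x t)\<^sup>2 \<partial>gauss)) \<partial>gauss)"
        using elim(4) by (simp add: avg2)
      also have "\<dots> \<le> ennreal (2 * (\<integral>t. (?v x t)\<^sup>2 \<partial>gauss))"
        by (rule gauss_log_sobolev_weak[OF elim(2,3)]) (use elim(1) in blast)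
      finally show ?case using elim(4) by (simp add: avg2)
    qed
  qed
  also have "\<dots> = ennreal (\<integral>x. 2 * avg ?I (\<lambda>x. (h x)\<^sup>2) x \<partial>?M)"
    using integrable_avg[OF L2_functionsD(2)[OF h], of ?I]
    by (intro nn_integral_eq_integral) (simp, simp add: avg_def)
  also have "\<dots> = ennreal (2 * (\<integral>x. (h x)\<^sup>2 \<partial>?M))"
    using integral_avg[OF L2_functionsD(2)[OF h], of ?I] by simp
  finally show ?thesis .
qed

lemma coordinate_log_sobolev:
  assumes p: "0 < p" "p < 1" and R: "coordinate_gradient p S k f h"
  shows "(\<integral>\<^sup>+ x. ennreal (rel_ent ((f x)\<^sup>2) (avg (-{k}) (\<lambda>x. (f x)\<^sup>2) x)) \<partial>mixed_product p S)
    \<le> ennreal (log_sobolev_constant p k * (\<integral>x. (h x)\<^sup>2 \<partial>mixed_product p S))"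
proof (cases k)
  case (Inl s)
  have f: "f \<in> L2_functions (mixed_product p S)" and h: "h \<in> L2_functions (mixed_product p S)"
    and s: "s \<in> S" and AE: "AE x in mixed_product p S. h x = f x - avg (-{Inl s}) f x"
    using R Inl by (auto simp: coordinate_gradient_def)
  have [measurable]: "f \<in> borel_measurable (mixed_product p S)" "h \<in> borel_measurable (mixed_product p S)"
    using f h by (auto dest: L2_functionsD)
  have "(\<integral>x. (f x - avg (-{Inl s}) f x)\<^sup>2 \<partial>mixed_product p S) = (\<integral>x. (h x)\<^sup>2 \<partial>mixed_product p S)"
    using AE by (intro integral_cong_AE) (auto elim: eventually_mono)
  then show ?thesis using mixed_Inl_log_sobolev[OF p s f] by (simp add: Inl log_sobolev_constant_def)
next
  case (Inr i)
  then show ?thesis using coordinate_log_sobolev_Inr[of i f h] R by (simp add: log_sobolev_constant_def)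
qed

end

section \<open>The inequality for infinitely many coordinates\<close>

lemma sum_le_infsum_ennreal:
  fixes f :: "'a \<Rightarrow> ennreal"
  assumes "finite B" "B \<subseteq> A"
  shows "sum f B \<le> infsum f A"
  using assms by (subst nonneg_infsum_complete) (auto intro: SUP_upper)

lemma coordinate_gradient_weak_partial:
  assumes f: "f \<in> L2_functions (mixed_product p S)" and w: "weak_partial p S i f h"
  shows "coordinate_gradient p S (Inr i) f h"
proof -
  let ?M = "mixed_product p S"
  interpret resampling ?M mixed_mrg by (rule resampling_mixed_product)
  have h: "h \<in> L2_functions ?M" using w by (simp add: weak_partial_def)
  have [measurable]: "f \<in> borel_measurable ?M" "h \<in> borel_measurable ?M" using f h by (auto dest: L2_functionsD)
  have "weak_identity (Inr i) (bump_weight (balanced_bump a b n) i) (bump_weight (bump_test a b n) i) f h" for a b n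
  proof -
    have [measurable]: "balanced_bump a b n \<in> borel_measurable borel" "bump_test a b n \<in> borel_measurable borel"
      by (auto intro!: borel_measurable_continuous_onI smooth_imp_continuous balanced_bump bump_test_continuous)
    have "AE z in ?M. - (\<integral>t. deriv (bump_test a b n) t * f (fst z, (snd z)(i := t)) \<partial>lborel) = (\<integral>t. bump_test a b n t * h (fst z, (snd z)(i := t)) \<partial>lborel)"
      using w bump_test(1)[of a b n] unfolding weak_partial_def by (auto simp: split_beta')
    then show ?thesis
      unfolding weak_identity_def bump_weight_def using AE_space
    proof eventually_elim
      case (elim x)
      have "avg (-{Inr i}) (\<lambda>x. balanced_bump a b n (snd x i) / std_normal_density (snd x i) * f x) x = (\<integral>t. balanced_bump a b n t * f (fst x, (snd x)(i := t)) \<partial>lborel)"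
        "avg (-{Inr i}) (\<lambda>x. bump_test a b n (snd x i) / std_normal_density (snd x i) * h x) x = (\<integral>t. bump_test a b n t * h (fst x, (snd x)(i := t)) \<partial>lborel)"
        by (intro avg_Inr_lborel elim; measurable)+
      then show ?case using elim(1) unfolding bump_test(2) by (simp only:)
    qed
  qed
  then show ?thesis using f h by (simp add: coordinate_gradient_def)
qed

text \<open>
  \<open>energy_inequality\<close> holds for the average \<open>f\<^sub>n\<close> of \<open>f\<close> over the coordinates outside \<open>mixed_index S n\<close>. Averaging
  commutes with \<open>\<Delta>\<^sub>k\<close> and with the gradients and contracts \<open>L\<^sup>1\<close> and \<open>L\<^sup>2\<close> norms, so the bounds \<open>D\<close> and \<open>E\<close>
  for \<open>f\<close> serve for all \<open>f\<^sub>n\<close>; only the variance depends on \<open>n\<close>, and it converges.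
\<close>

lemma mixed_energy_inequality:
  fixes p :: real and h :: "'s + nat \<Rightarrow> ('s \<Rightarrow> bool) \<times> (nat \<Rightarrow> real) \<Rightarrow> real" and S :: "'s set"
  defines "M \<equiv> mixed_product p S"
  defines "A \<equiv> resampling.avg M mixed_mrg"
  assumes S: "countable S" and p: "0 < p" "p < 1" and r: "r > 0" and f: "f \<in> L2_functions M"
    and h: "\<And>n k. k \<in> mixed_index S n \<Longrightarrow> coordinate_gradient p S k f (h k)"
    and D: "\<And>n. (\<Sum>k\<in>mixed_index S n. (\<integral>x. \<bar>f x - A (-{k}) f x\<bar> \<partial>M)\<^sup>2) \<le> D"
    and E: "\<And>n. (\<Sum>k\<in>mixed_index S n. log_sobolev_constant p k * (\<integral>x. (h k x)\<^sup>2 \<partial>M)) \<le> E"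
  shows "prob_space.variance M f * (ln r + 1) - r * D \<le> E"
proof -
  interpret resampling M mixed_mrg unfolding M_def by (rule resampling_mixed_product)
  have A: "A = avg" by (simp add: A_def)
  have fi: "integrable M f" by (rule L2_functions_integrable[OF f])
  let ?J = "mixed_index S"
  have c: "log_sobolev_constant p k \<ge> 0" for k :: "'s + nat"
    using c_LS_ge_2[OF p] by (simp add: log_sobolev_constant_def split: sum.split)
  have step: "variance (avg (?J n) f) * (ln r + 1) - r * D \<le> E" for n
  proof -
    have J: "finite (?J n)" by (rule finite_mixed_index[OF S])
    have "variance (avg (?J n) f) * (ln r + 1) - r * (\<Sum>k\<in>?J n. (\<integral>x. \<bar>avg (?J n) f x - avg (-{k}) (avg (?J n) f) x\<bar> \<partial>M)\<^sup>2)
      \<le> (\<Sum>k\<in>?J n. log_sobolev_constant p k * (\<integral>x. (avg (?J n) (h k) x)\<^sup>2 \<partial>M))"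
    proof (rule energy_inequality[where R="coordinate_gradient p S"])
      show "AE x in M. avg (?J n) (avg (?J n) f) x = avg (?J n) f x" using avg_avg[OF fi, of "?J n" "?J n"] by simp
      show "coordinate_gradient p S k (avg (?J n) f) (avg (?J n) (h k))" if "k \<in> ?J n" for k
        using coordinate_gradient_avg[OF h[OF that] that] by (simp add: M_def)
      show "avg (?J n) f \<in> L2_functions M" by (rule avg_L2[OF f])
    next
      fix k and f h :: "('s \<Rightarrow> bool) \<times> (nat \<Rightarrow> real) \<Rightarrow> real"
      assume R: "coordinate_gradient p S k f h"
      then show "f \<in> L2_functions M \<and> h \<in> L2_functions M" by (simp add: coordinate_gradient_def M_def)
      show "coordinate_gradient p S k (\<lambda>x. f x - avg (-{k}) f x) h"
        using coordinate_gradient_self[OF R] by (simp add: M_def)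
      show "coordinate_gradient p S k (avg (-{l}) f) (avg (-{l}) h)" if "k \<noteq> l" for l
        using coordinate_gradient_avg[OF R, of "-{l}"] that by (simp add: M_def)
      show "(\<integral>\<^sup>+ x. ennreal (rel_ent ((f x)\<^sup>2) (avg (-{k}) (\<lambda>x. (f x)\<^sup>2) x)) \<partial>M) \<le> ennreal (log_sobolev_constant p k * (\<integral>x. (h x)\<^sup>2 \<partial>M))"
        using coordinate_log_sobolev[OF p R] by (simp add: M_def)
      show "coordinate_gradient p S k (\<lambda>x. f x - f' x) (\<lambda>x. h x - h' x)" if "coordinate_gradient p S k f' h'" for f' h'
        by (rule coordinate_gradient_diff[OF R that])
    qed (use c r J in auto)
    also have "\<dots> \<le> (\<Sum>k\<in>?J n. log_sobolev_constant p k * (\<integral>x. (h k x)\<^sup>2 \<partial>M))"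
    proof (intro sum_mono mult_left_mono c)
      fix k assume "k \<in> ?J n"
      then have "h k \<in> L2_functions M" using h by (auto simp: coordinate_gradient_def M_def)
      from integral_square_minus_avg[OF this, of "?J n"]
      have "(\<integral>x. (h k x)\<^sup>2 \<partial>M) - (\<integral>x. (avg (?J n) (h k) x)\<^sup>2 \<partial>M) = (\<integral>x. (h k x - avg (?J n) (h k) x)\<^sup>2 \<partial>M)" by simp
      also have "\<dots> \<ge> 0" by simp
      finally show "(\<integral>x. (avg (?J n) (h k) x)\<^sup>2 \<partial>M) \<le> (\<integral>x. (h k x)\<^sup>2 \<partial>M)" by simp
    qed
    also have "\<dots> \<le> E" by (rule E)
    finally have 1: "variance (avg (?J n) f) * (ln r + 1) - r * (\<Sum>k\<in>?J n. (\<integral>x. \<bar>avg (?J n) f x - avg (-{k}) (avg (?J n) f) x\<bar> \<partial>M)\<^sup>2) \<le> E" .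
    have "(\<integral>x. \<bar>avg (?J n) f x - avg (-{k}) (avg (?J n) f) x\<bar> \<partial>M) \<le> (\<integral>x. \<bar>f x - avg (-{k}) f x\<bar> \<partial>M)" for k
    proof -
      have [measurable]: "f \<in> borel_measurable M" using fi by auto
      have "AE x in M. avg (?J n) f x - avg (-{k}) (avg (?J n) f) x = avg (?J n) (\<lambda>x. f x - avg (-{k}) f x) x"
        using avg_commute[OF fi, of "-{k}" "?J n"] avg_diff[OF fi integrable_avg[OF fi], of "?J n" "-{k}"]
        by eventually_elim simp
      then have "(\<integral>x. \<bar>avg (?J n) f x - avg (-{k}) (avg (?J n) f) x\<bar> \<partial>M) = (\<integral>x. \<bar>avg (?J n) (\<lambda>x. f x - avg (-{k}) f x) x\<bar> \<partial>M)"
        by (intro integral_cong_AE) (auto elim!: eventually_mono)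
      also have "\<dots> \<le> (\<integral>x. \<bar>f x - avg (-{k}) f x\<bar> \<partial>M)"
        by (intro integral_abs_avg_le Bochner_Integration.integrable_diff fi integrable_avg)
      finally show ?thesis .
    qed
    then have "(\<Sum>k\<in>?J n. (\<integral>x. \<bar>avg (?J n) f x - avg (-{k}) (avg (?J n) f) x\<bar> \<partial>M)\<^sup>2) \<le> (\<Sum>k\<in>?J n. (\<integral>x. \<bar>f x - avg (-{k}) f x\<bar> \<partial>M)\<^sup>2)"
      by (intro sum_mono power_mono) auto
    also have "\<dots> \<le> D" using D unfolding A .
    finally have "r * (\<Sum>k\<in>?J n. (\<integral>x. \<bar>avg (?J n) f x - avg (-{k}) (avg (?J n) f) x\<bar> \<partial>M)\<^sup>2) \<le> r * D"
      using r by (intro mult_left_mono) auto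
    with 1 show ?thesis by linarith
  qed
  have var: "variance (avg (?J n) f) = variance f - (\<integral>x. (f x - avg (?J n) f x)\<^sup>2 \<partial>M)" for n
    using variance_eq[OF fi L2_functionsD(2)[OF f]]
      variance_eq[OF L2_functions_integrable[OF avg_L2[OF f]] L2_functionsD(2)[OF avg_L2[OF f]], of "?J n"]
      integral_avg[OF fi, of "?J n"] integral_square_minus_avg[OF f, of "?J n"] by simp
  have "(\<lambda>n. \<integral>x. (f x - avg (?J n) f x)\<^sup>2 \<partial>M) \<longlonglongrightarrow> 0"
    using sets_mixed_product_cylinders[OF S, of p] f unfolding M_def[symmetric] by (intro avg_tendsto_L2)
  then have "(\<lambda>n. variance (avg (?J n) f)) \<longlonglongrightarrow> variance f - 0"
    unfolding var by (intro tendsto_diff tendsto_const)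
  then have "(\<lambda>n. variance (avg (?J n) f) * (ln r + 1) - r * D) \<longlonglongrightarrow> variance f * (ln r + 1) - r * D"
    by (intro tendsto_intros) simp
  then show ?thesis using step by (intro LIMSEQ_le_const2) auto
qed

theorem corollary2p2:
  fixes S :: "'s set" and p :: real
    and f :: "('s \<Rightarrow> bool) \<times> (nat \<Rightarrow> real) \<Rightarrow> real"
    and df :: "nat \<Rightarrow> ('s \<Rightarrow> bool) \<times> (nat \<Rightarrow> real) \<Rightarrow> real"
  defines "M \<equiv> mixed_product p S"
  defines "V \<equiv> prob_space.variance M f"
  assumes "countable S"
    and "0 < p" and "p < 1"
    and "f \<in> H12 p S"
    and "\<And>i. weak_partial p S i f (df i)"
  shows "(if V = 0 then 0
          else ereal V * ext_ln (ennreal V /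
                 ((\<Sum>\<^sub>\<infinity>s\<in>S. (L1_norm M (Delta_bool p s f))\<^sup>2)
                  + (\<Sum>\<^sub>\<infinity>i\<in>UNIV. (L1_norm M (Delta_gauss i f))\<^sup>2))))
         \<le> ereal (c_LS p) * enn2ereal (\<Sum>\<^sub>\<infinity>s\<in>S. expect_sq M (Delta_bool p s f))
           + 2 * enn2ereal (\<Sum>\<^sub>\<infinity>i\<in>UNIV. expect_sq M (df i))"
proof -
  note S = assms(3) and p = assms(4,5)
  interpret resampling M mixed_mrg unfolding M_def by (rule resampling_mixed_product)
  have f: "f \<in> L2_functions M" using assms(6) by (simp add: H12_def M_def)
  have [measurable]: "f \<in> borel_measurable M" using f by (rule L2_functionsD)
  have fi: "integrable M f" by (rule L2_functions_integrable[OF f])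
  define h where "h k = (case k of Inl s \<Rightarrow> (\<lambda>x. f x - avg (-{Inl s}) f x) | Inr i \<Rightarrow> df i)" for k
  define d where "d k = (\<integral>x. \<bar>f x - avg (-{k}) f x\<bar> \<partial>M)" for k
  have cpos: "c_LS p > 0" using c_LS_ge_2[OF p] by simp
  have h: "coordinate_gradient p S k f (h k)" if "k \<in> mixed_index S n" for k n
  proof (cases k)
    case (Inl s)
    then have "s \<in> S" using that by (auto simp: mixed_index_def)
    then show ?thesis
      using Inl f L2_functions_diff[OF f avg_L2[OF f]] by (simp add: coordinate_gradient_def h_def M_def)
  next
    case (Inr i)
    then show ?thesis using coordinate_gradient_weak_partial[OF _ assms(7)] f by (simp add: h_def M_def)
  qed
  define SD where "SD = (\<Sum>\<^sub>\<infinity>s\<in>S. (L1_norm M (Delta_bool p s f))\<^sup>2) + (\<Sum>\<^sub>\<infinity>i\<in>UNIV. (L1_norm M (Delta_gauss i f))\<^sup>2)"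
  define EB where "EB = (\<Sum>\<^sub>\<infinity>s\<in>S. expect_sq M (Delta_bool p s f))"
  define EG where "EG = (\<Sum>\<^sub>\<infinity>i\<in>UNIV. expect_sq M (df i))"
  have index_sum: "(\<Sum>k\<in>mixed_index S n. g k) = (\<Sum>s\<in>{s \<in> S. to_nat_on S s < n}. g (Inl s)) + (\<Sum>i<n. g (Inr i))"
    for n and g :: "'s + nat \<Rightarrow> 'b :: comm_monoid_add"
  proof -
    have "(\<Sum>k\<in>mixed_index S n. g k) = sum g (Inl ` {s \<in> S. to_nat_on S s < n}) + sum g (Inr ` {..<n})"
      unfolding mixed_index_def using finite_mixed_index[OF S, of n]
      by (intro sum.union_disjoint) (auto simp: mixed_index_def)
    then show ?thesis by (simp add: sum.reindex)
  qed
  have fin: "finite {s \<in> S. to_nat_on S s < n}" for n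
    using finite_mixed_index[OF S, of n] by (auto simp: mixed_index_def dest: finite_imageD)
  have L1: "(\<integral>\<^sup>+x. ennreal \<bar>f x - avg (-{k}) f x\<bar> \<partial>M) = ennreal (d k)" for k
    unfolding d_def by (intro nn_integral_eq_integral integrable_abs Bochner_Integration.integrable_diff fi integrable_avg) auto
  have L1b: "L1_norm M (Delta_bool p s f) = ennreal (d (Inl s))" if "s \<in> S" for s
    unfolding L1_norm_def L1[symmetric] Delta_bool_eq_avg[OF that] M_def ..
  have L1g: "L1_norm M (Delta_gauss i f) = ennreal (d (Inr i))" for i
    unfolding L1_norm_def L1[symmetric]
  proof (rule nn_integral_cong)
    fix x assume x: "x \<in> space M"
    have "avg (-{Inr i}) f x = (\<integral>t. f (fst x, (snd x)(i := t)) \<partial>gauss)"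
      using avg_Inr[of f p S x i] x by (simp add: M_def[symmetric])
    then show "ennreal \<bar>Delta_gauss i f x\<bar> = ennreal \<bar>f x - avg (-{Inr i}) f x\<bar>"
      by (simp add: Delta_gauss_def split_beta')
  qed
  have d0: "d k \<ge> 0" for k by (simp add: d_def)
  have D_le: "ennreal (\<Sum>k\<in>mixed_index S n. (d k)\<^sup>2) \<le> SD" for n
  proof -
    have "ennreal (\<Sum>k\<in>mixed_index S n. (d k)\<^sup>2) = (\<Sum>k\<in>mixed_index S n. (ennreal (d k))\<^sup>2)"
      using d0 by (subst sum_ennreal[symmetric]) (simp_all add: ennreal_power)
    also have "\<dots> = (\<Sum>s\<in>{s \<in> S. to_nat_on S s < n}. (L1_norm M (Delta_bool p s f))\<^sup>2) + (\<Sum>i<n. (L1_norm M (Delta_gauss i f))\<^sup>2)"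
      unfolding index_sum L1g by (intro arg_cong2[where f="(+)"] sum.cong refl) (simp add: L1b)
    also have "\<dots> \<le> SD" unfolding SD_def by (intro add_mono sum_le_infsum_ennreal fin) auto
    finally show ?thesis .
  qed
  have hL2: "h k \<in> L2_functions M" if "k \<in> mixed_index S n" for k n
    using h[OF that] by (simp add: coordinate_gradient_def M_def)
  have e: "expect_sq M g = ennreal (\<integral>x. (g x)\<^sup>2 \<partial>M)" if "g \<in> L2_functions M" for g
    unfolding expect_sq_def using L2_functionsD(2)[OF that] by (intro nn_integral_eq_integral) auto
  have DB: "Delta_bool p s f = h (Inl s)" if "s \<in> S" for s
    using Delta_bool_eq_avg[OF that, of p f] by (simp add: h_def M_def)
  have hG: "h (Inr i) = df i" for i by (simp add: h_def)
  have E_le: "ennreal (\<Sum>k\<in>mixed_index S n. log_sobolev_constant p k * (\<integral>x. (h k x)\<^sup>2 \<partial>M)) \<le> ennreal (c_LS p) * EB + 2 * EG" for n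
  proof -
    have "ennreal (\<Sum>k\<in>mixed_index S n. log_sobolev_constant p k * (\<integral>x. (h k x)\<^sup>2 \<partial>M))
      = (\<Sum>k\<in>mixed_index S n. ennreal (log_sobolev_constant p k) * expect_sq M (h k))"
    proof (subst sum_ennreal[symmetric])
      have c0: "log_sobolev_constant p k \<ge> 0" for k :: "'s + nat"
        using cpos by (simp add: log_sobolev_constant_def split: sum.split)
      then show "0 \<le> log_sobolev_constant p k * (\<integral>x. (h k x)\<^sup>2 \<partial>M)" for k by simp
      show "(\<Sum>k\<in>mixed_index S n. ennreal (log_sobolev_constant p k * (\<integral>x. (h k x)\<^sup>2 \<partial>M)))
        = (\<Sum>k\<in>mixed_index S n. ennreal (log_sobolev_constant p k) * expect_sq M (h k))"
        using c0 by (intro sum.cong refl) (simp add: e[OF hL2] ennreal_mult)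
    qed
    also have "\<dots> = ennreal (c_LS p) * (\<Sum>s\<in>{s \<in> S. to_nat_on S s < n}. expect_sq M (Delta_bool p s f)) + 2 * (\<Sum>i<n. expect_sq M (df i))"
      unfolding index_sum sum_distrib_left
      by (intro arg_cong2[where f="(+)"] sum.cong refl) (simp_all add: log_sobolev_constant_def DB hG)
    also have "\<dots> \<le> ennreal (c_LS p) * EB + 2 * EG"
      unfolding EB_def EG_def by (intro add_mono mult_left_mono sum_le_infsum_ennreal fin) auto
    finally show ?thesis .
  qed
  have RHS: "ereal (c_LS p) * enn2ereal EB + 2 * enn2ereal EG = enn2ereal (ennreal (c_LS p) * EB + 2 * EG)"
    using cpos by (simp add: plus_ennreal.rep_eq times_ennreal.rep_eq enn2ereal_ennreal enn2ereal_numeral)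
  have V0: "V \<ge> 0" unfolding V_def by (rule variance_positive)
  have main: "(if V = 0 then 0 else ereal V * ext_ln (ennreal V / SD)) \<le> enn2ereal (ennreal (c_LS p) * EB + 2 * EG)"
  proof (cases "V = 0 \<or> SD = \<infinity> \<or> ennreal (c_LS p) * EB + 2 * EG = \<infinity>")
    case True
    then consider "V = 0" | "V \<noteq> 0" "SD = \<infinity>" | "ennreal (c_LS p) * EB + 2 * EG = \<infinity>" by blast
    then show ?thesis
    proof cases
      case 2
      then show ?thesis using V0 by (simp add: ext_ln_def)
    next
      case 3
      then have "enn2ereal (ennreal (c_LS p) * EB + 2 * EG) = \<infinity>" by (simp only: infinity_ennreal_def top_ennreal.rep_eq top_ereal_def)
      then show ?thesis by (simp only: ereal_less_eq)
    qed simp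
  next
    case False
    then have V: "V > 0" using V0 by simp
    obtain D where D: "SD = ennreal D" "D \<ge> 0" using False by (cases SD) auto
    obtain E where E: "ennreal (c_LS p) * EB + 2 * EG = ennreal E" "E \<ge> 0"
      using False by (cases "ennreal (c_LS p) * EB + 2 * EG") auto
    have bound: "V * (ln r + 1) - r * D \<le> E" if r: "r > 0" for r
      unfolding V_def M_def
    proof (rule mixed_energy_inequality[OF S p r])
      show "f \<in> L2_functions (mixed_product p S)" using f by (simp add: M_def)
      show "coordinate_gradient p S k f (h k)" if "k \<in> mixed_index S n" for n k by (rule h[OF that])
      show "(\<Sum>k\<in>mixed_index S n. (\<integral>x. \<bar>f x - resampling.avg (mixed_product p S) mixed_mrg (- {k}) f x\<bar> \<partial>mixed_product p S)\<^sup>2) \<le> D" for n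
        using D_le[of n] D by (simp add: d_def M_def)
      show "(\<Sum>k\<in>mixed_index S n. log_sobolev_constant p k * (\<integral>x. (h k x)\<^sup>2 \<partial>mixed_product p S)) \<le> E" for n
        using E_le[of n] E by (simp add: M_def)
    qed
    \<comment> \<open>for \<open>D = 0\<close> the bound would hold for all \<open>r\<close>, which is absurd for large \<open>r\<close>\<close>
    have D0: "D > 0"
    proof (rule ccontr)
      assume "\<not> D > 0"
      then have "D = 0" using D by simp
      then have "V * (E / V + 1) \<le> E" using bound[of "exp (E / V)"] by simp
      then show False using V by (simp add: distrib_left)
    qed
    \<comment> \<open>\<open>r = V / D\<close> is the optimal choice; the terms \<open>V\<close> and \<open>r D\<close> cancel\<close>
    have "V * ln (V / D) \<le> E" using bound[of "V / D"] V D0 by (simp add: distrib_left)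
    moreover have "ext_ln (ennreal V / SD) = ereal (ln (V / D))"
      using V D D0 by (simp add: ext_ln_def divide_ennreal)
    ultimately show ?thesis using V E by (simp add: enn2ereal_ennreal)
  qed
  show ?thesis using main unfolding SD_def EB_def[symmetric] EG_def[symmetric] RHS .
qed

end
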